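(* Let $G$ be a totally torsion free profinite $l$-group. Then the continuous affine $G$-scheme $\mathcal{E}G$ is etale.
   Context: Throughout $k$ is a fixed algebraically closed field and $l$ is a prime different from the characteristic of $k$. A profinite $l$-group (pro-$l$ group) $G$ is totally torsion free if for every closed subgroup $K\subseteq G$ the profinite abelianization $K^{ab}=K/\overline{[K,K]}$ is torsion free. A continuous affine $G$-scheme is $\mathrm{Spec}(A)$, where $A$ is a commutative ring with the discrete topology and a continuous $G$-action. It is etale if for every closed normal subgroup $N\subseteq G$ of finite index the inclusion $A^G\hookrightarrow A^N$ is a Galois (etale) cover with group $G/N$. \emph{$l$-BARs.} A based affine $\mathbb{Z}_l$-module is $(F,X,B)$ with $F$ a finitely generated free $\mathbb{Z}_l$-module, $X$ a continuous simply transitive $F$-space (each map $F\to X$, $f\mapsto f\cdot x$, is a homeomorphism) and $B$ a basis of $F$. Its automorphism group $\mathfrak{A}$ consists of pairs $(\varphi,\chi)$ with $\varphi$ a continuous $\mathbb{Z}_l$-automorphism of $F$ permuting $B$ and $\chi$ a homeomorphism of $X$ with $\chi(f\cdot x)=\varphi(f)\cdot\chi(x)$; choosing a base point, $\mathfrak{A}\cong\Sigma_B\ltimes F$. An $l$-BAR of a pro-$l$ group $G$ is a continuous homomorphism $\eta:G\to\mathfrak{A}$. For a closed subgroup $K\subseteq G$, $\eta$ is $K$-principal if the stabilizer in $G$ of every $x\in X$ equals $K$. Fix compatible primitive $l^s$-th roots of unity $\zeta_s\in k$, $\zeta_{s+1}^l=\zeta_s$. Let $\rho_s$ be the representation of $\mathfrak{A}$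 on the $k$-vector space with basis $\{e_b\}_{b\in B}$ where $f=\sum f_b b\in F$ acts by $e_b\mapsto\zeta_s^{f_b}e_b$ and $\sigma\in\Sigma_B$ by $e_b\mapsto e_{\sigma(b)}$. Let $\mathcal{T}_\eta=\mathrm{Spec}\bigcup_s k[t_b^{\pm 1/l^s};b\in B]$ with $G$ acting through $\eta$ and the $\mathfrak A$-action $f\cdot t_b^{1/l^s}=\zeta_s^{f_b}t_b^{1/l^s}$, $\sigma\cdot t_b^{1/l^s}=t_{\sigma(b)}^{1/l^s}$. \emph{$\mathcal{E}G$.} For each closed normal subgroup $N$ of finite index in $G$ choose an $l$-BAR $\eta_N$ of $G$ which is $N'$-principal for some closed normal subgroup $N'\subseteq N$ of $G$. For each isomorphism class $\alpha$ of finite dimensional continuous $k$-linear representations of $G$ choose an $l$-BAR $\eta_\alpha$ with $\rho_s\circ\eta_\alpha\in\alpha$ for some $s$. (Such choices exist.) Then $\mathcal{E}G=\prod_N\mathcal{T}_{\eta_N}\times\prod_\alpha\mathcal{T}_{\eta_\alpha}$, the (possibly infinite) product of affine $k$-schemes with diagonal $G$-action. *)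

theory Defs
  imports
    "HOL-Analysis.Abstract_Topology_2"
    "HOL-Analysis.T1_Spaces"
    "HOL-Analysis.Function_Topology"
    "HOL-Algebra.Module"
    "HOL-Algebra.Generated_Groups"
    "HOL-Algebra.Free_Abelian_Groups"
    "HOL-Computational_Algebra.Computational_Algebra"
    "HOL-Library.Poly_Mapping"
    "Jordan_Normal_Form.Matrix"
begin

section \<open>Profinite groups\<close>

definition topological_group :: "('g, 'm) monoid_scheme \<Rightarrow> 'g topology \<Rightarrow> bool" where
  "topological_group G T \<longleftrightarrow>
     group G \<and> topspace T = carrier G \<and>
     continuous_map (prod_topology T T) T (\<lambda>(x, y). x \<otimes>\<^bsub>G\<^esub> y) \<and>
     continuous_map T T (\<lambda>x. inv\<^bsub>G\<^esub> x)"

definition profinite_group :: "('g, 'm) monoid_scheme \<Rightarrow> 'g topology \<Rightarrow> bool" where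
  "profinite_group G T \<longleftrightarrow>
     topological_group G T \<and> compact_space T \<and> Hausdorff_space T \<and>
     (\<forall>S. connectedin T S \<longrightarrow> (\<forall>x\<in>S. \<forall>y\<in>S. x = y))"

definition pro_l_group :: "nat \<Rightarrow> ('g, 'm) monoid_scheme \<Rightarrow> 'g topology \<Rightarrow> bool" where
  "pro_l_group l G T \<longleftrightarrow>
     profinite_group G T \<and>
     (\<forall>U. U \<lhd> G \<and> openin T U \<longrightarrow> (\<exists>n. card (rcosets\<^bsub>G\<^esub> U) = l ^ n))"

definition torsion_free_group :: "('g, 'm) monoid_scheme \<Rightarrow> bool" where
  "torsion_free_group H \<longleftrightarrow>
     (\<forall>x\<in>carrier H. \<forall>n::nat. n > 0 \<and> x [^]\<^bsub>H\<^esub> n = \<one>\<^bsub>H\<^esub> \<longrightarrow> x = \<one>\<^bsub>H\<^esub>)"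

definition profinite_ab :: "('g, 'm) monoid_scheme \<Rightarrow> 'g topology \<Rightarrow> 'g set \<Rightarrow> 'g set monoid" where
  "profinite_ab G T K = (G\<lparr>carrier := K\<rparr>) Mod (T closure_of (derived G K))"

definition totally_torsion_free :: "('g, 'm) monoid_scheme \<Rightarrow> 'g topology \<Rightarrow> bool" where
  "totally_torsion_free G T \<longleftrightarrow>
     (\<forall>K. subgroup K G \<and> closedin T K \<longrightarrow> torsion_free_group (profinite_ab G T K))"

definition closed_normal :: "('g, 'm) monoid_scheme \<Rightarrow> 'g topology \<Rightarrow> 'g set \<Rightarrow> bool" where
  "closed_normal G T N \<longleftrightarrow> N \<lhd> G \<and> closedin T N"

definition closed_normal_fin :: "('g, 'm) monoid_scheme \<Rightarrow> 'g topology \<Rightarrow> 'g set \<Rightarrow> bool" where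
  "closed_normal_fin G T N \<longleftrightarrow> closed_normal G T N \<and> finite (rcosets\<^bsub>G\<^esub> N)"


section \<open>Galois covers and etale continuous affine \<open>G\<close>-schemes\<close>

text \<open>Commutative rings are unital subrings of a type of class \<^class>\<open>comm_ring_1\<close>.\<close>

definition unital_subring :: "'a::comm_ring_1 set \<Rightarrow> bool" where
  "unital_subring S \<longleftrightarrow>
     0 \<in> S \<and> 1 \<in> S \<and> (\<forall>a\<in>S. \<forall>b\<in>S. a + b \<in> S \<and> a - b \<in> S \<and> a * b \<in> S)"

definition acts_on_ring ::
    "('g, 'm) monoid_scheme \<Rightarrow> 'a::comm_ring_1 set \<Rightarrow> ('g \<Rightarrow> 'a \<Rightarrow> 'a) \<Rightarrow> bool" where
  "acts_on_ring G S act \<longleftrightarrow>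
     (\<forall>g\<in>carrier G. \<forall>a\<in>S. act g a \<in> S) \<and>
     (\<forall>a\<in>S. act \<one>\<^bsub>G\<^esub> a = a) \<and>
     (\<forall>g\<in>carrier G. \<forall>h\<in>carrier G. \<forall>a\<in>S. act (g \<otimes>\<^bsub>G\<^esub> h) a = act g (act h a)) \<and>
     (\<forall>g\<in>carrier G. act g 1 = 1 \<and>
        (\<forall>a\<in>S. \<forall>b\<in>S. act g (a + b) = act g a + act g b \<and> act g (a * b) = act g a * act g b))"

definition additive_group :: "'a::comm_ring_1 set \<Rightarrow> 'a monoid" where
  "additive_group S = \<lparr>carrier = S, monoid.mult = (+), one = 0\<rparr>"

text \<open>
  The tensor product \<open>S \<otimes>\<^sub>R S\<close>: the free abelian group on the pairs \<open>(a, b)\<close>, written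
  \<^term>\<open>frag_of (a, b)\<close>, modulo bilinearity and \<open>R\<close>-balancedness.
\<close>

definition tensor_relations :: "'a::comm_ring_1 set \<Rightarrow> 'a set \<Rightarrow> ('a \<times> 'a \<Rightarrow>\<^sub>0 int) set" where
  "tensor_relations R S = generate (free_Abelian_group (S \<times> S))
     ({frag_of (a + a', b) - frag_of (a, b) - frag_of (a', b) | a a' b. a \<in> S \<and> a' \<in> S \<and> b \<in> S} \<union>
      {frag_of (a, b + b') - frag_of (a, b) - frag_of (a, b') | a b b'. a \<in> S \<and> b \<in> S \<and> b' \<in> S} \<union>
      {frag_of (a * r, b) - frag_of (a, r * b) | a b r. a \<in> S \<and> b \<in> S \<and> r \<in> R})"

definition tensor_product :: "'a::comm_ring_1 set \<Rightarrow> 'a set \<Rightarrow> ('a \<times> 'a \<Rightarrow>\<^sub>0 int) set monoid" where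
  "tensor_product R S = free_Abelian_group (S \<times> S) Mod tensor_relations R S"

definition fin_projective :: "'a::comm_ring_1 set \<Rightarrow> 'a set \<Rightarrow> bool" where
  "fin_projective R S \<longleftrightarrow>
     (\<exists>(n::nat) x \<phi>.
        (\<forall>j<n. x j \<in> S) \<and>
        (\<forall>j<n. \<forall>s\<in>S. \<phi> j s \<in> R) \<and>
        (\<forall>j<n. \<forall>s\<in>S. \<forall>t\<in>S. \<phi> j (s + t) = \<phi> j s + \<phi> j t) \<and>
        (\<forall>j<n. \<forall>r\<in>R. \<forall>s\<in>S. \<phi> j (r * s) = r * \<phi> j s) \<and>
        (\<forall>s\<in>S. s = (\<Sum>j<n. \<phi> j s * x j)))"
  \<comment> \<open>\<open>\<phi>\<close> is an \<open>R\<close>-linear section of the map \<open>R\<^sup>n \<rightarrow> S\<close> given by \<open>x\<close>: \<open>S\<close> is a direct summand of \<open>R\<^sup>n\<close>\<close>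

definition separable_algebra :: "'a::comm_ring_1 set \<Rightarrow> 'a set \<Rightarrow> bool" where
  "separable_algebra R S \<longleftrightarrow>
     (\<exists>(n::nat) x y.
        (\<forall>j<n. x j \<in> S \<and> y j \<in> S) \<and>
        (\<Sum>j<n. x j * y j) = 1 \<and>
        (\<forall>s\<in>S. (\<Sum>j<n. frag_of (s * x j, y j)) - (\<Sum>j<n. frag_of (x j, y j * s))
                 \<in> tensor_relations R S))"
  \<comment> \<open>\<open>\<Sum>\<^sub>j x\<^sub>j \<otimes> y\<^sub>j\<close> is a separability idempotent, i.e. \<open>S\<close> is a projective \<open>S \<otimes>\<^sub>R S\<close>-module\<close>

definition finite_etale :: "'a::comm_ring_1 set \<Rightarrow> 'a set \<Rightarrow> bool" where
  "finite_etale R S \<longleftrightarrow> fin_projective R S \<and> separable_algebra R S"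

definition torsor_map ::
    "('c, 'm) monoid_scheme \<Rightarrow> ('c \<Rightarrow> 'a \<Rightarrow> 'a) \<Rightarrow> ('a::comm_ring_1 \<times> 'a \<Rightarrow>\<^sub>0 int) \<Rightarrow> 'c \<Rightarrow> 'a" where
  "torsor_map \<Gamma> act p =
     (\<lambda>\<gamma>\<in>carrier \<Gamma>. \<Sum>(a, b)\<in>Poly_Mapping.keys p.
        of_int (Poly_Mapping.lookup p (a, b)) * (a * act \<gamma> b))"

text \<open>
  A Galois cover with group \<open>\<Gamma>\<close> is a finite etale cover that is a \<open>\<Gamma>\<close>-torsor: the map
  \<open>S \<otimes>\<^sub>R S \<rightarrow> \<Prod>\<^sub>\<Gamma> S\<close>, \<open>a \<otimes> b \<mapsto> (a \<cdot> \<gamma>(b))\<^sub>\<gamma>\<close>, is bijective.  Surjectivity of \<open>Spec S \<rightarrow> Spec R\<close>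
  is automatic, since \<open>R \<subseteq> S\<close> is a finite extension.
\<close>

definition galois_cover ::
    "'a::comm_ring_1 set \<Rightarrow> 'a set \<Rightarrow> ('c, 'm) monoid_scheme \<Rightarrow> ('c \<Rightarrow> 'a \<Rightarrow> 'a) \<Rightarrow> bool" where
  "galois_cover R S \<Gamma> act \<longleftrightarrow>
     unital_subring R \<and> unital_subring S \<and> R \<subseteq> S \<and>
     group \<Gamma> \<and> finite (carrier \<Gamma>) \<and>
     acts_on_ring \<Gamma> S act \<and> (\<forall>\<gamma>\<in>carrier \<Gamma>. \<forall>r\<in>R. act \<gamma> r = r) \<and>
     finite_etale R S \<and>
     (\<lambda>X. the_elem (torsor_map \<Gamma> act ` X))
       \<in> iso (tensor_product R S) (product_group (carrier \<Gamma>) (\<lambda>_. additive_group S))"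

definition continuous_affine_G_scheme ::
    "('g, 'm) monoid_scheme \<Rightarrow> 'g topology \<Rightarrow> 'a::comm_ring_1 set \<Rightarrow> ('g \<Rightarrow> 'a \<Rightarrow> 'a) \<Rightarrow> bool" where
  "continuous_affine_G_scheme G T A act \<longleftrightarrow>
     unital_subring A \<and> acts_on_ring G A act \<and>
     continuous_map (prod_topology T (discrete_topology A)) (discrete_topology A)
       (\<lambda>(g, a). act g a)"

definition invariants :: "'a set \<Rightarrow> ('g \<Rightarrow> 'a \<Rightarrow> 'a) \<Rightarrow> 'g set \<Rightarrow> 'a set" where
  "invariants A act N = {a \<in> A. \<forall>g\<in>N. act g a = a}"

text \<open>The action of a coset \<open>C \<in> G/N\<close> on \<open>A\<^sup>N\<close>, through any representative.\<close>

definition coset_act :: "('g \<Rightarrow> 'a \<Rightarrow> 'a) \<Rightarrow> 'g set \<Rightarrow> 'a \<Rightarrow> 'a" where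
  "coset_act act C a = act (SOME g. g \<in> C) a"

definition etale_G_scheme ::
    "('g, 'm) monoid_scheme \<Rightarrow> 'g topology \<Rightarrow> 'a::comm_ring_1 set \<Rightarrow> ('g \<Rightarrow> 'a \<Rightarrow> 'a) \<Rightarrow> bool" where
  "etale_G_scheme G T A act \<longleftrightarrow>
     continuous_affine_G_scheme G T A act \<and>
     (\<forall>N. closed_normal_fin G T N \<longrightarrow>
        galois_cover (invariants A act (carrier G)) (invariants A act N) (G Mod N) (coset_act act))"


section \<open>The \<open>l\<close>-adic integers\<close>

text \<open>\<open>\<int>\<^sub>l\<close> as the inverse limit of the rings \<open>\<int>/l\<^sup>s\<close>; \<open>a s\<close> is the residue of \<open>a\<close> modulo \<open>l\<^sup>s\<close>.\<close>

definition Zl :: "nat \<Rightarrow> (nat \<Rightarrow> int) ring" where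
  "Zl l = \<lparr>carrier = {a. \<forall>s. a s \<in> {0..<int l ^ s} \<and> a (Suc s) mod int l ^ s = a s},
           monoid.mult = (\<lambda>a b s. (a s * b s) mod int l ^ s),
           one = (\<lambda>s. 1 mod int l ^ s),
           zero = (\<lambda>s. 0),
           add = (\<lambda>a b s. (a s + b s) mod int l ^ s)\<rparr>"

definition Zl_top :: "nat \<Rightarrow> (nat \<Rightarrow> int) topology" where
  "Zl_top l = subtopology (product_topology (\<lambda>_. discrete_topology UNIV) UNIV) (carrier (Zl l))"

lemma Zl_ops_simps:
  "a \<in> carrier (Zl l) \<longleftrightarrow> (\<forall>s. 0 \<le> a s \<and> a s < int l ^ s \<and> a (Suc s) mod int l ^ s = a s)"
  "a \<otimes>\<^bsub>Zl l\<^esub> b = (\<lambda>s. (a s * b s) mod int l ^ s)"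
  "\<one>\<^bsub>Zl l\<^esub> = (\<lambda>s. 1 mod int l ^ s)"
  "\<zero>\<^bsub>Zl l\<^esub> = (\<lambda>s. 0)"
  "a \<oplus>\<^bsub>Zl l\<^esub> b = (\<lambda>s. (a s + b s) mod int l ^ s)"
  by (simp_all add: Zl_def)

lemma cring_Zl:
  assumes "l > 0"
  shows "cring (Zl l)"
proof -
  have pos: "int l ^ s > 0" for s
    using assms by simp
  have mm: "x mod int l ^ Suc s mod int l ^ s = x mod int l ^ s" for x s
    by (simp add: mod_mod_cancel)
  have neg: "(\<lambda>s. (- a s) mod int l ^ s) \<in> carrier (Zl l)" if "a \<in> carrier (Zl l)" for a
    using that pos by (simp add: Zl_ops_simps mm del: power_Suc) (metis mod_minus_eq)
  have cong_add: "a (Suc s) mod int l ^ s = a s \<Longrightarrow> b (Suc s) mod int l ^ s = b s \<Longrightarrow>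
      (a (Suc s) + b (Suc s)) mod int l ^ s = (a s + b s) mod int l ^ s" for a b s
    by (metis mod_add_eq)
  have cong_mult: "a (Suc s) mod int l ^ s = a s \<Longrightarrow> b (Suc s) mod int l ^ s = b s \<Longrightarrow>
      (a (Suc s) * b (Suc s)) mod int l ^ s = (a s * b s) mod int l ^ s" for a b s
    by (metis mod_mult_eq)
  show ?thesis
  proof (rule cringI)
    show "abelian_group (Zl l)"
    proof (rule abelian_groupI)
      fix a b assume "a \<in> carrier (Zl l)" "b \<in> carrier (Zl l)"
      then show "a \<oplus>\<^bsub>Zl l\<^esub> b \<in> carrier (Zl l)"
        using pos by (simp add: Zl_ops_simps mm cong_add del: power_Suc)
    next
      fix a assume a: "a \<in> carrier (Zl l)"
      show "\<exists>b\<in>carrier (Zl l). b \<oplus>\<^bsub>Zl l\<^esub> a = \<zero>\<^bsub>Zl l\<^esub>"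
        by (rule bexI[OF _ neg[OF a]]) (simp add: Zl_ops_simps mod_add_left_eq)
    qed (use pos in \<open>auto simp: Zl_ops_simps fun_eq_iff mod_simps ac_simps\<close>)
    show "comm_monoid (Zl l)"
    proof (rule comm_monoidI)
      fix a b assume "a \<in> carrier (Zl l)" "b \<in> carrier (Zl l)"
      then show "a \<otimes>\<^bsub>Zl l\<^esub> b \<in> carrier (Zl l)"
        using pos by (simp add: Zl_ops_simps mm cong_mult del: power_Suc)
    qed (use pos in \<open>auto simp: Zl_ops_simps fun_eq_iff mod_simps mm ac_simps simp del: power_Suc\<close>)
  qed (auto simp: Zl_ops_simps fun_eq_iff mod_simps algebra_simps)
qed


section \<open>Based affine \<open>\<int>\<^sub>l\<close>-modules and \<open>l\<close>-BARs\<close>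

record ('f, 'x) based_affine =
  ba_lattice :: "(nat \<Rightarrow> int, 'f) module"
  ba_space :: "'x topology"
  ba_act :: "'f \<Rightarrow> 'x \<Rightarrow> 'x"
  ba_basis :: "'f set"

definition is_module_basis :: "nat \<Rightarrow> (nat \<Rightarrow> int, 'f) module \<Rightarrow> 'f set \<Rightarrow> bool" where
  "is_module_basis l F B \<longleftrightarrow>
     finite B \<and> B \<subseteq> carrier F \<and>
     (\<forall>f\<in>carrier F. \<exists>!c. c \<in> B \<rightarrow>\<^sub>E carrier (Zl l) \<and> f = (\<Oplus>\<^bsub>F\<^esub>b\<in>B. c b \<odot>\<^bsub>F\<^esub> b))"

text \<open>The coordinates \<open>(f\<^sub>b)\<close> of \<open>f = \<Sum> f\<^sub>b b\<close>.\<close>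

definition coords :: "nat \<Rightarrow> (nat \<Rightarrow> int, 'f) module \<Rightarrow> 'f set \<Rightarrow> 'f \<Rightarrow> 'f \<Rightarrow> (nat \<Rightarrow> int)" where
  "coords l F B f =
     (THE c. c \<in> B \<rightarrow>\<^sub>E carrier (Zl l) \<and> f = (\<Oplus>\<^bsub>F\<^esub>b\<in>B. c b \<odot>\<^bsub>F\<^esub> b))"

definition lattice_top :: "nat \<Rightarrow> (nat \<Rightarrow> int, 'f) module \<Rightarrow> 'f set \<Rightarrow> 'f topology" where
  "lattice_top l F B =
     pullback_topology (carrier F) (coords l F B) (product_topology (\<lambda>_. Zl_top l) B)"

definition is_based_affine :: "nat \<Rightarrow> ('f, 'x) based_affine \<Rightarrow> bool" where
  "is_based_affine l D \<longleftrightarrow>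
     (let F = ba_lattice D; X = ba_space D; TF = lattice_top l F (ba_basis D) in
       module (Zl l) F \<and> is_module_basis l F (ba_basis D) \<and>
       topspace X \<noteq> {} \<and>
       continuous_map (prod_topology TF X) X (\<lambda>(f, x). ba_act D f x) \<and>
       (\<forall>x\<in>topspace X. ba_act D \<zero>\<^bsub>F\<^esub> x = x) \<and>
       (\<forall>f\<in>carrier F. \<forall>f'\<in>carrier F. \<forall>x\<in>topspace X.
          ba_act D (f \<oplus>\<^bsub>F\<^esub> f') x = ba_act D f (ba_act D f' x)) \<and>
       (\<forall>x\<in>topspace X. homeomorphic_map TF X (\<lambda>f. ba_act D f x)))"

text \<open>
  The automorphism group \<open>\<AA>\<close>.  Both components are extensional, so that the pairs correspond
  exactly to maps on \<open>F\<close> and \<open>X\<close>.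
\<close>

definition BA_aut :: "nat \<Rightarrow> ('f, 'x) based_affine \<Rightarrow> (('f \<Rightarrow> 'f) \<times> ('x \<Rightarrow> 'x)) monoid" where
  "BA_aut l D =
     (let F = ba_lattice D; X = ba_space D; B = ba_basis D; TF = lattice_top l F B in
      \<lparr>carrier = {(\<phi>, \<chi>).
          \<phi> \<in> extensional (carrier F) \<and> \<chi> \<in> extensional (topspace X) \<and>
          bij_betw \<phi> (carrier F) (carrier F) \<and>
          (\<forall>f\<in>carrier F. \<forall>f'\<in>carrier F. \<phi> (f \<oplus>\<^bsub>F\<^esub> f') = \<phi> f \<oplus>\<^bsub>F\<^esub> \<phi> f') \<and>
          (\<forall>c\<in>carrier (Zl l). \<forall>f\<in>carrier F. \<phi> (c \<odot>\<^bsub>F\<^esub> f) = c \<odot>\<^bsub>F\<^esub> \<phi> f) \<and>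
          homeomorphic_map TF TF \<phi> \<and>
          \<phi> ` B = B \<and>
          homeomorphic_map X X \<chi> \<and>
          (\<forall>f\<in>carrier F. \<forall>x\<in>topspace X. \<chi> (ba_act D f x) = ba_act D (\<phi> f) (\<chi> x))},
       monoid.mult = (\<lambda>(\<phi>, \<chi>) (\<phi>', \<chi>'). (compose (carrier F) \<phi> \<phi>', compose (topspace X) \<chi> \<chi>')),
       one = (restrict id (carrier F), restrict id (topspace X))\<rparr>)"

text \<open>
  The topology of \<open>\<AA>\<close>: discrete in the permutation of \<open>B\<close>, pointwise convergence on \<open>X\<close>.  Under
  \<open>\<AA> \<cong> \<Sigma>\<^sub>B \<ltimes> F\<close> (for any base point) it is the product of the discrete topology and that of \<open>F\<close>.
\<close>

definition BA_aut_top ::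
    "nat \<Rightarrow> ('f, 'x) based_affine \<Rightarrow> (('f \<Rightarrow> 'f) \<times> ('x \<Rightarrow> 'x)) topology" where
  "BA_aut_top l D =
     pullback_topology (carrier (BA_aut l D)) (\<lambda>(\<phi>, \<chi>). (restrict \<phi> (ba_basis D), \<chi>))
       (prod_topology (discrete_topology UNIV)
          (product_topology (\<lambda>_. ba_space D) (topspace (ba_space D))))"

definition l_BAR ::
    "nat \<Rightarrow> ('g, 'm) monoid_scheme \<Rightarrow> 'g topology \<Rightarrow> ('f, 'x) based_affine
     \<Rightarrow> ('g \<Rightarrow> ('f \<Rightarrow> 'f) \<times> ('x \<Rightarrow> 'x)) \<Rightarrow> bool" where
  "l_BAR l G T D \<eta> \<longleftrightarrow>
     is_based_affine l D \<and> \<eta> \<in> hom G (BA_aut l D) \<and> continuous_map T (BA_aut_top l D) \<eta>"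

definition principal ::
    "('g, 'm) monoid_scheme \<Rightarrow> ('f, 'x) based_affine
     \<Rightarrow> ('g \<Rightarrow> ('f \<Rightarrow> 'f) \<times> ('x \<Rightarrow> 'x)) \<Rightarrow> 'g set \<Rightarrow> bool" where
  "principal G D \<eta> K \<longleftrightarrow> (\<forall>x\<in>topspace (ba_space D). {g \<in> carrier G. snd (\<eta> g) x = x} = K)"

text \<open>
  With base point \<open>x\<^sub>0\<close>, \<open>a = (\<phi>, \<chi>) \<in> \<AA>\<close> is the product \<open>f \<cdot> \<sigma>\<close> of its permutation \<open>\<sigma> = \<phi>|\<^sub>B\<close>
  and of the translation by the \<open>f \<in> F\<close> with \<open>\<chi>(x\<^sub>0) = f \<cdot> x\<^sub>0\<close>; \<open>shift_coord\<close> is the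
  coordinate \<open>f\<^sub>b\<close>.
\<close>

definition shift_coord ::
    "nat \<Rightarrow> ('f, 'x) based_affine \<Rightarrow> 'x \<Rightarrow> ('f \<Rightarrow> 'f) \<times> ('x \<Rightarrow> 'x) \<Rightarrow> 'f \<Rightarrow> (nat \<Rightarrow> int)" where
  "shift_coord l D x0 a b =
     coords l (ba_lattice D) (ba_basis D)
       (THE f. f \<in> carrier (ba_lattice D) \<and> snd a x0 = ba_act D f x0) b"


section \<open>Representations\<close>

definition compatible_roots :: "nat \<Rightarrow> (nat \<Rightarrow> 'k::field) \<Rightarrow> bool" where
  "compatible_roots l \<zeta> \<longleftrightarrow>
     (\<forall>s. \<zeta> s ^ (l ^ s) = 1 \<and> (\<forall>j. 0 < j \<and> j < l ^ s \<longrightarrow> \<zeta> s ^ j \<noteq> 1)) \<and>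
     (\<forall>s. \<zeta> (Suc s) ^ l = \<zeta> s)"

definition cont_rep ::
    "('g, 'm) monoid_scheme \<Rightarrow> 'g topology \<Rightarrow> nat \<Rightarrow> ('g \<Rightarrow> 'k::field mat) \<Rightarrow> bool" where
  "cont_rep G T n \<rho> \<longleftrightarrow>
     (\<forall>g\<in>carrier G. \<rho> g \<in> carrier_mat n n) \<and>
     \<rho> \<one>\<^bsub>G\<^esub> = 1\<^sub>m n \<and>
     (\<forall>g\<in>carrier G. \<forall>h\<in>carrier G. \<rho> (g \<otimes>\<^bsub>G\<^esub> h) = \<rho> g * \<rho> h) \<and>
     continuous_map T (discrete_topology UNIV) \<rho>"

definition rep_iso ::
    "('g, 'm) monoid_scheme \<Rightarrow> 'g topology \<Rightarrow> (('g \<Rightarrow> 'k::field mat) \<times> ('g \<Rightarrow> 'k mat)) set" where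
  "rep_iso G T =
     {(\<rho>, \<rho>'). (\<exists>n. cont_rep G T n \<rho> \<and> cont_rep G T n \<rho>') \<and>
        (\<exists>P Q. \<forall>g\<in>carrier G. similar_mat_wit (\<rho> g) (\<rho>' g) P Q)}"

definition rep_classes ::
    "('g, 'm) monoid_scheme \<Rightarrow> 'g topology \<Rightarrow> ('g \<Rightarrow> 'k::field mat) set set" where
  "rep_classes G T = {\<rho>. \<exists>n. cont_rep G T n \<rho>} // rep_iso G T"

text \<open>
  The matrix of \<open>\<rho>\<^sub>s(a)\<close> with respect to the basis \<open>(e\<^bsub>b\<^esub>)\<close> enumerated by \<open>enum\<close>: writing
  \<open>a = f \<cdot> \<sigma>\<close> as above, \<open>a\<close> maps \<open>e\<^bsub>b\<^esub>\<close> to \<open>\<zeta>\<^sub>s\<close> to the power \<open>f\<^bsub>\<sigma>(b)\<^esub>\<close>, times \<open>e\<^bsub>\<sigma>(b)\<^esub>\<close>.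
\<close>

definition rho_mat ::
    "nat \<Rightarrow> (nat \<Rightarrow> 'k::field) \<Rightarrow> nat \<Rightarrow> ('f, 'x) based_affine \<Rightarrow> 'x \<Rightarrow> (nat \<Rightarrow> 'f)
     \<Rightarrow> ('f \<Rightarrow> 'f) \<times> ('x \<Rightarrow> 'x) \<Rightarrow> 'k mat" where
  "rho_mat l \<zeta> s D x0 enum a =
     mat (card (ba_basis D)) (card (ba_basis D)) (\<lambda>(i, j).
       if enum i = fst a (enum j)
       then \<zeta> s ^ nat (shift_coord l D x0 a (enum i) s) else 0)"


section \<open>The schemes \<open>\<T>\<^sub>\<eta>\<close> and their product\<close>

text \<open>
  The type \<^typ>\<open>('v \<Rightarrow>\<^sub>0 rat) \<Rightarrow>\<^sub>0 'k\<close> is the ring of Laurent polynomials over \<open>'k\<close> with rational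
  exponents in variables \<open>t\<^sub>v\<close>: a monomial is given by its finitely supported exponent vector.
  The following subring is \<open>\<Union>\<^sub>s k[t\<^sub>v\<^bsup>\<plusminus>1/l^s\<^esup>; v \<in> V]\<close>.
\<close>

definition laurent_ring :: "nat \<Rightarrow> 'v set \<Rightarrow> (('v \<Rightarrow>\<^sub>0 rat) \<Rightarrow>\<^sub>0 'k::field) set" where
  "laurent_ring l V =
     (\<Union>s::nat. {p. \<forall>m\<in>Poly_Mapping.keys p. \<forall>v\<in>Poly_Mapping.keys m.
        v \<in> V \<and> of_nat (l ^ s) * Poly_Mapping.lookup m v \<in> \<int>})"

text \<open>
  \<open>root_pow l \<zeta> c q\<close> is \<open>\<zeta>\<^sub>s\<^bsup>c n\<^esup>\<close> for \<open>q = n / l\<^sup>s\<close>; thus \<open>f \<in> F\<close> multiplies \<open>t\<^sub>b\<^bsup>q\<^esup>\<close> by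
  \<open>root_pow l \<zeta> f\<^sub>b q\<close>.
\<close>

definition root_pow :: "nat \<Rightarrow> (nat \<Rightarrow> 'k::field) \<Rightarrow> (nat \<Rightarrow> int) \<Rightarrow> rat \<Rightarrow> 'k" where
  "root_pow l \<zeta> c q =
     (let s = (LEAST s. of_nat (l ^ s) * q \<in> \<int>) in \<zeta> s powi (c s * \<lfloor>of_nat (l ^ s) * q\<rfloor>))"

definition rename_mono :: "('v \<Rightarrow> 'w) \<Rightarrow> ('v \<Rightarrow>\<^sub>0 rat) \<Rightarrow> ('w \<Rightarrow>\<^sub>0 rat)" where
  "rename_mono \<sigma> m =
     (\<Sum>v\<in>Poly_Mapping.keys m. Poly_Mapping.single (\<sigma> v) (Poly_Mapping.lookup m v))"

text \<open>
  The \<open>k\<close>-linear ring endomorphism \<open>c \<cdot> \<sigma>\<close>: first \<open>t\<^sub>v\<^bsup>q\<^esup> \<mapsto> t\<^bsub>\<sigma>(v)\<^esub>\<^bsup>q\<^esup>\<close>, then the element \<open>c\<close> of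
  \<open>\<Prod>\<^sub>v \<int>\<^sub>l\<close> acts.
\<close>

definition laurent_act ::
    "nat \<Rightarrow> (nat \<Rightarrow> 'k::field) \<Rightarrow> ('v \<Rightarrow> 'v) \<Rightarrow> ('v \<Rightarrow> nat \<Rightarrow> int)
     \<Rightarrow> (('v \<Rightarrow>\<^sub>0 rat) \<Rightarrow>\<^sub>0 'k) \<Rightarrow> (('v \<Rightarrow>\<^sub>0 rat) \<Rightarrow>\<^sub>0 'k)" where
  "laurent_act l \<zeta> \<sigma> c p =
     (\<Sum>m\<in>Poly_Mapping.keys p. Poly_Mapping.single (rename_mono \<sigma> m)
        (Poly_Mapping.lookup p m *
         (\<Prod>v\<in>Poly_Mapping.keys m. root_pow l \<zeta> (c (\<sigma> v)) (Poly_Mapping.lookup m v))))"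

definition T_ring :: "nat \<Rightarrow> ('f, 'x) based_affine \<Rightarrow> (('f \<Rightarrow>\<^sub>0 rat) \<Rightarrow>\<^sub>0 'k::field) set" where
  "T_ring l D = laurent_ring l (ba_basis D)"

definition T_act ::
    "nat \<Rightarrow> (nat \<Rightarrow> 'k::field) \<Rightarrow> ('f, 'x) based_affine \<Rightarrow> 'x \<Rightarrow> ('g \<Rightarrow> ('f \<Rightarrow> 'f) \<times> ('x \<Rightarrow> 'x))
     \<Rightarrow> 'g \<Rightarrow> (('f \<Rightarrow>\<^sub>0 rat) \<Rightarrow>\<^sub>0 'k) \<Rightarrow> (('f \<Rightarrow>\<^sub>0 rat) \<Rightarrow>\<^sub>0 'k)" where
  "T_act l \<zeta> D x0 \<eta> g = laurent_act l \<zeta> (fst (\<eta> g)) (shift_coord l D x0 (\<eta> g))"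

text \<open>
  The coordinate ring of \<open>\<Prod>\<^bsub>i\<in>I\<^esub> \<T>\<^bsub>\<eta>(i)\<^esub>\<close>, i.e. the tensor product over \<open>k\<close> of the \<open>T_ring l (D i)\<close>,
  with the diagonal action; that it is the coproduct of \<open>k\<close>-algebras, equivariantly, is
  \<open>prod_ring_coproduct\<close> and \<open>prod_incl_equivariant\<close> below.
\<close>

definition prod_ring ::
    "nat \<Rightarrow> 'i set \<Rightarrow> ('i \<Rightarrow> ('f, 'x) based_affine) \<Rightarrow> (('i \<times> 'f \<Rightarrow>\<^sub>0 rat) \<Rightarrow>\<^sub>0 'k::field) set" where
  "prod_ring l I D = laurent_ring l (SIGMA i:I. ba_basis (D i))"

definition prod_act ::
    "nat \<Rightarrow> (nat \<Rightarrow> 'k::field) \<Rightarrow> ('i \<Rightarrow> ('f, 'x) based_affine) \<Rightarrow> ('i \<Rightarrow> 'x)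
     \<Rightarrow> ('i \<Rightarrow> 'g \<Rightarrow> ('f \<Rightarrow> 'f) \<times> ('x \<Rightarrow> 'x))
     \<Rightarrow> 'g \<Rightarrow> (('i \<times> 'f \<Rightarrow>\<^sub>0 rat) \<Rightarrow>\<^sub>0 'k) \<Rightarrow> (('i \<times> 'f \<Rightarrow>\<^sub>0 rat) \<Rightarrow>\<^sub>0 'k)" where
  "prod_act l \<zeta> D x0 \<eta> g =
     laurent_act l \<zeta> (\<lambda>(i, b). (i, fst (\<eta> i g) b))
       (\<lambda>(i, b). shift_coord l (D i) (x0 i) (\<eta> i g) b)"

definition prod_incl :: "'i \<Rightarrow> (('f \<Rightarrow>\<^sub>0 rat) \<Rightarrow>\<^sub>0 'k::field) \<Rightarrow> (('i \<times> 'f \<Rightarrow>\<^sub>0 rat) \<Rightarrow>\<^sub>0 'k)" where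
  "prod_incl i p =
     (\<Sum>m\<in>Poly_Mapping.keys p. Poly_Mapping.single (rename_mono (Pair i) m) (Poly_Mapping.lookup p m))"

lemma poly_mapping_sum_single:
  "(\<Sum>m\<in>Poly_Mapping.keys p. Poly_Mapping.single m (Poly_Mapping.lookup p m)) = p"
proof (rule poly_mapping_eqI)
  fix k
  have "Poly_Mapping.lookup (\<Sum>m\<in>Poly_Mapping.keys p. Poly_Mapping.single m (Poly_Mapping.lookup p m)) k
      = (\<Sum>m\<in>Poly_Mapping.keys p. if m = k then Poly_Mapping.lookup p k else 0)"
    by (auto simp: lookup_sum lookup_single when_def intro!: sum.cong)
  also have "\<dots> = Poly_Mapping.lookup p k"
    by (simp add: in_keys_iff)
  finally show "Poly_Mapping.lookup (\<Sum>m\<in>Poly_Mapping.keys p.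
      Poly_Mapping.single m (Poly_Mapping.lookup p m)) k = Poly_Mapping.lookup p k" .
qed

lemma rename_mono_single [simp]:
  "rename_mono \<sigma> (Poly_Mapping.single v q) = Poly_Mapping.single (\<sigma> v) q"
  by (cases "q = 0") (simp_all add: rename_mono_def)

lemma rename_mono_0 [simp]: "rename_mono \<sigma> 0 = 0"
  by (simp add: rename_mono_def)

lemma rename_mono_add: "rename_mono \<sigma> (m + m') = rename_mono \<sigma> m + rename_mono \<sigma> m'"
  unfolding rename_mono_def by (rule setsum_keys_plus_distrib) (simp_all add: single_add)

lemma rename_mono_sum: "rename_mono \<sigma> (sum f A) = (\<Sum>a\<in>A. rename_mono \<sigma> (f a))"
  by (induction A rule: infinite_finite_induct) (simp_all add: rename_mono_add)

lemma rename_mono_rename_mono: "rename_mono \<sigma> (rename_mono \<tau> m) = rename_mono (\<sigma> \<circ> \<tau>) m"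
proof -
  have "rename_mono \<sigma> (rename_mono \<tau> m) =
      rename_mono \<sigma> (\<Sum>v\<in>Poly_Mapping.keys m. Poly_Mapping.single (\<tau> v) (Poly_Mapping.lookup m v))"
    by (simp only: rename_mono_def[of \<tau>])
  also have "\<dots> = rename_mono (\<sigma> \<circ> \<tau>) m"
    by (simp add: rename_mono_sum rename_mono_def[of "\<sigma> \<circ> \<tau>"])
  finally show ?thesis .
qed

lemma lookup_rename_mono_inj:
  assumes "inj \<sigma>"
  shows "Poly_Mapping.lookup (rename_mono \<sigma> m) (\<sigma> v) = Poly_Mapping.lookup m v"
proof -
  have "Poly_Mapping.lookup (rename_mono \<sigma> m) (\<sigma> v) =
      (\<Sum>u\<in>Poly_Mapping.keys m. if u = v then Poly_Mapping.lookup m u else 0)"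
    using assms by (auto simp: rename_mono_def lookup_sum lookup_single when_def inj_eq intro!: sum.cong)
  also have "\<dots> = Poly_Mapping.lookup m v"
    by (simp add: in_keys_iff)
  finally show ?thesis .
qed

lemma keys_rename_mono_inj:
  assumes "inj \<sigma>"
  shows "Poly_Mapping.keys (rename_mono \<sigma> m) = \<sigma> ` Poly_Mapping.keys m"
proof
  show "Poly_Mapping.keys (rename_mono \<sigma> m) \<subseteq> \<sigma> ` Poly_Mapping.keys m"
    unfolding rename_mono_def by (rule order_trans[OF keys_sum]) (auto split: if_splits)
  show "\<sigma> ` Poly_Mapping.keys m \<subseteq> Poly_Mapping.keys (rename_mono \<sigma> m)"
    using assms by (auto simp: in_keys_iff lookup_rename_mono_inj)
qed

lemma prod_incl_add: "prod_incl i (p + q) = prod_incl i p + prod_incl i q"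
  unfolding prod_incl_def by (rule setsum_keys_plus_distrib) (simp_all add: single_add)

lemma prod_incl_0 [simp]: "prod_incl i 0 = 0"
  by (simp add: prod_incl_def)

lemma prod_incl_single [simp]:
  "prod_incl i (Poly_Mapping.single m a) = Poly_Mapping.single (rename_mono (Pair i) m) a"
  by (cases "a = 0") (simp_all add: prod_incl_def)

lemma prod_incl_sum: "prod_incl i (sum f A) = (\<Sum>a\<in>A. prod_incl i (f a))"
  by (induction A rule: infinite_finite_induct) (simp_all add: prod_incl_add)

lemma laurent_act_add: "laurent_act l \<zeta> \<sigma> c (p + q) = laurent_act l \<zeta> \<sigma> c p + laurent_act l \<zeta> \<sigma> c q"
  unfolding laurent_act_def
  by (rule setsum_keys_plus_distrib) (simp_all add: single_add distrib_right)

lemma laurent_act_0 [simp]: "laurent_act l \<zeta> \<sigma> c 0 = 0"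
  by (simp add: laurent_act_def)

lemma laurent_act_single [simp]:
  "laurent_act l \<zeta> \<sigma> c (Poly_Mapping.single m a) = Poly_Mapping.single (rename_mono \<sigma> m)
     (a * (\<Prod>v\<in>Poly_Mapping.keys m. root_pow l \<zeta> (c (\<sigma> v)) (Poly_Mapping.lookup m v)))"
  by (cases "a = 0") (simp_all add: laurent_act_def)

lemma laurent_act_sum: "laurent_act l \<zeta> \<sigma> c (sum f A) = (\<Sum>a\<in>A. laurent_act l \<zeta> \<sigma> c (f a))"
  by (induction A rule: infinite_finite_induct) (simp_all add: laurent_act_add)

lemma prod_incl_equivariant:
  "prod_incl i (T_act l \<zeta> (D i) (x0 i) (\<eta> i) g p) = prod_act l \<zeta> D x0 \<eta> g (prod_incl i p)"
proof -
  have inj: "inj (Pair i)" by (simp add: inj_on_def)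
  have *: "prod_incl i (T_act l \<zeta> (D i) (x0 i) (\<eta> i) g (Poly_Mapping.single m a)) =
      prod_act l \<zeta> D x0 \<eta> g (prod_incl i (Poly_Mapping.single m a))" for m a
    by (simp add: T_act_def prod_act_def rename_mono_rename_mono comp_def keys_rename_mono_inj[OF inj]
        lookup_rename_mono_inj[OF inj] prod.reindex inj_on_def)
  have "prod_incl i (T_act l \<zeta> (D i) (x0 i) (\<eta> i) g (\<Sum>m\<in>Poly_Mapping.keys p. Poly_Mapping.single m (Poly_Mapping.lookup p m))) =
      prod_act l \<zeta> D x0 \<eta> g (prod_incl i (\<Sum>m\<in>Poly_Mapping.keys p. Poly_Mapping.single m (Poly_Mapping.lookup p m)))"
    using * by (simp only: T_act_def prod_act_def laurent_act_sum prod_incl_sum)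
  then show ?thesis by (simp only: poly_mapping_sum_single)
qed

definition kalg_hom ::
    "('k::field \<Rightarrow> 'r::comm_ring_1) \<Rightarrow> (('v \<Rightarrow>\<^sub>0 rat) \<Rightarrow>\<^sub>0 'k) set \<Rightarrow> ((('v \<Rightarrow>\<^sub>0 rat) \<Rightarrow>\<^sub>0 'k) \<Rightarrow> 'r) \<Rightarrow> bool" where
  "kalg_hom c A h \<longleftrightarrow>
     (\<forall>p\<in>A. \<forall>q\<in>A. h (p + q) = h p + h q \<and> h (p * q) = h p * h q) \<and>
     (\<forall>a. h (Poly_Mapping.single 0 a) = c a)"
  \<comment> \<open>homomorphism of \<open>k\<close>-algebras into the algebra \<open>'r\<close> with structure map \<open>c\<close>\<close>

definition laurent_monos :: "nat \<Rightarrow> 'v set \<Rightarrow> ('v \<Rightarrow>\<^sub>0 rat) set" where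
  "laurent_monos l V =
     {m. \<forall>v\<in>Poly_Mapping.keys m. v \<in> V \<and> (\<exists>s::nat. of_nat (l ^ s) * Poly_Mapping.lookup m v \<in> \<int>)}"

lemma frac_mono:
  assumes "of_nat (l ^ s) * (q::rat) \<in> \<int>" "s \<le> s'"
  shows "of_nat (l ^ s') * q \<in> \<int>"
proof -
  have "of_nat (l ^ s') * q = of_nat (l ^ (s' - s)) * (of_nat (l ^ s) * q)"
    using assms(2) by (simp flip: power_add mult.assoc of_nat_mult)
  then show ?thesis using assms(1) by (metis Ints_mult Ints_of_nat)
qed

lemma laurent_ring_altdef:
  "(laurent_ring l V :: (('v \<Rightarrow>\<^sub>0 rat) \<Rightarrow>\<^sub>0 'k::field) set) =
     {p. Poly_Mapping.keys p \<subseteq> laurent_monos l V}"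
proof safe
  fix p :: "('v \<Rightarrow>\<^sub>0 rat) \<Rightarrow>\<^sub>0 'k" and m
  assume "p \<in> laurent_ring l V" "m \<in> Poly_Mapping.keys p"
  then show "m \<in> laurent_monos l V"
    by (auto simp: laurent_ring_def laurent_monos_def)
next
  fix p :: "('v \<Rightarrow>\<^sub>0 rat) \<Rightarrow>\<^sub>0 'k"
  assume p: "Poly_Mapping.keys p \<subseteq> laurent_monos l V"
  have "\<forall>m\<in>Poly_Mapping.keys p. \<forall>v\<in>Poly_Mapping.keys m. \<exists>s::nat. of_nat (l ^ s) * Poly_Mapping.lookup m v \<in> \<int>"
    using p by (auto simp: laurent_monos_def)
  then obtain s where s: "\<And>m v. m \<in> Poly_Mapping.keys p \<Longrightarrow> v \<in> Poly_Mapping.keys m \<Longrightarrow>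
      of_nat (l ^ s m v) * Poly_Mapping.lookup m v \<in> \<int>"
    by metis
  let ?Z = "SIGMA m:Poly_Mapping.keys p. Poly_Mapping.keys m"
  let ?s = "\<Sum>(m, v)\<in>?Z. s m v"
  have "of_nat (l ^ ?s) * Poly_Mapping.lookup m v \<in> \<int>"
    if "m \<in> Poly_Mapping.keys p" "v \<in> Poly_Mapping.keys m" for m v
  proof (rule frac_mono[OF s[OF that]])
    have "(\<lambda>(m, v). s m v) (m, v) \<le> ?s"
      by (rule member_le_sum) (use that in auto)
    then show "s m v \<le> ?s" by simp
  qed
  then show "p \<in> laurent_ring l V"
    using p unfolding laurent_ring_def laurent_monos_def by blast
qed

lemma laurent_monos_0 [simp]: "0 \<in> laurent_monos l V"
  by (simp add: laurent_monos_def)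

lemma laurent_monos_add:
  assumes "m \<in> laurent_monos l V" "m' \<in> laurent_monos l V"
  shows "m + m' \<in> laurent_monos l V"
  unfolding laurent_monos_def mem_Collect_eq
proof
  fix v assume v: "v \<in> Poly_Mapping.keys (m + m')"
  have ex: "\<exists>s::nat. of_nat (l ^ s) * Poly_Mapping.lookup m v \<in> \<int>" if "m \<in> laurent_monos l V" for m
    using that by (cases "v \<in> Poly_Mapping.keys m") (auto simp: laurent_monos_def in_keys_iff)
  obtain s s' where "of_nat (l ^ s) * Poly_Mapping.lookup m v \<in> \<int>" "of_nat (l ^ s') * Poly_Mapping.lookup m' v \<in> \<int>"
    using ex assms by blast
  then have "of_nat (l ^ (s + s')) * Poly_Mapping.lookup m v \<in> \<int>" "of_nat (l ^ (s + s')) * Poly_Mapping.lookup m' v \<in> \<int>"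
    using frac_mono by (metis le_add1 le_add2)+
  then have "of_nat (l ^ (s + s')) * Poly_Mapping.lookup (m + m') v \<in> \<int>"
    by (simp add: lookup_add distrib_left)
  moreover have "v \<in> V"
    using v keys_add[of m m'] assms by (auto simp: laurent_monos_def)
  ultimately show "v \<in> V \<and> (\<exists>s::nat. of_nat (l ^ s) * Poly_Mapping.lookup (m + m') v \<in> \<int>)"
    by blast
qed

lemma single_in_laurent_ring [simp]:
  "m \<in> laurent_monos l V \<Longrightarrow> Poly_Mapping.single m a \<in> laurent_ring l V"
  by (simp add: laurent_ring_altdef)

lemma laurent_ring_sum:
  "(\<And>a. a \<in> A \<Longrightarrow> f a \<in> laurent_ring l V) \<Longrightarrow> sum f A \<in> laurent_ring l V"
  unfolding laurent_ring_altdef using keys_sum[of f A] by blast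

lemma laurent_ring_mult:
  "p \<in> laurent_ring l V \<Longrightarrow> q \<in> laurent_ring l V \<Longrightarrow> p * q \<in> laurent_ring l V"
  unfolding laurent_ring_altdef using keys_mult[of p q] laurent_monos_add by blast

lemma prod_incl_in_prod_ring:
  assumes "i \<in> I" "p \<in> T_ring l (D i)"
  shows "prod_incl i p \<in> prod_ring l I D"
proof -
  have inj: "inj (Pair i)" by (simp add: inj_on_def)
  have "rename_mono (Pair i) m \<in> laurent_monos l (SIGMA i:I. ba_basis (D i))"
    if "m \<in> laurent_monos l (ba_basis (D i))" for m
    using that assms(1) by (auto simp: laurent_monos_def keys_rename_mono_inj[OF inj] lookup_rename_mono_inj[OF inj])
  then show ?thesis
    using assms(2) unfolding prod_ring_def T_ring_def prod_incl_def
    by (intro laurent_ring_sum single_in_laurent_ring) (auto simp: laurent_ring_altdef)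
qed

lemma prod_incl_mult: "prod_incl i (p * q) = prod_incl i p * prod_incl i q"
proof -
  let ?S = "\<lambda>p. \<Sum>m\<in>Poly_Mapping.keys p. Poly_Mapping.single m (Poly_Mapping.lookup p m)"
  have "prod_incl i (?S p * ?S q) = prod_incl i (?S p) * prod_incl i (?S q)"
    by (simp add: sum_product prod_incl_sum mult_single rename_mono_add)
  then show ?thesis by (simp only: poly_mapping_sum_single)
qed

lemma prod_incl_kalg_hom: "kalg_hom (Poly_Mapping.single 0) A (prod_incl i)"
  by (simp add: kalg_hom_def prod_incl_add prod_incl_mult)

lemma kalg_hom_sum:
  assumes "kalg_hom c (laurent_ring l V) h" "c 0 = 0" "\<And>a. a \<in> A \<Longrightarrow> f a \<in> laurent_ring l V"
  shows "h (sum f A) = (\<Sum>a\<in>A. h (f a))"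
proof -
  have h0: "h 0 = 0"
    using assms(1,2) by (metis kalg_hom_def single_zero)
  show ?thesis using assms(3)
  proof (induction A rule: infinite_finite_induct)
    case (insert x F)
    then have "sum f F \<in> laurent_ring l V" by (intro laurent_ring_sum) auto
    with insert assms(1) show ?case by (simp add: kalg_hom_def)
  qed (simp_all add: h0)
qed

lemma kalg_hom_eval:
  assumes h: "kalg_hom c (laurent_ring l V) h" and c0: "c 0 = 0" and p: "p \<in> laurent_ring l V"
  shows "h p = (\<Sum>m\<in>Poly_Mapping.keys p. c (Poly_Mapping.lookup p m) * h (Poly_Mapping.single m 1))"
proof -
  have M: "m \<in> laurent_monos l V" if "m \<in> Poly_Mapping.keys p" for m
    using p that by (auto simp: laurent_ring_altdef)
  have "h p = h (\<Sum>m\<in>Poly_Mapping.keys p. Poly_Mapping.single m (Poly_Mapping.lookup p m))"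
    by (simp only: poly_mapping_sum_single)
  also have "\<dots> = (\<Sum>m\<in>Poly_Mapping.keys p. h (Poly_Mapping.single m (Poly_Mapping.lookup p m)))"
    by (rule kalg_hom_sum[OF h c0]) (simp add: M)
  also have "\<dots> = (\<Sum>m\<in>Poly_Mapping.keys p. c (Poly_Mapping.lookup p m) * h (Poly_Mapping.single m 1))"
  proof (rule sum.cong[OF refl])
    fix m assume m: "m \<in> Poly_Mapping.keys p"
    have "h (Poly_Mapping.single 0 (Poly_Mapping.lookup p m) * Poly_Mapping.single m 1) =
        h (Poly_Mapping.single 0 (Poly_Mapping.lookup p m)) * h (Poly_Mapping.single m 1)"
      using h single_in_laurent_ring[OF laurent_monos_0] single_in_laurent_ring[OF M[OF m]]
      unfolding kalg_hom_def by blast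
    then show "h (Poly_Mapping.single m (Poly_Mapping.lookup p m)) =
        c (Poly_Mapping.lookup p m) * h (Poly_Mapping.single m 1)"
      using h by (simp add: kalg_hom_def mult_single)
  qed
  finally show ?thesis .
qed

lemma prod_ring_coproduct:
  fixes c :: "'k::field \<Rightarrow> 'r::comm_ring_1" and D :: "'i \<Rightarrow> ('f, 'x) based_affine"
  assumes c: "\<And>a b. c (a + b) = c a + c b" "\<And>a b. c (a * b) = c a * c b" "c 1 = 1"
    and h: "\<And>i. i \<in> I \<Longrightarrow> kalg_hom c (T_ring l (D i)) (h i)"
  shows "\<exists>H. kalg_hom c (prod_ring l I D) H \<and>
             (\<forall>i\<in>I. \<forall>p\<in>T_ring l (D i). H (prod_incl i p) = h i p)"
    and "\<lbrakk>kalg_hom c (prod_ring l I D) H; \<forall>i\<in>I. \<forall>p\<in>T_ring l (D i). H (prod_incl i p) = h i p;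
          kalg_hom c (prod_ring l I D) H'; \<forall>i\<in>I. \<forall>p\<in>T_ring l (D i). H' (prod_incl i p) = h i p;
          p \<in> prod_ring l I D\<rbrakk> \<Longrightarrow> H p = H' p"
proof -
  let ?V = "SIGMA i:I. ba_basis (D i)"
  let ?M = "laurent_monos l ?V"
  define restr where "restr i m = Poly_Mapping.map_key (Pair i) m" for i :: 'i and m :: "'i \<times> 'f \<Rightarrow>\<^sub>0 rat"
  have inj: "inj (Pair i)" for i :: 'i by (simp add: inj_on_def)
  have c0: "c 0 = 0" using c(1)[of 0 0] by simp
  have lookup_restr: "Poly_Mapping.lookup (restr i m) b = Poly_Mapping.lookup m (i, b)" for i m b
    by (simp add: restr_def map_key.rep_eq[OF inj])
  have restr_add: "restr i (m + m') = restr i m + restr i m'" for i m m'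
    by (simp add: restr_def map_key_plus[OF inj])
  have restr_M: "restr i m \<in> laurent_monos l (ba_basis (D i))" if "m \<in> ?M" for i m
    using that by (force simp: laurent_monos_def in_keys_iff lookup_restr)
  have one: "h i (Poly_Mapping.single 0 1) = 1" if "i \<in> I" for i
    using h[OF that] c(3) by (metis kalg_hom_def)
  have fst_I: "fst ` Poly_Mapping.keys m \<subseteq> I" if "m \<in> ?M" for m
    using that by (auto simp: laurent_monos_def)
  define W where "W m = (\<Prod>i\<in>fst ` Poly_Mapping.keys m. h i (Poly_Mapping.single (restr i m) 1))" for m
  have W_super: "W m = (\<Prod>i\<in>J. h i (Poly_Mapping.single (restr i m) 1))"
    if "finite J" "fst ` Poly_Mapping.keys m \<subseteq> J" "J \<subseteq> I" for m J
    unfolding W_def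
  proof (rule prod.mono_neutral_left[OF that(1,2)], intro ballI)
    fix i assume i: "i \<in> J - fst ` Poly_Mapping.keys m"
    then have "Poly_Mapping.lookup m (i, b) = 0" for b
      by (metis DiffD2 fst_conv image_eqI in_keys_iff)
    then have "restr i m = 0"
      by (intro poly_mapping_eqI) (simp add: lookup_restr)
    then show "h i (Poly_Mapping.single (restr i m) 1) = 1"
      using one i that(3) by auto
  qed
  have W_mult: "W (m + m') = W m * W m'" if mm: "m \<in> ?M" "m' \<in> ?M" for m m'
  proof -
    let ?J = "fst ` Poly_Mapping.keys m \<union> fst ` Poly_Mapping.keys m'"
    have J: "finite ?J" "?J \<subseteq> I" using fst_I mm by auto
    have "W (m + m') = (\<Prod>i\<in>?J. h i (Poly_Mapping.single (restr i (m + m')) 1))"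
      using keys_add[of m m'] J by (intro W_super) auto
    also have "\<dots> = (\<Prod>i\<in>?J. h i (Poly_Mapping.single (restr i m) 1) * h i (Poly_Mapping.single (restr i m') 1))"
    proof (rule prod.cong[OF refl])
      fix i assume "i \<in> ?J"
      then have "kalg_hom c (T_ring l (D i)) (h i)" using h J by blast
      moreover have "Poly_Mapping.single (restr i (m + m')) (1::'k) =
          Poly_Mapping.single (restr i m) 1 * Poly_Mapping.single (restr i m') 1"
        by (simp add: mult_single restr_add)
      ultimately show "h i (Poly_Mapping.single (restr i (m + m')) 1) =
          h i (Poly_Mapping.single (restr i m) 1) * h i (Poly_Mapping.single (restr i m') 1)"
        using restr_M mm by (simp add: kalg_hom_def T_ring_def)
    qed
    also have "\<dots> = W m * W m'"
      using J W_super[of ?J m] W_super[of ?J m'] by (simp add: prod.distrib)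
    finally show ?thesis .
  qed
  define E where "E p = (\<Sum>m\<in>Poly_Mapping.keys p. c (Poly_Mapping.lookup p m) * W m)" for p
  have E_add: "E (p + q) = E p + E q" for p q
    unfolding E_def by (rule setsum_keys_plus_distrib) (simp_all add: c0 c(1) distrib_right)
  have E_single: "E (Poly_Mapping.single m a) = c a * W m" for m a
    by (cases "a = 0") (simp_all add: E_def c0)
  have E_sum: "E (sum f A) = (\<Sum>a\<in>A. E (f a))" for f :: "'z \<Rightarrow> _" and A
    by (induction A rule: infinite_finite_induct) (simp_all add: E_add, simp_all add: E_def)
  have E_mult: "E (p * q) = E p * E q" if "p \<in> prod_ring l I D" "q \<in> prod_ring l I D" for p q
  proof -
    let ?S = "\<lambda>p. \<Sum>m\<in>Poly_Mapping.keys p. Poly_Mapping.single m (Poly_Mapping.lookup p m)"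
    have "E (?S p * ?S q) = (\<Sum>m\<in>Poly_Mapping.keys p. \<Sum>m'\<in>Poly_Mapping.keys q.
        c (Poly_Mapping.lookup p m * Poly_Mapping.lookup q m') * W (m + m'))"
      by (simp add: sum_product E_sum mult_single E_single)
    also have "\<dots> = (\<Sum>m\<in>Poly_Mapping.keys p. \<Sum>m'\<in>Poly_Mapping.keys q.
        (c (Poly_Mapping.lookup p m) * W m) * (c (Poly_Mapping.lookup q m') * W m'))"
    proof (intro sum.cong refl)
      fix m m' assume "m \<in> Poly_Mapping.keys p" "m' \<in> Poly_Mapping.keys q"
      then have "m \<in> ?M" "m' \<in> ?M" using that by (auto simp: prod_ring_def laurent_ring_altdef)
      then show "c (Poly_Mapping.lookup p m * Poly_Mapping.lookup q m') * W (m + m') =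
          (c (Poly_Mapping.lookup p m) * W m) * (c (Poly_Mapping.lookup q m') * W m')"
        by (simp add: W_mult c(2) mult_ac)
    qed
    also have "\<dots> = E p * E q" by (simp add: E_def sum_product)
    finally show ?thesis by (simp only: poly_mapping_sum_single)
  qed
  have W0: "W 0 = 1" by (simp add: W_def)
  have E_hom: "kalg_hom c (prod_ring l I D) E"
    by (simp add: kalg_hom_def E_add E_mult E_single W0)
  have restr_rename: "restr i (rename_mono (Pair i) m) = m" for i m
    by (rule poly_mapping_eqI) (simp add: lookup_restr lookup_rename_mono_inj[OF inj])
  have E_incl: "E (prod_incl i p) = h i p" if i: "i \<in> I" and p: "p \<in> T_ring l (D i)" for i p
  proof -
    have W: "W (rename_mono (Pair i) m) = h i (Poly_Mapping.single m 1)" for m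
    proof -
      have "fst ` Poly_Mapping.keys (rename_mono (Pair i) m) \<subseteq> {i}"
        by (auto simp: keys_rename_mono_inj[OF inj])
      then show ?thesis
        using W_super[of "{i}" "rename_mono (Pair i) m"] i by (simp add: restr_rename)
    qed
    have "E (prod_incl i p) = (\<Sum>m\<in>Poly_Mapping.keys p. c (Poly_Mapping.lookup p m) * h i (Poly_Mapping.single m 1))"
      by (simp add: prod_incl_def E_sum E_single W)
    also have "\<dots> = h i p"
      by (rule kalg_hom_eval[OF h[OF i, unfolded T_ring_def] c0 p[unfolded T_ring_def], symmetric])
    finally show ?thesis .
  qed
  show "\<exists>H. kalg_hom c (prod_ring l I D) H \<and> (\<forall>i\<in>I. \<forall>p\<in>T_ring l (D i). H (prod_incl i p) = h i p)"
    using E_hom E_incl by blast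
  have uniq: "H p = E p" if H: "kalg_hom c (prod_ring l I D) H"
    "\<forall>i\<in>I. \<forall>p\<in>T_ring l (D i). H (prod_incl i p) = h i p" and p: "p \<in> prod_ring l I D" for H p
  proof -
    have decomp: "m = (\<Sum>i\<in>fst ` Poly_Mapping.keys m. rename_mono (Pair i) (restr i m))" for m
    proof (rule poly_mapping_eqI)
      fix v :: "'i \<times> 'f" obtain j b where v: "v = (j, b)" by (cases v)
      have "Poly_Mapping.lookup (rename_mono (Pair i) (restr i m)) v =
          (if i = j then Poly_Mapping.lookup m v else 0)" for i
      proof (cases "i = j")
        case True then show ?thesis by (simp add: v lookup_rename_mono_inj[OF inj] lookup_restr)
      next
        case False
        then have "v \<notin> Poly_Mapping.keys (rename_mono (Pair i) (restr i m))"
          by (auto simp: keys_rename_mono_inj[OF inj] v)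
        then show ?thesis using False by (simp add: in_keys_iff)
      qed
      then have "Poly_Mapping.lookup (\<Sum>i\<in>fst ` Poly_Mapping.keys m. rename_mono (Pair i) (restr i m)) v =
          (if j \<in> fst ` Poly_Mapping.keys m then Poly_Mapping.lookup m v else 0)"
        by (simp add: lookup_sum)
      also have "\<dots> = Poly_Mapping.lookup m v"
        by (metis fst_conv image_eqI in_keys_iff v)
      finally show "Poly_Mapping.lookup m v = Poly_Mapping.lookup (\<Sum>i\<in>fst ` Poly_Mapping.keys m. rename_mono (Pair i) (restr i m)) v" ..
    qed
    have fin: "Poly_Mapping.single (\<Sum>i\<in>J. rename_mono (Pair i) (restr i m)) (1::'k) \<in> prod_ring l I D \<and>
        H (Poly_Mapping.single (\<Sum>i\<in>J. rename_mono (Pair i) (restr i m)) 1) =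
        (\<Prod>i\<in>J. h i (Poly_Mapping.single (restr i m) 1))"
      if "finite J" "J \<subseteq> I" "m \<in> ?M" for J m
      using that
    proof (induction J rule: finite_induct)
      case empty
      have "Poly_Mapping.single 0 (1::'k) \<in> prod_ring l I D"
        unfolding prod_ring_def by (rule single_in_laurent_ring[OF laurent_monos_0])
      moreover have "H (Poly_Mapping.single 0 1) = 1"
        using H(1) c(3) unfolding kalg_hom_def by metis
      ultimately show ?case by simp
    next
      case (insert i J)
      let ?r = "Poly_Mapping.single (restr i m) (1::'k)"
      let ?q = "Poly_Mapping.single (\<Sum>i\<in>J. rename_mono (Pair i) (restr i m)) (1::'k)"
      have i: "i \<in> I" using insert.prems by blast
      have r: "?r \<in> T_ring l (D i)"
        unfolding T_ring_def by (rule single_in_laurent_ring[OF restr_M[OF insert.prems(2)]])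
      have ir: "prod_incl i ?r \<in> prod_ring l I D"
        using i r by (rule prod_incl_in_prod_ring)
      have eq: "Poly_Mapping.single (\<Sum>i\<in>insert i J. rename_mono (Pair i) (restr i m)) (1::'k) = prod_incl i ?r * ?q"
        by (simp add: sum.insert[OF insert.hyps] mult_single)
      have JI: "J \<subseteq> I" using insert.prems by blast
      have q: "?q \<in> prod_ring l I D"
        and Hq: "H ?q = (\<Prod>i\<in>J. h i (Poly_Mapping.single (restr i m) 1))"
        using insert.IH[OF JI insert.prems(2)] by blast+
      have in_ring: "prod_incl i ?r * ?q \<in> prod_ring l I D"
        using laurent_ring_mult[OF ir[unfolded prod_ring_def] q[unfolded prod_ring_def]]
        unfolding prod_ring_def .
      have "H (prod_incl i ?r * ?q) = H (prod_incl i ?r) * H ?q"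
        using H(1) ir q unfolding kalg_hom_def by blast
      also have "\<dots> = (\<Prod>i\<in>insert i J. h i (Poly_Mapping.single (restr i m) 1))"
        unfolding prod.insert[OF insert.hyps] Hq H(2)[rule_format, OF i r] ..
      finally show ?case unfolding eq using in_ring by blast
    qed
    have HW: "H (Poly_Mapping.single m 1) = W m" if "m \<in> ?M" for m
      using fin[OF finite_imageI[OF finite_keys] fst_I[OF that] that]
      unfolding decomp[of m, symmetric] W_def by blast
    have "H p = (\<Sum>m\<in>Poly_Mapping.keys p. c (Poly_Mapping.lookup p m) * H (Poly_Mapping.single m 1))"
      by (rule kalg_hom_eval[OF H(1)[unfolded prod_ring_def] c0 p[unfolded prod_ring_def]])
    also have "\<dots> = E p"
      unfolding E_def using p by (intro sum.cong refl) (auto simp: HW prod_ring_def laurent_ring_altdef subset_iff)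
    finally show ?thesis .
  qed
  show "H p = H' p"
    if "kalg_hom c (prod_ring l I D) H" "\<forall>i\<in>I. \<forall>p\<in>T_ring l (D i). H (prod_incl i p) = h i p"
      "kalg_hom c (prod_ring l I D) H'" "\<forall>i\<in>I. \<forall>p\<in>T_ring l (D i). H' (prod_incl i p) = h i p"
      "p \<in> prod_ring l I D"
    using uniq[OF that(1,2,5)] uniq[OF that(3,4,5)] by simp
qed

section \<open>The scheme \<open>\<E>G\<close>\<close>

text \<open>The factors of \<open>\<E>G\<close>: \<open>Inl N\<close> for a subgroup, \<open>Inr \<alpha>\<close> for an isomorphism class.\<close>

definition EG_index ::
    "('g, 'm) monoid_scheme \<Rightarrow> 'g topology \<Rightarrow> ('g set + ('g \<Rightarrow> 'k::field mat) set) set" where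
  "EG_index G T = {N. closed_normal_fin G T N} <+> rep_classes G T"

text \<open>
  The base points \<open>x0\<close> are those needed to identify \<open>\<AA>\<close> with \<open>\<Sigma>\<^sub>B \<ltimes> F\<close>, on which \<open>\<rho>\<^sub>s\<close> and
  \<open>\<T>\<^sub>\<eta>\<close> depend (up to isomorphism they do not).
\<close>

definition EG_choice ::
    "nat \<Rightarrow> (nat \<Rightarrow> 'k::field) \<Rightarrow> ('g, 'm) monoid_scheme \<Rightarrow> 'g topology
     \<Rightarrow> ('g set + ('g \<Rightarrow> 'k mat) set \<Rightarrow> ('f, 'x) based_affine)
     \<Rightarrow> ('g set + ('g \<Rightarrow> 'k mat) set \<Rightarrow> 'x)
     \<Rightarrow> ('g set + ('g \<Rightarrow> 'k mat) set \<Rightarrow> 'g \<Rightarrow> ('f \<Rightarrow> 'f) \<times> ('x \<Rightarrow> 'x)) \<Rightarrow> bool" where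
  "EG_choice l \<zeta> G T D x0 \<eta> \<longleftrightarrow>
     (\<forall>i\<in>EG_index G T. l_BAR l G T (D i) (\<eta> i) \<and> x0 i \<in> topspace (ba_space (D i))) \<and>
     (\<forall>N. closed_normal_fin G T N \<longrightarrow>
        (\<exists>N'. closed_normal G T N' \<and> N' \<subseteq> N \<and> principal G (D (Inl N)) (\<eta> (Inl N)) N')) \<and>
     (\<forall>\<alpha>\<in>rep_classes G T. \<exists>s enum.
        bij_betw enum {..<card (ba_basis (D (Inr \<alpha>)))} (ba_basis (D (Inr \<alpha>))) \<and>
        (\<lambda>g. rho_mat l \<zeta> s (D (Inr \<alpha>)) (x0 (Inr \<alpha>)) enum (\<eta> (Inr \<alpha>) g)) \<in> \<alpha>)"

definition EG_ring ::
    "nat \<Rightarrow> ('g, 'm) monoid_scheme \<Rightarrow> 'g topology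
     \<Rightarrow> ('g set + ('g \<Rightarrow> 'k::field mat) set \<Rightarrow> ('f, 'x) based_affine)
     \<Rightarrow> ((('g set + ('g \<Rightarrow> 'k mat) set) \<times> 'f \<Rightarrow>\<^sub>0 rat) \<Rightarrow>\<^sub>0 'k) set" where
  "EG_ring l G T D = prod_ring l (EG_index G T) D"

end

theory Submission
  imports Defs
begin

text \<open>
  A finite group \<open>\<Gamma>\<close> acting on a ring \<open>S\<close> makes \<open>S\<close> a Galois cover of \<open>S\<^sup>\<Gamma>\<close> as soon as there are
  \<^emph>\<open>Galois coordinates\<close>: finitely many \<open>x\<^sub>j, y\<^sub>j \<in> S\<close> for which \<open>\<Sum>\<^sub>j x\<^sub>j \<gamma>(y\<^sub>j)\<close> is \<open>1\<close> for \<open>\<gamma> = 1\<close> and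
  \<open>0\<close> otherwise (the criterion of Chase, Harrison and Rosenberg).  The trace form then gives dual
  bases, \<open>\<Sum>\<^sub>j x\<^sub>j \<otimes> y\<^sub>j\<close> is a separability idempotent, and the coordinates invert the torsor map
  (\<open>galois_coordinates.galois_cover\<close>).

  Let a compact group \<open>G\<close> act continuously on a ring \<open>A\<close>, and let \<open>N\<close> be closed normal of finite
  index, hence open.  Consider the functions \<open>\<phi>(h) = \<Sum>\<^sub>j x\<^sub>j h(y\<^sub>j)\<close> on \<open>G\<close> with \<open>x\<^sub>j, y\<^sub>j \<in> A\<close>.  They form
  a ring of locally constant functions that is stable under right translation.  Suppose that each
  \<open>g \<notin> N\<close> can be separated from \<open>1\<close> by such a function, with value \<open>1\<close> at \<open>1\<close> and \<open>0\<close> at \<open>g\<close>.  By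
  compactness finite products and translates of these functions give the indicator function of
  \<open>N\<close>.  Its \<open>x\<^sub>j, y\<^sub>j\<close> are fixed by an open normal subgroup \<open>U\<close>, and averaging them over the finite
  group \<open>NU/U\<close> makes them \<open>N\<close>-invariant without changing the function; this requires that the index,
  a power of \<open>l\<close>, is invertible in \<open>A\<close>.  So \<open>A\<^sup>N\<close> has Galois coordinates over \<open>A\<^sup>G\<close>
  (\<open>galois_cover_of_separating\<close>).

  It remains to separate \<open>g \<notin> N\<close> from \<open>1\<close> on the coordinate ring of \<open>\<E>G\<close>.  The \<open>l\<close>-BAR \<open>\<eta>\<^sub>N\<close> is
  principal for some \<open>N' \<subseteq> N\<close>, so \<open>g\<close> has no fixed point on the affine module \<open>X\<close>.  If \<open>g\<close> acts on
  \<open>X \<cong> F\<close> as \<open>f \<cdot> \<sigma>\<close>, a fixed point is a solution of \<open>y = f + \<sigma> y\<close>, and since \<open>F\<close> is a permutation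
  module, it exists if the coordinates of \<open>f\<close> sum to \<open>0\<close> over each \<open>\<sigma>\<close>-stable set of basis vectors
  (\<open>fixed_point\<close>).  Hence some \<open>\<sigma>\<close>-stable \<open>C \<subseteq> B\<close> has \<open>\<Sum>\<^bsub>b\<in>C\<^esub> f\<^sub>b\<close> nonzero modulo some \<open>l\<^sup>s\<close>, and the
  unit \<open>u = \<Prod>\<^bsub>b\<in>C\<^esub> t\<^sub>b\<^bsup>1/l^s\<^esup>\<close> is an eigenvector of \<open>g\<close> with eigenvalue a root of unity \<open>\<omega> \<noteq> 1\<close>
  (\<open>eigenmonomial\<close>).  The function \<open>\<phi>(h) = (u\<inverse> h(u) - \<omega>) / (1 - \<omega>)\<close> separates \<open>g\<close> from \<open>1\<close>.

  That the group acts continuously on the coordinate ring amounts to the cocycle rule for the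
  translation parts of the \<open>\<eta>(g)\<close> (\<open>shift_coord_mult\<close>) and to the local constancy of their
  coordinates modulo \<open>l\<^sup>s\<close>.
\<close>

section \<open>Galois covers from Galois coordinates\<close>

lemma unital_subring_sum:
  assumes "unital_subring S" "\<And>i. i \<in> I \<Longrightarrow> f i \<in> S"
  shows "sum f I \<in> S"
  using assms(2) by (induction I rule: infinite_finite_induct) (use assms(1) in \<open>auto simp: unital_subring_def\<close>)

lemma unital_subring_uminus: "unital_subring S \<Longrightarrow> a \<in> S \<Longrightarrow> - a \<in> S"
  unfolding unital_subring_def by (metis diff_0)

lemma acts_on_ring_zero:
  assumes "acts_on_ring G S act" "unital_subring S" "g \<in> carrier G"
  shows "act g 0 = 0"
proof -
  have "act g (0 + 0) = act g 0 + act g 0"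
    using assms unfolding acts_on_ring_def unital_subring_def by blast
  then show ?thesis by simp
qed

lemma acts_on_ring_diff:
  assumes "acts_on_ring G S act" "unital_subring S" "g \<in> carrier G" "a \<in> S" "b \<in> S"
  shows "act g (a - b) = act g a - act g b"
proof -
  have "act g (a - b + b) = act g (a - b) + act g b"
    using assms unfolding acts_on_ring_def unital_subring_def by blast
  then show ?thesis by simp
qed

lemma acts_on_ring_sum:
  assumes "acts_on_ring G S act" "unital_subring S" "g \<in> carrier G" "\<And>i. i \<in> I \<Longrightarrow> f i \<in> S"
  shows "act g (sum f I) = (\<Sum>i\<in>I. act g (f i))"
  using assms(4)
proof (induction I rule: infinite_finite_induct)
  case (insert i I)
  then have "act g (f i + sum f I) = act g (f i) + act g (sum f I)"
    using assms(1,3) unital_subring_sum[OF assms(2), of I f] unfolding acts_on_ring_def by auto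
  then show ?case using insert by simp
qed (use acts_on_ring_zero[OF assms(1-3)] in simp_all)

lemma unital_subring_invariants:
  assumes "acts_on_ring G S act" "unital_subring S" "N \<subseteq> carrier G"
  shows "unital_subring (invariants S act N)"
  using assms acts_on_ring_zero[OF assms(1,2)] acts_on_ring_diff[OF assms(1,2)]
  unfolding invariants_def unital_subring_def acts_on_ring_def by auto

lemma acts_on_ring_orbit_sum:
  assumes acts: "acts_on_ring \<Gamma> S act" and S: "unital_subring S"
    and "group \<Gamma>" and Q: "subgroup Q \<Gamma>" and s: "s \<in> S" and \<delta>: "\<delta> \<in> Q"
  shows "act \<delta> (\<Sum>\<gamma>\<in>Q. act \<gamma> s) = (\<Sum>\<gamma>\<in>Q. act \<gamma> s)"
proof -
  interpret group \<Gamma> by fact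
  interpret Q: subgroup Q \<Gamma> by fact
  have "act \<delta> (\<Sum>\<gamma>\<in>Q. act \<gamma> s) = (\<Sum>\<gamma>\<in>Q. act \<delta> (act \<gamma> s))"
    using acts s \<delta> by (intro acts_on_ring_sum[OF acts S]) (auto simp: acts_on_ring_def)
  also have "\<dots> = (\<Sum>\<gamma>\<in>Q. act (\<delta> \<otimes>\<^bsub>\<Gamma>\<^esub> \<gamma>) s)"
    using acts s \<delta> by (intro sum.cong refl) (auto simp: acts_on_ring_def)
  also have "\<dots> = (\<Sum>\<gamma>\<in>Q. act \<gamma> s)"
    using \<delta> by (intro sum.reindex_bij_witness[of _ "\<lambda>\<gamma>. inv\<^bsub>\<Gamma>\<^esub> \<delta> \<otimes>\<^bsub>\<Gamma>\<^esub> \<gamma>" "\<lambda>\<gamma>. \<delta> \<otimes>\<^bsub>\<Gamma>\<^esub> \<gamma>"])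
      (auto simp: m_assoc[symmetric])
  finally show ?thesis .
qed

text \<open>
  The tensor product \<open>S \<otimes>\<^sub>R S\<close> is computed on representatives: two elements of the free abelian
  group on \<open>S \<times> S\<close> are equal tensors if their difference is a relation.
\<close>

context
  fixes R S :: "'a::comm_ring_1 set"
  assumes S: "unital_subring S" and RS: "R \<subseteq> S"
begin

lemma tensor_relations_subgroup: "subgroup (tensor_relations R S) (free_Abelian_group (S \<times> S))"
proof -
  have "Poly_Mapping.keys (frag_of (a + a', b) - frag_of (a, b) - frag_of (a', b)) \<subseteq> S \<times> S"
    "Poly_Mapping.keys (frag_of (a, b + b') - frag_of (a, b) - frag_of (a, b')) \<subseteq> S \<times> S"
    if "a \<in> S" "a' \<in> S" "b \<in> S" "b' \<in> S" for a a' b b'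
    using that S unfolding unital_subring_def
    by (auto dest!: subsetD[OF keys_diff] split: if_splits)
  moreover have "Poly_Mapping.keys (frag_of (a * r, b) - frag_of (a, r * b)) \<subseteq> S \<times> S"
    if "a \<in> S" "b \<in> S" "r \<in> R" for a b r
    using that S RS unfolding unital_subring_def
    by (auto dest!: subsetD[OF keys_diff] split: if_splits)
  ultimately show ?thesis
    unfolding tensor_relations_def
    by (intro group.generate_is_subgroup[OF group_free_Abelian_group]) (auto; blast)
qed

lemma tensor_relations_0: "0 \<in> tensor_relations R S"
  using subgroup.one_closed[OF tensor_relations_subgroup] by simp

lemma tensor_relations_add:
  "p \<in> tensor_relations R S \<Longrightarrow> q \<in> tensor_relations R S \<Longrightarrow> p + q \<in> tensor_relations R S"
  using subgroup.m_closed[OF tensor_relations_subgroup] by simp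

lemma tensor_relations_uminus:
  assumes "p \<in> tensor_relations R S" shows "- p \<in> tensor_relations R S"
proof -
  have "Poly_Mapping.keys p \<subseteq> S \<times> S"
    using subsetD[OF subgroup.subset[OF tensor_relations_subgroup] assms] by simp
  then show ?thesis
    using subgroup.m_inv_closed[OF tensor_relations_subgroup assms] by simp
qed

definition tensor_eq :: "('a \<times> 'a \<Rightarrow>\<^sub>0 int) \<Rightarrow> ('a \<times> 'a \<Rightarrow>\<^sub>0 int) \<Rightarrow> bool" where
  "tensor_eq p q \<longleftrightarrow> p - q \<in> tensor_relations R S"

lemma tensor_eq_refl: "tensor_eq p p"
  by (simp add: tensor_eq_def tensor_relations_0)

lemma tensor_eq_sym: "tensor_eq p q \<Longrightarrow> tensor_eq q p"
  using tensor_relations_uminus[of "p - q"] by (simp add: tensor_eq_def)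

lemma tensor_eq_trans [trans]: "tensor_eq p q \<Longrightarrow> tensor_eq q r \<Longrightarrow> tensor_eq p r"
  using tensor_relations_add[of "p - q" "q - r"] by (simp add: tensor_eq_def)

lemma tensor_eq_add: "tensor_eq p q \<Longrightarrow> tensor_eq p' q' \<Longrightarrow> tensor_eq (p + p') (q + q')"
  using tensor_relations_add[of "p - q" "p' - q'"] by (simp add: tensor_eq_def algebra_simps)

lemma tensor_eq_uminus: "tensor_eq p q \<Longrightarrow> tensor_eq (- p) (- q)"
  using tensor_relations_uminus[of "p - q"] by (simp add: tensor_eq_def)

lemma tensor_eq_diff: "tensor_eq p q \<Longrightarrow> tensor_eq p' q' \<Longrightarrow> tensor_eq (p - p') (q - q')"
  using tensor_eq_add[OF _ tensor_eq_uminus, of p q p' q'] by simp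

lemma tensor_eq_sum: "(\<And>i. i \<in> I \<Longrightarrow> tensor_eq (f i) (g i)) \<Longrightarrow> tensor_eq (sum f I) (sum g I)"
  by (induction I rule: infinite_finite_induct) (auto simp: tensor_eq_refl tensor_eq_add)

lemma tensor_eq_add_left:
  assumes "a \<in> S" "a' \<in> S" "b \<in> S"
  shows "tensor_eq (frag_of (a + a', b)) (frag_of (a, b) + frag_of (a', b))"
  unfolding tensor_eq_def diff_diff_eq[symmetric] tensor_relations_def
  by (rule generate.incl) (use assms in blast)

lemma tensor_eq_add_right:
  assumes "a \<in> S" "b \<in> S" "b' \<in> S"
  shows "tensor_eq (frag_of (a, b + b')) (frag_of (a, b) + frag_of (a, b'))"
  unfolding tensor_eq_def diff_diff_eq[symmetric] tensor_relations_def
  by (rule generate.incl) (use assms in blast)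

lemma tensor_eq_balanced:
  assumes "a \<in> S" "b \<in> S" "r \<in> R"
  shows "tensor_eq (frag_of (a * r, b)) (frag_of (a, r * b))"
  unfolding tensor_eq_def tensor_relations_def
  by (rule generate.incl) (use assms in blast)

lemma tensor_eq_0_left: "b \<in> S \<Longrightarrow> tensor_eq (frag_of (0, b)) 0"
  using tensor_eq_diff[OF tensor_eq_add_left[of 0 0 b] tensor_eq_refl[of "frag_of (0, b)"]] S
  by (auto simp: unital_subring_def intro: tensor_eq_sym)

lemma tensor_eq_0_right: "a \<in> S \<Longrightarrow> tensor_eq (frag_of (a, 0)) 0"
  using tensor_eq_diff[OF tensor_eq_add_right[of a 0 0] tensor_eq_refl[of "frag_of (a, 0)"]] S
  by (auto simp: unital_subring_def intro: tensor_eq_sym)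

lemma tensor_eq_sum_right:
  assumes "a \<in> S" "\<And>i. i \<in> I \<Longrightarrow> f i \<in> S"
  shows "tensor_eq (frag_of (a, sum f I)) (\<Sum>i\<in>I. frag_of (a, f i))"
  using assms(2)
proof (induction I rule: infinite_finite_induct)
  case (insert i I)
  have "tensor_eq (frag_of (a, f i + sum f I)) (frag_of (a, f i) + frag_of (a, sum f I))"
    using insert.prems assms(1) S by (intro tensor_eq_add_right unital_subring_sum) auto
  also have "tensor_eq \<dots> (frag_of (a, f i) + (\<Sum>i\<in>I. frag_of (a, f i)))"
    using insert by (intro tensor_eq_add tensor_eq_refl) auto
  finally show ?case using insert by simp
qed (use tensor_eq_0_right assms(1) in simp_all)

end

text \<open>
  On the free abelian group the torsor map is additive, so that it is determined by its values
  \<open>a * \<gamma>(b)\<close> at the generators.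
\<close>

lemma torsor_map_eq:
  assumes "\<gamma> \<in> carrier \<Gamma>"
  shows "torsor_map \<Gamma> act p \<gamma> =
    (\<Sum>k\<in>Poly_Mapping.keys p. of_int (Poly_Mapping.lookup p k) * (fst k * act \<gamma> (snd k)))"
  using assms by (simp add: torsor_map_def case_prod_unfold)

lemma torsor_map_add:
  "\<gamma> \<in> carrier \<Gamma> \<Longrightarrow> torsor_map \<Gamma> act (p + q) \<gamma> = torsor_map \<Gamma> act p \<gamma> + torsor_map \<Gamma> act q \<gamma>"
  unfolding torsor_map_eq
  by (rule setsum_keys_plus_distrib[where f = "\<lambda>k c. of_int c * (fst k * act \<gamma> (snd k))"])
     (simp_all add: distrib_right)

lemma torsor_map_frag_of: "\<gamma> \<in> carrier \<Gamma> \<Longrightarrow> torsor_map \<Gamma> act (frag_of (a, b)) \<gamma> = a * act \<gamma> b"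
  by (simp add: torsor_map_eq)

lemma torsor_map_0: "\<gamma> \<in> carrier \<Gamma> \<Longrightarrow> torsor_map \<Gamma> act 0 \<gamma> = 0"
  by (simp add: torsor_map_eq)

lemma torsor_map_uminus: "\<gamma> \<in> carrier \<Gamma> \<Longrightarrow> torsor_map \<Gamma> act (- p) \<gamma> = - torsor_map \<Gamma> act p \<gamma>"
  by (simp add: torsor_map_eq sum_negf)

lemma torsor_map_diff:
  "\<gamma> \<in> carrier \<Gamma> \<Longrightarrow> torsor_map \<Gamma> act (p - q) \<gamma> = torsor_map \<Gamma> act p \<gamma> - torsor_map \<Gamma> act q \<gamma>"
  using torsor_map_add[of \<gamma> \<Gamma> act p "- q"] by (simp add: torsor_map_uminus)

lemma torsor_map_sum:
  "\<gamma> \<in> carrier \<Gamma> \<Longrightarrow> torsor_map \<Gamma> act (sum f I) \<gamma> = (\<Sum>i\<in>I. torsor_map \<Gamma> act (f i) \<gamma>)"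
  by (induction I rule: infinite_finite_induct) (simp_all add: torsor_map_0 torsor_map_add)

text \<open>
  Galois coordinates.  They exist for \<open>S\<close> over \<open>S\<^sup>\<Gamma>\<close> exactly if \<open>S\<close> is Galois; the sufficiency is
  proved here.
\<close>

locale galois_coordinates =
  fixes \<Gamma> :: "('c, 'm) monoid_scheme" and S :: "'a::comm_ring_1 set" and act :: "'c \<Rightarrow> 'a \<Rightarrow> 'a"
    and n :: nat and x y :: "nat \<Rightarrow> 'a"
  assumes group: "group \<Gamma>" and finite_carrier: "finite (carrier \<Gamma>)"
    and subring: "unital_subring S" and acts: "acts_on_ring \<Gamma> S act"
    and x_in: "\<And>j. j < n \<Longrightarrow> x j \<in> S" and y_in: "\<And>j. j < n \<Longrightarrow> y j \<in> S"
    and delta: "\<And>\<gamma>. \<gamma> \<in> carrier \<Gamma> \<Longrightarrow>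
        (\<Sum>j<n. x j * act \<gamma> (y j)) = (if \<gamma> = \<one>\<^bsub>\<Gamma>\<^esub> then 1 else 0)"
begin

abbreviation R :: "'a set" where "R \<equiv> invariants S act (carrier \<Gamma>)"

definition trace :: "'a \<Rightarrow> 'a" where
  "trace s = (\<Sum>\<gamma>\<in>carrier \<Gamma>. act \<gamma> s)"

lemma act_in: "\<gamma> \<in> carrier \<Gamma> \<Longrightarrow> s \<in> S \<Longrightarrow> act \<gamma> s \<in> S"
  and act_one: "s \<in> S \<Longrightarrow> act \<one>\<^bsub>\<Gamma>\<^esub> s = s"
  and act_act: "\<gamma> \<in> carrier \<Gamma> \<Longrightarrow> \<delta> \<in> carrier \<Gamma> \<Longrightarrow> s \<in> S \<Longrightarrow> act (\<gamma> \<otimes>\<^bsub>\<Gamma>\<^esub> \<delta>) s = act \<gamma> (act \<delta> s)"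
  and act_add: "\<gamma> \<in> carrier \<Gamma> \<Longrightarrow> s \<in> S \<Longrightarrow> t \<in> S \<Longrightarrow> act \<gamma> (s + t) = act \<gamma> s + act \<gamma> t"
  and act_mult: "\<gamma> \<in> carrier \<Gamma> \<Longrightarrow> s \<in> S \<Longrightarrow> t \<in> S \<Longrightarrow> act \<gamma> (s * t) = act \<gamma> s * act \<gamma> t"
  and act_1: "\<gamma> \<in> carrier \<Gamma> \<Longrightarrow> act \<gamma> 1 = 1"
  using acts unfolding acts_on_ring_def by blast+

lemmas act_sum = acts_on_ring_sum[OF acts subring]

lemma S_mult: "s \<in> S \<Longrightarrow> t \<in> S \<Longrightarrow> s * t \<in> S"
  and S_add: "s \<in> S \<Longrightarrow> t \<in> S \<Longrightarrow> s + t \<in> S"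
  using subring unfolding unital_subring_def by blast+

lemmas S_sum = unital_subring_sum[OF subring]

lemma R_subset: "R \<subseteq> S"
  by (auto simp: invariants_def)

lemma trace_in_R:
  assumes "s \<in> S"
  shows "trace s \<in> R"
  using acts_on_ring_orbit_sum[OF acts subring group group.subgroup_self[OF group] assms] assms
  unfolding invariants_def trace_def by (auto intro!: S_sum act_in)

text \<open>Applying \<open>\<delta>\<close> to the coordinates of \<open>\<delta>\<inverse>\<gamma>\<close> moves the Kronecker delta to an arbitrary pair.\<close>

lemma delta_pair:
  assumes "\<gamma> \<in> carrier \<Gamma>" "\<delta> \<in> carrier \<Gamma>"
  shows "(\<Sum>j<n. act \<delta> (x j) * act \<gamma> (y j)) = (if \<gamma> = \<delta> then 1 else 0)"
proof -
  interpret group \<Gamma> by (rule group)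
  have "act \<delta> (\<Sum>j<n. x j * act (inv\<^bsub>\<Gamma>\<^esub> \<delta> \<otimes>\<^bsub>\<Gamma>\<^esub> \<gamma>) (y j)) = (\<Sum>j<n. act \<delta> (x j) * act \<gamma> (y j))"
  proof (subst act_sum)
    show "(\<Sum>j<n. act \<delta> (x j * act (inv\<^bsub>\<Gamma>\<^esub> \<delta> \<otimes>\<^bsub>\<Gamma>\<^esub> \<gamma>) (y j))) = (\<Sum>j<n. act \<delta> (x j) * act \<gamma> (y j))"
    proof (rule sum.cong[OF refl])
      fix j assume j: "j \<in> {..<n}"
      have "act \<delta> (act (inv\<^bsub>\<Gamma>\<^esub> \<delta> \<otimes>\<^bsub>\<Gamma>\<^esub> \<gamma>) (y j)) = act (\<delta> \<otimes>\<^bsub>\<Gamma>\<^esub> (inv\<^bsub>\<Gamma>\<^esub> \<delta> \<otimes>\<^bsub>\<Gamma>\<^esub> \<gamma>)) (y j)"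
        using assms j by (simp add: act_act y_in)
      also have "\<dots> = act \<gamma> (y j)"
        using assms by (simp add: m_assoc[symmetric])
      finally show "act \<delta> (x j * act (inv\<^bsub>\<Gamma>\<^esub> \<delta> \<otimes>\<^bsub>\<Gamma>\<^esub> \<gamma>) (y j)) = act \<delta> (x j) * act \<gamma> (y j)"
        using assms j by (simp add: act_mult act_in x_in y_in)
    qed
  qed (use assms in \<open>auto intro!: S_mult act_in x_in y_in\<close>)
  moreover have "inv\<^bsub>\<Gamma>\<^esub> \<delta> \<otimes>\<^bsub>\<Gamma>\<^esub> \<gamma> = \<one>\<^bsub>\<Gamma>\<^esub> \<longleftrightarrow> \<gamma> = \<delta>"
    using assms by (metis inv_closed inv_equality inv_inv l_inv)
  moreover have "act \<delta> 0 = 0" "act \<delta> 1 = 1"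
    using acts_on_ring_zero[OF acts subring] act_1 assms by auto
  ultimately show ?thesis
    using delta[of "inv\<^bsub>\<Gamma>\<^esub> \<delta> \<otimes>\<^bsub>\<Gamma>\<^esub> \<gamma>"] assms by (auto split: if_splits)
qed

text \<open>
  The delta property says that the \<open>x\<^sub>j\<close> and the functionals \<open>trace (y\<^sub>j _)\<close> are dual bases, and by
  \<open>delta_pair\<close> so are the \<open>y\<^sub>j\<close> and \<open>trace (x\<^sub>j _)\<close>.
\<close>

lemma trace_expansion_x:
  assumes "s \<in> S"
  shows "(\<Sum>j<n. trace (y j * s) * x j) = s"
proof -
  have "(\<Sum>j<n. trace (y j * s) * x j) = (\<Sum>j<n. \<Sum>\<gamma>\<in>carrier \<Gamma>. act \<gamma> s * (x j * act \<gamma> (y j)))"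
    unfolding trace_def sum_distrib_right
    by (intro sum.cong refl) (use assms in \<open>simp add: act_mult y_in mult_ac\<close>)
  also have "\<dots> = (\<Sum>\<gamma>\<in>carrier \<Gamma>. act \<gamma> s * (\<Sum>j<n. x j * act \<gamma> (y j)))"
    by (subst sum.swap) (simp add: sum_distrib_left)
  also have "\<dots> = (\<Sum>\<gamma>\<in>carrier \<Gamma>. if \<gamma> = \<one>\<^bsub>\<Gamma>\<^esub> then act \<gamma> s else 0)"
    by (intro sum.cong refl) (simp add: delta)
  also have "\<dots> = s"
    using finite_carrier group assms by (simp add: act_one group.is_monoid monoid.one_closed)
  finally show ?thesis .
qed

lemma trace_expansion_y:
  assumes "s \<in> S"
  shows "(\<Sum>j<n. trace (s * x j) * y j) = s"
proof -
  interpret group \<Gamma> by (rule group)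
  have "(\<Sum>j<n. trace (s * x j) * y j) = (\<Sum>j<n. \<Sum>\<gamma>\<in>carrier \<Gamma>. act \<gamma> s * (act \<gamma> (x j) * act \<one>\<^bsub>\<Gamma>\<^esub> (y j)))"
    unfolding trace_def sum_distrib_right
    by (intro sum.cong refl) (use assms in \<open>simp add: act_mult x_in y_in act_one mult_ac\<close>)
  also have "\<dots> = (\<Sum>\<gamma>\<in>carrier \<Gamma>. act \<gamma> s * (\<Sum>j<n. act \<gamma> (x j) * act \<one>\<^bsub>\<Gamma>\<^esub> (y j)))"
    by (subst sum.swap) (simp add: sum_distrib_left)
  also have "\<dots> = (\<Sum>\<gamma>\<in>carrier \<Gamma>. if \<gamma> = \<one>\<^bsub>\<Gamma>\<^esub> then act \<gamma> s else 0)"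
    by (intro sum.cong refl) (simp add: delta_pair)
  also have "\<dots> = s"
    using finite_carrier assms by (simp add: act_one)
  finally show ?thesis .
qed

lemma fin_projective: "fin_projective R S"
  unfolding fin_projective_def
proof (intro exI conjI allI impI ballI)
  let ?\<phi> = "\<lambda>j s. trace (y j * s)"
  fix j assume j: "j < n"
  show "x j \<in> S" using j by (rule x_in)
  fix s assume s: "s \<in> S"
  show "?\<phi> j s \<in> R" using j s by (intro trace_in_R S_mult y_in)
  show "?\<phi> j (s + t) = ?\<phi> j s + ?\<phi> j t" if "t \<in> S" for t
    unfolding trace_def sum.distrib[symmetric]
    by (rule sum.cong[OF refl]) (use that j s in \<open>simp add: distrib_left act_add S_mult y_in\<close>)
  show "?\<phi> j (r * s) = r * ?\<phi> j s" if "r \<in> R" for r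
    unfolding trace_def sum_distrib_left
    by (rule sum.cong[OF refl])
       (use that j s in \<open>auto simp: invariants_def act_mult S_mult y_in mult_ac\<close>)
next
  fix s assume "s \<in> S"
  then show "s = (\<Sum>j<n. trace (y j * s) * x j)" by (simp add: trace_expansion_x)
qed

lemmas teq_trans [trans] = tensor_eq_trans[OF subring R_subset]

abbreviation teq (infix "\<approx>\<^sub>t" 50) where "p \<approx>\<^sub>t q \<equiv> tensor_eq R S p q"

text \<open>
  A tensor can be recovered from its image under the torsor map.  For \<open>a \<otimes> b\<close>, expand \<open>b\<close> in the
  \<open>y\<^sub>j\<close> and move the coefficients \<open>trace (b x\<^sub>j) \<in> R\<close> to the left factor; there
  \<open>a * trace (b x\<^sub>j) = \<Sum>\<^sub>\<gamma> a \<gamma>(b) \<gamma>(x\<^sub>j)\<close> involves only the values \<open>a \<gamma>(b)\<close> of the torsor map.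
\<close>

lemma tensor_eq_torsor_coordinates:
  assumes "Poly_Mapping.keys p \<subseteq> S \<times> S"
  shows "p \<approx>\<^sub>t (\<Sum>j<n. frag_of (\<Sum>\<gamma>\<in>carrier \<Gamma>. torsor_map \<Gamma> act p \<gamma> * act \<gamma> (x j), y j))"
    and "\<gamma> \<in> carrier \<Gamma> \<Longrightarrow> torsor_map \<Gamma> act p \<gamma> \<in> S"
proof -
  note sr = subring R_subset
  let ?c = "\<lambda>p j. \<Sum>\<gamma>\<in>carrier \<Gamma>. torsor_map \<Gamma> act p \<gamma> * act \<gamma> (x j)"
  have in_S: "?c p j \<in> S" if "\<forall>\<gamma>\<in>carrier \<Gamma>. torsor_map \<Gamma> act p \<gamma> \<in> S" "j < n" for p j
    using that by (intro S_sum S_mult act_in x_in) auto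
  have "p \<approx>\<^sub>t (\<Sum>j<n. frag_of (?c p j, y j)) \<and> (\<forall>\<gamma>\<in>carrier \<Gamma>. torsor_map \<Gamma> act p \<gamma> \<in> S)"
    using assms
  proof (induction p rule: frag_induction)
    case zero
    have "(\<Sum>j<n. 0) \<approx>\<^sub>t (\<Sum>j<n. frag_of (?c 0 j, y j))"
      by (rule tensor_eq_sum[OF sr])
         (auto simp: torsor_map_0 y_in intro!: tensor_eq_sym[OF sr] tensor_eq_0_left[OF sr])
    then show ?case
      using subring by (simp add: torsor_map_0 unital_subring_def)
  next
    case (one k)
    then obtain a b where k: "k = (a, b)" and a: "a \<in> S" and b: "b \<in> S" by auto
    have "frag_of (a, b) = frag_of (a, \<Sum>j<n. trace (b * x j) * y j)"
      using b by (simp add: trace_expansion_y)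
    also have "\<dots> \<approx>\<^sub>t (\<Sum>j<n. frag_of (a, trace (b * x j) * y j))"
      using a b by (intro tensor_eq_sum_right[OF sr])
        (auto intro!: S_mult y_in x_in subsetD[OF R_subset trace_in_R])
    also have "\<dots> \<approx>\<^sub>t (\<Sum>j<n. frag_of (a * trace (b * x j), y j))"
      using a b
      by (intro tensor_eq_sum[OF sr], intro tensor_eq_sym[OF sr, OF tensor_eq_balanced[OF sr]])
         (auto intro!: S_mult y_in x_in trace_in_R)
    also have "\<dots> = (\<Sum>j<n. frag_of (?c (frag_of k) j, y j))"
    proof (rule sum.cong[OF refl])
      fix j assume "j \<in> {..<n}"
      then have "a * trace (b * x j) = ?c (frag_of k) j"
        unfolding trace_def sum_distrib_left k
        by (intro sum.cong refl) (simp add: torsor_map_frag_of act_mult b x_in mult_ac)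
      then show "frag_of (a * trace (b * x j), y j) = frag_of (?c (frag_of k) j, y j)" by simp
    qed
    finally show ?case
      using a b by (simp add: k torsor_map_frag_of S_mult act_in)
  next
    case (diff p q)
    have "p - q \<approx>\<^sub>t (\<Sum>j<n. frag_of (?c p j, y j)) - (\<Sum>j<n. frag_of (?c q j, y j))"
      using diff by (intro tensor_eq_diff[OF sr]) auto
    also have "\<dots> = (\<Sum>j<n. frag_of (?c p j, y j) - frag_of (?c q j, y j))"
      by (simp add: sum_subtractf)
    also have "\<dots> \<approx>\<^sub>t (\<Sum>j<n. frag_of (?c (p - q) j, y j))"
    proof (rule tensor_eq_sum[OF sr])
      fix j assume j: "j \<in> {..<n}"
      have eq: "?c p j = ?c (p - q) j + ?c q j"
        by (simp add: torsor_map_diff left_diff_distrib sum_subtractf)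
      have "?c (p - q) j \<in> S" "?c q j \<in> S"
        using diff j subring by (intro in_S; auto simp: torsor_map_diff unital_subring_def)+
      then have "frag_of (?c (p - q) j + ?c q j, y j) \<approx>\<^sub>t
          frag_of (?c (p - q) j, y j) + frag_of (?c q j, y j)"
        using j by (intro tensor_eq_add_left[OF sr] y_in) auto
      then have "frag_of (?c p j, y j) \<approx>\<^sub>t frag_of (?c (p - q) j, y j) + frag_of (?c q j, y j)"
        unfolding eq .
      from tensor_eq_diff[OF sr this tensor_eq_refl[OF sr, of "frag_of (?c q j, y j)"]]
      show "frag_of (?c p j, y j) - frag_of (?c q j, y j) \<approx>\<^sub>t frag_of (?c (p - q) j, y j)"
        by simp
    qed
    finally show ?case
      using diff subring by (auto simp: torsor_map_diff unital_subring_def)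
  qed
  then show "p \<approx>\<^sub>t (\<Sum>j<n. frag_of (?c p j, y j))"
    and "\<gamma> \<in> carrier \<Gamma> \<Longrightarrow> torsor_map \<Gamma> act p \<gamma> \<in> S" by auto
qed

lemma torsor_map_zero_imp_relation:
  assumes "Poly_Mapping.keys p \<subseteq> S \<times> S" "\<And>\<gamma>. \<gamma> \<in> carrier \<Gamma> \<Longrightarrow> torsor_map \<Gamma> act p \<gamma> = 0"
  shows "p \<in> tensor_relations R S"
proof -
  note sr = subring R_subset
  have "p \<approx>\<^sub>t (\<Sum>j<n. frag_of (0, y j))"
    using tensor_eq_torsor_coordinates(1)[OF assms(1)] assms(2) by simp
  also have "\<dots> \<approx>\<^sub>t (\<Sum>j<n. 0)"
    by (rule tensor_eq_sum[OF sr], rule tensor_eq_0_left[OF sr]) (auto intro: y_in)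
  finally show ?thesis
    using tensor_eq_def[OF sr, of p 0] by simp
qed

text \<open>
  Both \<open>\<Sum>\<^sub>j s x\<^sub>j \<otimes> y\<^sub>j\<close> and \<open>\<Sum>\<^sub>j x\<^sub>j \<otimes> y\<^sub>j s\<close> have the image \<open>s\<close> at \<open>1\<close> and \<open>0\<close> elsewhere under the
  injective torsor map.
\<close>

lemma separable: "separable_algebra R S"
proof -
  interpret group \<Gamma> by (rule group)
  have "(\<Sum>j<n. frag_of (s * x j, y j)) - (\<Sum>j<n. frag_of (x j, y j * s)) \<in> tensor_relations R S"
    if s: "s \<in> S" for s
  proof (rule torsor_map_zero_imp_relation)
    have "Poly_Mapping.keys (\<Sum>j<n. frag_of (s * x j, y j)) \<subseteq> S \<times> S"
      by (rule order_trans[OF keys_sum]) (use s in \<open>auto intro!: S_mult x_in y_in\<close>)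
    moreover have "Poly_Mapping.keys (\<Sum>j<n. frag_of (x j, y j * s)) \<subseteq> S \<times> S"
      by (rule order_trans[OF keys_sum]) (use s in \<open>auto intro!: S_mult x_in y_in\<close>)
    ultimately show "Poly_Mapping.keys ((\<Sum>j<n. frag_of (s * x j, y j)) - (\<Sum>j<n. frag_of (x j, y j * s))) \<subseteq> S \<times> S"
      using keys_diff[of "\<Sum>j<n. frag_of (s * x j, y j)" "\<Sum>j<n. frag_of (x j, y j * s)"] by blast
  next
    fix \<gamma> assume \<gamma>: "\<gamma> \<in> carrier \<Gamma>"
    have "(\<Sum>j<n. s * x j * act \<gamma> (y j)) = s * (\<Sum>j<n. x j * act \<gamma> (y j))"
      by (simp add: sum_distrib_left mult_ac)
    moreover have "(\<Sum>j<n. x j * act \<gamma> (y j * s)) = act \<gamma> s * (\<Sum>j<n. x j * act \<gamma> (y j))"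
      unfolding sum_distrib_left by (intro sum.cong refl) (simp add: act_mult \<gamma> s y_in mult_ac)
    ultimately show "torsor_map \<Gamma> act ((\<Sum>j<n. frag_of (s * x j, y j)) - (\<Sum>j<n. frag_of (x j, y j * s))) \<gamma> = 0"
      using \<gamma> s by (simp add: torsor_map_diff torsor_map_sum torsor_map_frag_of delta act_one)
  qed
  moreover have "(\<Sum>j<n. x j * y j) = 1"
    using delta[of "\<one>\<^bsub>\<Gamma>\<^esub>"] by (simp add: act_one y_in)
  ultimately show ?thesis
    unfolding separable_algebra_def using x_in y_in by blast
qed

lemma torsor_map_hom:
  "torsor_map \<Gamma> act \<in> hom (free_Abelian_group (S \<times> S))
     (product_group (carrier \<Gamma>) (\<lambda>_. additive_group S))"
proof (rule homI)
  fix p assume "p \<in> carrier (free_Abelian_group (S \<times> S))"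
  then have "\<gamma> \<in> carrier \<Gamma> \<Longrightarrow> torsor_map \<Gamma> act p \<gamma> \<in> S" for \<gamma>
    using tensor_eq_torsor_coordinates(2) by simp
  moreover have "torsor_map \<Gamma> act p \<in> extensional (carrier \<Gamma>)"
    by (simp add: torsor_map_def)
  ultimately show "torsor_map \<Gamma> act p \<in> carrier (product_group (carrier \<Gamma>) (\<lambda>_. additive_group S))"
    by (auto simp: product_group_def additive_group_def PiE_def)
next
  fix p q
  show "torsor_map \<Gamma> act (p \<otimes>\<^bsub>free_Abelian_group (S \<times> S)\<^esub> q) =
      torsor_map \<Gamma> act p \<otimes>\<^bsub>product_group (carrier \<Gamma>) (\<lambda>_. additive_group S)\<^esub> torsor_map \<Gamma> act q"
  proof
    fix \<gamma>
    show "torsor_map \<Gamma> act (p \<otimes>\<^bsub>free_Abelian_group (S \<times> S)\<^esub> q) \<gamma> =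
      (torsor_map \<Gamma> act p \<otimes>\<^bsub>product_group (carrier \<Gamma>) (\<lambda>_. additive_group S)\<^esub> torsor_map \<Gamma> act q) \<gamma>"
      by (cases "\<gamma> \<in> carrier \<Gamma>")
         (auto simp: product_group_def additive_group_def torsor_map_add, simp add: torsor_map_def)
  qed
qed

lemma group_additive_group: "group (additive_group S)"
proof -
  have "0 \<in> S" using subring by (simp add: unital_subring_def)
  moreover have "\<exists>b\<in>S. b + a = 0" if "a \<in> S" for a
    using that unital_subring_uminus[OF subring] by (intro bexI[of _ "- a"]) auto
  ultimately show ?thesis
    by (intro groupI) (simp_all add: additive_group_def S_add add.assoc)
qed

lemma torsor_iso:
  "(\<lambda>X. the_elem (torsor_map \<Gamma> act ` X))
     \<in> iso (tensor_product R S) (product_group (carrier \<Gamma>) (\<lambda>_. additive_group S))"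
proof -
  note sr = subring R_subset
  let ?F = "free_Abelian_group (S \<times> S)" and ?P = "product_group (carrier \<Gamma>) (\<lambda>_. additive_group S)"
  have hom: "group_hom ?F ?P (torsor_map \<Gamma> act)"
    by (simp add: group_hom_def group_hom_axioms_def torsor_map_hom group_additive_group)
  have ker: "kernel ?F ?P (torsor_map \<Gamma> act) = tensor_relations R S"
  proof
    show "kernel ?F ?P (torsor_map \<Gamma> act) \<subseteq> tensor_relations R S"
    proof
      fix p assume "p \<in> kernel ?F ?P (torsor_map \<Gamma> act)"
      then have "Poly_Mapping.keys p \<subseteq> S \<times> S" "torsor_map \<Gamma> act p = (\<lambda>\<gamma>\<in>carrier \<Gamma>. 0)"
        by (auto simp: kernel_def product_group_def additive_group_def)
      then show "p \<in> tensor_relations R S"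
        by (intro torsor_map_zero_imp_relation) auto
    qed
    have "torsor_map \<Gamma> act p \<gamma> = 0" if "p \<in> tensor_relations R S" "\<gamma> \<in> carrier \<Gamma>" for p \<gamma>
      using that(1) unfolding tensor_relations_def
    proof (induction p rule: generate.induct)
      case (incl p)
      then show ?case
        using that(2)
        by (auto simp: torsor_map_diff torsor_map_frag_of act_add act_mult invariants_def distrib_left distrib_right mult_ac)
    next
      case (inv p)
      then have "Poly_Mapping.keys p \<subseteq> S \<times> S"
        using subsetD[OF subgroup.subset[OF tensor_relations_subgroup[OF sr],
              unfolded tensor_relations_def] generate.incl[OF inv]] by simp
      moreover have "torsor_map \<Gamma> act p \<gamma> = 0"
        using inv that(2)
        by (auto simp: torsor_map_diff torsor_map_frag_of act_add act_mult invariants_def distrib_left distrib_right mult_ac)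
      ultimately show ?case using that(2) by (simp add: torsor_map_uminus)
    qed (use that(2) in \<open>simp_all add: torsor_map_0 torsor_map_add\<close>)
    moreover have "torsor_map \<Gamma> act p \<in> extensional (carrier \<Gamma>)" for p
      by (simp add: torsor_map_def)
    ultimately have "torsor_map \<Gamma> act p = (\<lambda>\<gamma>\<in>carrier \<Gamma>. 0)" if "p \<in> tensor_relations R S" for p
      using that by (intro extensionalityI[of _ "carrier \<Gamma>"]) auto
    moreover have "p \<in> carrier ?F" if "p \<in> tensor_relations R S" for p
      using subsetD[OF subgroup.subset[OF tensor_relations_subgroup[OF sr]] that] .
    ultimately show "tensor_relations R S \<subseteq> kernel ?F ?P (torsor_map \<Gamma> act)"
      by (auto simp only: kernel_def product_group_def additive_group_def) simp
  qed
  have "torsor_map \<Gamma> act ` carrier ?F = carrier ?P"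
  proof
    show "torsor_map \<Gamma> act ` carrier ?F \<subseteq> carrier ?P"
      using torsor_map_hom unfolding hom_def by blast
    show "carrier ?P \<subseteq> torsor_map \<Gamma> act ` carrier ?F"
    proof
      fix f assume "f \<in> carrier ?P"
      then have f: "f \<in> extensional (carrier \<Gamma>)" "\<And>\<gamma>. \<gamma> \<in> carrier \<Gamma> \<Longrightarrow> f \<gamma> \<in> S"
        by (auto simp: product_group_def additive_group_def PiE_def)
      \<comment> \<open>by \<open>delta_pair\<close>, the element \<open>\<Sum>\<^sub>j \<delta>(x\<^sub>j) \<otimes> y\<^sub>j\<close> maps to the indicator of \<open>\<delta>\<close>\<close>
      let ?p = "\<Sum>\<delta>\<in>carrier \<Gamma>. \<Sum>j<n. frag_of (f \<delta> * act \<delta> (x j), y j)"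
      have "?p \<in> carrier ?F"
        by (intro sum_closed_free_Abelian_group) (auto intro!: S_mult f act_in x_in y_in)
      moreover have "torsor_map \<Gamma> act ?p = f"
      proof (rule extensionalityI[OF _ f(1)])
        fix \<gamma> assume \<gamma>: "\<gamma> \<in> carrier \<Gamma>"
        have "torsor_map \<Gamma> act ?p \<gamma> = (\<Sum>\<delta>\<in>carrier \<Gamma>. f \<delta> * (\<Sum>j<n. act \<delta> (x j) * act \<gamma> (y j)))"
          using \<gamma> by (simp add: torsor_map_sum torsor_map_frag_of sum_distrib_left mult_ac)
        also have "\<dots> = (\<Sum>\<delta>\<in>carrier \<Gamma>. if \<delta> = \<gamma> then f \<delta> else 0)"
          by (intro sum.cong refl) (use \<gamma> in \<open>auto simp: delta_pair\<close>)
        also have "\<dots> = f \<gamma>" using finite_carrier \<gamma> by simp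
        finally show "torsor_map \<Gamma> act ?p \<gamma> = f \<gamma>" .
      qed (simp add: torsor_map_def)
      ultimately show "f \<in> torsor_map \<Gamma> act ` carrier ?F" by force
    qed
  qed
  from group_hom.FactGroup_iso_set[OF hom this] show ?thesis
    by (simp add: ker tensor_product_def)
qed

theorem galois_cover: "galois_cover R S \<Gamma> act"
  unfolding galois_cover_def finite_etale_def
proof (intro conjI)
  show "unital_subring R"
    by (rule unital_subring_invariants[OF acts subring order_refl])
  show "\<forall>\<gamma>\<in>carrier \<Gamma>. \<forall>r\<in>R. act \<gamma> r = r"
    by (auto simp: invariants_def)
qed (fact subring R_subset group finite_carrier acts fin_projective separable torsor_iso)+

end

section \<open>Locally constant functions and finite index subgroups of compact groups\<close>

text \<open>
  Continuity of a map into a discrete space, without reference to a codomain.  In this form it is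
  preserved by arbitrary operations on the values.
\<close>

definition locally_constant :: "'t topology \<Rightarrow> ('t \<Rightarrow> 'b) \<Rightarrow> bool" where
  "locally_constant T f \<longleftrightarrow> (\<forall>x\<in>topspace T. \<exists>W. openin T W \<and> x \<in> W \<and> (\<forall>y\<in>W. f y = f x))"

lemma locally_constantD:
  "locally_constant T f \<Longrightarrow> x \<in> topspace T \<Longrightarrow> \<exists>W. openin T W \<and> x \<in> W \<and> (\<forall>y\<in>W. f y = f x)"
  unfolding locally_constant_def by blast

lemma locally_constant_const: "locally_constant T (\<lambda>_. c)"
  unfolding locally_constant_def by (intro ballI exI[of _ "topspace T"]) auto

lemma locally_constant_combine:
  assumes "locally_constant T f" "locally_constant T g"
  shows "locally_constant T (\<lambda>x. h (f x) (g x))"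
  unfolding locally_constant_def
proof
  fix x assume x: "x \<in> topspace T"
  obtain W where "openin T W" "x \<in> W" "\<forall>y\<in>W. f y = f x"
    using locally_constantD[OF assms(1) x] by blast
  moreover obtain W' where "openin T W'" "x \<in> W'" "\<forall>y\<in>W'. g y = g x"
    using locally_constantD[OF assms(2) x] by blast
  ultimately show "\<exists>W. openin T W \<and> x \<in> W \<and> (\<forall>y\<in>W. h (f y) (g y) = h (f x) (g x))"
    by (intro exI[of _ "W \<inter> W'"]) (metis IntD1 IntD2 IntI openin_Int)
qed

lemma locally_constant_cong:
  assumes "locally_constant T f" "\<And>x. x \<in> topspace T \<Longrightarrow> g x = f x"
  shows "locally_constant T g"
  unfolding locally_constant_def
proof
  fix x assume x: "x \<in> topspace T"
  obtain W where W: "openin T W" "x \<in> W" "\<forall>y\<in>W. f y = f x"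
    using locally_constantD[OF assms(1) x] by blast
  have "g y = g x" if y: "y \<in> W" for y
  proof -
    have "g y = f y" using y openin_subset[OF W(1)] by (intro assms(2)) blast
    also have "f y = f x" using W(3) y by (rule bspec)
    finally show ?thesis by (simp only: assms(2)[OF x])
  qed
  then show "\<exists>W. openin T W \<and> x \<in> W \<and> (\<forall>y\<in>W. g y = g x)" using W by blast
qed

lemma locally_constant_sum:
  assumes "\<And>i. i \<in> I \<Longrightarrow> locally_constant T (f i)"
  shows "locally_constant T (\<lambda>x. \<Sum>i\<in>I. f i x)"
  using assms
proof (induction I rule: infinite_finite_induct)
  case (insert i I)
  then have "locally_constant T (\<lambda>x. f i x + (\<Sum>i\<in>I. f i x))"
    by (intro locally_constant_combine[where h = "(+)"]) auto
  then show ?case using insert.hyps by simp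
qed (simp_all add: locally_constant_const)

lemma locally_constant_open_fibre:
  assumes "locally_constant T f"
  shows "openin T {x \<in> topspace T. f x = y}"
proof (subst openin_subopen, safe)
  fix x assume x: "x \<in> topspace T"
  obtain W where "openin T W" "x \<in> W" "\<forall>y\<in>W. f y = f x"
    using locally_constantD[OF assms x] by blast
  then show "\<exists>W. openin T W \<and> x \<in> W \<and> W \<subseteq> {z \<in> topspace T. f z = f x}"
    using openin_subset by (intro exI[of _ W]) blast
qed

lemma continuous_map_discrete_imp_locally_constant:
  assumes "continuous_map T (discrete_topology X) f"
  shows "locally_constant T f"
  unfolding locally_constant_def
proof
  fix x assume x: "x \<in> topspace T"
  then have "f x \<in> X" using assms unfolding continuous_map_def by auto
  then have "openin T {z \<in> topspace T. f z \<in> {f x}}"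
    by (intro openin_continuous_map_preimage[OF assms]) simp
  then show "\<exists>W. openin T W \<and> x \<in> W \<and> (\<forall>y\<in>W. f y = f x)"
    using x by (intro exI[of _ "{z \<in> topspace T. f z \<in> {f x}}"]) auto
qed

lemma continuous_map_discrete_iff_locally_constant:
  "continuous_map T (discrete_topology X) f \<longleftrightarrow> f ` topspace T \<subseteq> X \<and> locally_constant T f"
proof safe
  assume f: "f ` topspace T \<subseteq> X" "locally_constant T f"
  have "openin T {x \<in> topspace T. f x \<in> U}" for U
  proof -
    have "{x \<in> topspace T. f x \<in> U} = (\<Union>u\<in>U. {x \<in> topspace T. f x = u})" by auto
    also have "openin T \<dots>" using locally_constant_open_fibre[OF f(2)] by blast
    finally show ?thesis .
  qed
  then show "continuous_map T (discrete_topology X) f"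
    using f(1) by (auto simp: continuous_map_def)
next
  fix x assume "continuous_map T (discrete_topology X) f" "x \<in> topspace T"
  then show "f x \<in> X" by (auto simp: continuous_map_def)
qed (rule continuous_map_discrete_imp_locally_constant)

lemma compact_finite_cover:
  assumes "compact_space T" "closedin T K" "\<And>k. k \<in> K \<Longrightarrow> openin T (W k)" "\<And>k. k \<in> K \<Longrightarrow> k \<in> W k"
  obtains C where "finite C" "C \<subseteq> K" "K \<subseteq> (\<Union>k\<in>C. W k)"
proof -
  have "compactin T K" using assms(1,2) by (rule closedin_compact_space)
  moreover have "\<forall>U\<in>W ` K. openin T U" "K \<subseteq> \<Union> (W ` K)" using assms(3,4) by auto
  ultimately obtain F where "finite F" "F \<subseteq> W ` K" "K \<subseteq> \<Union> F"
    unfolding compactin_def by meson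
  moreover from this obtain C where "C \<subseteq> K" "finite C" "F = W ` C"
    using finite_subset_image by metis
  ultimately show thesis using that by blast
qed

lemma topological_group_right_translation:
  assumes "topological_group G T" "g \<in> carrier G"
  shows "continuous_map T T (\<lambda>x. x \<otimes>\<^bsub>G\<^esub> g)"
proof -
  have "continuous_map T (prod_topology T T) (\<lambda>x. (x, g))"
    using assms by (auto simp: topological_group_def intro!: continuous_map_pairedI)
  from continuous_map_compose[OF this, of T "\<lambda>(x, y). x \<otimes>\<^bsub>G\<^esub> y"] assms
  show ?thesis by (simp add: topological_group_def comp_def)
qed

text \<open>
  The complement is a finite union of cosets, which are closed as translates of \<open>N\<close>.
\<close>

lemma closed_normal_fin_open:
  assumes "topological_group G T" "closed_normal_fin G T N"
  shows "openin T N"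
proof -
  have "group G" and top: "topspace T = carrier G"
    using assms(1) by (auto simp: topological_group_def)
  then interpret group G by simp
  have N: "subgroup N G" "closedin T N" "finite (rcosets\<^bsub>G\<^esub> N)"
    using assms(2) by (auto simp: closed_normal_fin_def closed_normal_def normal_imp_subgroup)
  have "closedin T C" if C: "C \<in> rcosets\<^bsub>G\<^esub> N" for C
  proof -
    obtain g where g: "g \<in> carrier G" "C = N #>\<^bsub>G\<^esub> g"
      using C by (auto simp: RCOSETS_def)
    have "C = {x \<in> topspace T. x \<otimes>\<^bsub>G\<^esub> inv\<^bsub>G\<^esub> g \<in> N}"
    proof safe
      fix x assume "x \<in> C"
      then obtain n where n: "n \<in> N" "x = n \<otimes>\<^bsub>G\<^esub> g" by (auto simp: g r_coset_def)
      then have "n \<in> carrier G" using N(1) subgroup.mem_carrier by metis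
      then show "x \<in> topspace T" "x \<otimes>\<^bsub>G\<^esub> inv\<^bsub>G\<^esub> g \<in> N" using n g by (auto simp: top m_assoc)
    next
      fix x assume x: "x \<in> topspace T" "x \<otimes>\<^bsub>G\<^esub> inv\<^bsub>G\<^esub> g \<in> N"
      then have "x = (x \<otimes>\<^bsub>G\<^esub> inv\<^bsub>G\<^esub> g) \<otimes>\<^bsub>G\<^esub> g" using g by (simp add: top m_assoc)
      then show "x \<in> C" using x(2) unfolding g r_coset_def by blast
    qed
    also have "closedin T \<dots>"
      using g by (intro closedin_continuous_map_preimage[OF topological_group_right_translation[OF assms(1)] N(2)]) simp
    finally show ?thesis .
  qed
  then have closed: "closedin T (\<Union> (rcosets\<^bsub>G\<^esub> N - {N}))"
    using N(3) by (intro closedin_Union) auto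
  have NR: "N \<in> rcosets\<^bsub>G\<^esub> N" by (rule subgroup.subgroup_in_rcosets[OF N(1) is_group])
  have "C \<inter> N = {}" if "C \<in> rcosets\<^bsub>G\<^esub> N - {N}" for C
    using pairwiseD[OF rcos_disjoint[OF N(1)], of C N] that NR by (simp add: disjnt_def)
  then have "\<Union> (rcosets\<^bsub>G\<^esub> N - {N}) \<inter> N = {}" by (simp add: Int_commute Int_UN_distrib2 inf_Sup)
  moreover have "\<Union> (rcosets\<^bsub>G\<^esub> N - {N}) \<union> N = topspace T"
  proof -
    have "insert N (rcosets\<^bsub>G\<^esub> N - {N}) = rcosets\<^bsub>G\<^esub> N" using NR by (simp add: insert_absorb)
    then have "\<Union> (insert N (rcosets\<^bsub>G\<^esub> N - {N})) = topspace T"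
      using rcosets_part_G[OF N(1)] top by simp
    then show ?thesis by (simp only: Union_insert Un_commute)
  qed
  moreover have "Y - R = N" if "R \<inter> N = {}" "R \<union> N = Y" for R Y
    using that by blast
  ultimately have "topspace T - \<Union> (rcosets\<^bsub>G\<^esub> N - {N}) = N" by simp
  then show ?thesis
    using openin_diff[OF openin_topspace closed] by simp
qed

section \<open>Continuous actions on rings\<close>

lemma (in group) normal_coset_factor:
  assumes "N \<lhd> G" "g \<in> carrier G" "h \<in> N #> g"
  shows "\<exists>n\<in>N. h = g \<otimes> n"
proof -
  interpret normal N G by fact
  have "h \<in> g <# N" using assms coset_eq by auto
  then show "\<exists>n\<in>N. h = g \<otimes> n" by (auto simp: l_coset_def)
qed

lemma acts_on_ringD:
  assumes "acts_on_ring G S act" "g \<in> carrier G"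
  shows "a \<in> S \<Longrightarrow> act g a \<in> S"
    and "h \<in> carrier G \<Longrightarrow> a \<in> S \<Longrightarrow> act (g \<otimes>\<^bsub>G\<^esub> h) a = act g (act h a)"
    and "act g 1 = 1"
    and "a \<in> S \<Longrightarrow> b \<in> S \<Longrightarrow> act g (a + b) = act g a + act g b"
    and "a \<in> S \<Longrightarrow> b \<in> S \<Longrightarrow> act g (a * b) = act g a * act g b"
    and "a \<in> S \<Longrightarrow> act \<one>\<^bsub>G\<^esub> a = a"
  using assms unfolding acts_on_ring_def by blast+

text \<open>
  The representative of \<open>Ng\<close> chosen by \<open>coset_act\<close> has the form \<open>g n\<close> with \<open>n \<in> N\<close>, since \<open>N\<close> is normal.
\<close>

lemma coset_act_eq:
  assumes "acts_on_ring G A act" "group G" "N \<lhd> G" "g \<in> carrier G" "a \<in> invariants A act N"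
  shows "coset_act act (N #>\<^bsub>G\<^esub> g) a = act g a"
proof -
  interpret group G by fact
  interpret normal N G by fact
  have "g \<in> N #>\<^bsub>G\<^esub> g" using assms(4) by (rule rcos_self) (rule subgroup_axioms)
  then have "(SOME h. h \<in> N #>\<^bsub>G\<^esub> g) \<in> N #>\<^bsub>G\<^esub> g" by (rule someI)
  from normal_coset_factor[OF assms(3,4) this]
  obtain n where n: "n \<in> N" "(SOME h. h \<in> N #>\<^bsub>G\<^esub> g) = g \<otimes>\<^bsub>G\<^esub> n" by blast
  then show ?thesis
    using acts_on_ringD(2)[OF assms(1,4), of n a] mem_carrier assms(5)
    by (simp add: coset_act_def invariants_def)
qed

lemma act_in_invariants:
  assumes "acts_on_ring G A act" "group G" "N \<lhd> G" "g \<in> carrier G" "a \<in> invariants A act N"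
  shows "act g a \<in> invariants A act N"
proof -
  interpret group G by fact
  interpret normal N G by fact
  have mult: "act (g \<otimes>\<^bsub>G\<^esub> h) a = act g (act h a)" if "g \<in> carrier G" "h \<in> carrier G" for g h
    using acts_on_ringD(2)[OF assms(1) that] assms(5) by (simp add: invariants_def)
  have "act n (act g a) = act g a" if n: "n \<in> N" for n
  proof -
    have "inv\<^bsub>G\<^esub> g \<otimes>\<^bsub>G\<^esub> n \<otimes>\<^bsub>G\<^esub> g \<in> N" using n assms(4) inv_op_closed1 by blast
    moreover have "n \<otimes>\<^bsub>G\<^esub> g = g \<otimes>\<^bsub>G\<^esub> (inv\<^bsub>G\<^esub> g \<otimes>\<^bsub>G\<^esub> n \<otimes>\<^bsub>G\<^esub> g)"
      using n assms(4) by (simp add: m_assoc[symmetric])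
    ultimately show ?thesis
      using mult[of n g] mult[of g "inv\<^bsub>G\<^esub> g \<otimes>\<^bsub>G\<^esub> n \<otimes>\<^bsub>G\<^esub> g"] n mem_carrier assms(4,5)
      by (simp add: invariants_def)
  qed
  moreover have "act g a \<in> A"
    using acts_on_ringD(1)[OF assms(1,4)] assms(5) by (simp add: invariants_def)
  ultimately show ?thesis by (simp add: invariants_def)
qed

lemma acts_on_ring_coset_act:
  assumes acts: "acts_on_ring G A act" and "unital_subring A" "group G" "N \<lhd> G"
  shows "acts_on_ring (G Mod N) (invariants A act N) (coset_act act)"
proof -
  interpret group G by fact
  interpret normal N G by fact
  let ?S = "invariants A act N"
  note eq = coset_act_eq[OF acts assms(3,4)]
  have S: "unital_subring ?S" by (rule unital_subring_invariants[OF acts assms(2) subset])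
  have A: "a \<in> A" if "a \<in> ?S" for a using that by (simp add: invariants_def)
  have coset: "\<exists>g\<in>carrier G. C = N #>\<^bsub>G\<^esub> g" if "C \<in> carrier (G Mod N)" for C
    using that by (auto simp: FactGroup_def RCOSETS_def)
  show ?thesis
    unfolding acts_on_ring_def
  proof (intro conjI ballI)
    fix C a assume "C \<in> carrier (G Mod N)" "a \<in> ?S"
    then show "coset_act act C a \<in> ?S"
      using coset eq act_in_invariants[OF acts assms(3,4)] by metis
  next
    fix a assume a: "a \<in> ?S"
    have one_G: "\<one>\<^bsub>G\<^esub> \<in> carrier G" by simp
    have "N = N #>\<^bsub>G\<^esub> \<one>\<^bsub>G\<^esub>" using subset by (simp add: coset_mult_one)
    then show "coset_act act \<one>\<^bsub>G Mod N\<^esub> a = a"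
      using eq[OF one_G a] acts_on_ringD(6)[OF acts one_G A[OF a]] by (simp add: FactGroup_def)
  next
    fix C D a assume CD: "C \<in> carrier (G Mod N)" "D \<in> carrier (G Mod N)" and a: "a \<in> ?S"
    obtain g h where gh: "g \<in> carrier G" "C = N #>\<^bsub>G\<^esub> g" "h \<in> carrier G" "D = N #>\<^bsub>G\<^esub> h"
      using coset CD by metis
    have "C \<otimes>\<^bsub>G Mod N\<^esub> D = N #>\<^bsub>G\<^esub> (g \<otimes>\<^bsub>G\<^esub> h)"
      using gh rcos_sum by (simp add: FactGroup_def)
    then show "coset_act act (C \<otimes>\<^bsub>G Mod N\<^esub> D) a = coset_act act C (coset_act act D a)"
      using gh eq a act_in_invariants[OF acts assms(3,4)] acts_on_ringD(2)[OF acts gh(1,3) A[OF a]] by simp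
  next
    fix C assume "C \<in> carrier (G Mod N)"
    then obtain g where g: "g \<in> carrier G" "C = N #>\<^bsub>G\<^esub> g" using coset by blast
    show "coset_act act C 1 = 1"
      using eq[OF g(1), of 1] S g acts_on_ringD(3)[OF acts g(1)] by (simp add: unital_subring_def)
    fix a b assume ab: "a \<in> ?S" "b \<in> ?S"
    then have "a + b \<in> ?S" "a * b \<in> ?S" using S by (simp_all add: unital_subring_def)
    then show "coset_act act C (a + b) = coset_act act C a + coset_act act C b"
      "coset_act act C (a * b) = coset_act act C a * coset_act act C b"
      using eq[OF g(1)] ab g acts_on_ringD(4,5)[OF acts g(1) A[OF ab(1)] A[OF ab(2)]] by simp_all
  qed
qed

lemma invariants_coset_act:
  assumes acts: "acts_on_ring G A act" and "group G" "N \<lhd> G"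
  shows "invariants (invariants A act N) (coset_act act) (carrier (G Mod N)) = invariants A act (carrier G)"
proof -
  interpret group G by fact
  interpret normal N G by fact
  have carr: "carrier (G Mod N) = (\<lambda>g. N #>\<^bsub>G\<^esub> g) ` carrier G"
    by (auto simp: FactGroup_def RCOSETS_def)
  have "a \<in> invariants A act N" if "a \<in> invariants A act (carrier G)" for a
    using that mem_carrier by (auto simp: invariants_def)
  moreover have "(\<forall>C\<in>carrier (G Mod N). coset_act act C a = a) \<longleftrightarrow> (\<forall>g\<in>carrier G. act g a = a)"
    if "a \<in> invariants A act N" for a
    using coset_act_eq[OF assms _ that] by (simp add: carr)
  moreover have "invariants A act N \<subseteq> A" by (auto simp: invariants_def)
  ultimately show ?thesis
    unfolding invariants_def[of "invariants A act N"] invariants_def[of A act "carrier G"]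
    by (auto simp: invariants_def[of A act "carrier G"])
qed

locale continuous_action = group G for G (structure) +
  fixes T :: "'g topology" and A :: "'a::comm_ring_1 set" and act :: "'g \<Rightarrow> 'a \<Rightarrow> 'a"
  assumes top_group: "topological_group G T" and compact: "compact_space T"
    and scheme: "continuous_affine_G_scheme G T A act"
begin

lemma topspace_T: "topspace T = carrier G"
  using top_group by (simp add: topological_group_def)

lemma A_subring: "unital_subring A" and acts: "acts_on_ring G A act"
  using scheme by (auto simp: continuous_affine_G_scheme_def)

lemma A_closed: "0 \<in> A" "1 \<in> A" "a \<in> A \<Longrightarrow> b \<in> A \<Longrightarrow> a + b \<in> A"
    "a \<in> A \<Longrightarrow> b \<in> A \<Longrightarrow> a - b \<in> A" "a \<in> A \<Longrightarrow> b \<in> A \<Longrightarrow> a * b \<in> A"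
  using A_subring unfolding unital_subring_def by auto

lemma act_in: "g \<in> carrier G \<Longrightarrow> a \<in> A \<Longrightarrow> act g a \<in> A"
  and act_one: "a \<in> A \<Longrightarrow> act \<one> a = a"
  and act_act: "g \<in> carrier G \<Longrightarrow> h \<in> carrier G \<Longrightarrow> a \<in> A \<Longrightarrow> act (g \<otimes> h) a = act g (act h a)"
  and act_add: "g \<in> carrier G \<Longrightarrow> a \<in> A \<Longrightarrow> b \<in> A \<Longrightarrow> act g (a + b) = act g a + act g b"
  and act_mult: "g \<in> carrier G \<Longrightarrow> a \<in> A \<Longrightarrow> b \<in> A \<Longrightarrow> act g (a * b) = act g a * act g b"
  and act_1: "g \<in> carrier G \<Longrightarrow> act g 1 = 1"
  using acts unfolding acts_on_ring_def by blast+

lemma orbit_map_continuous: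
  assumes "a \<in> A"
  shows "continuous_map T (discrete_topology A) (\<lambda>g. act g a)"
proof -
  have "continuous_map T (prod_topology T (discrete_topology A)) (\<lambda>g. (g, a))"
    using assms by (auto intro!: continuous_map_pairedI)
  from continuous_map_compose[OF this, of "discrete_topology A" "\<lambda>(g, a). act g a"] scheme
  show ?thesis by (simp add: continuous_affine_G_scheme_def comp_def)
qed

lemma orbit_finite:
  assumes "a \<in> A"
  shows "finite ((\<lambda>g. act g a) ` carrier G)"
proof -
  have "compactin (discrete_topology A) ((\<lambda>g. act g a) ` topspace T)"
    using image_compactin[OF compact[unfolded compact_space_def] orbit_map_continuous[OF assms]] .
  then show ?thesis by (simp add: compactin_discrete_topology topspace_T)
qed

text \<open>
  The orbit of each point of \<open>P\<close> is finite, being compact and discrete.  The pointwise stabilizer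
  of the union of these orbits is a finite intersection of open subgroups, and it is normal because
  \<open>G\<close> permutes the union.
\<close>

lemma open_normal_stabilizer:
  assumes "finite P" "P \<subseteq> A"
  obtains U where "U \<lhd> G" "openin T U" "P \<subseteq> invariants A act U"
proof -
  define M where "M = (\<Union>p\<in>P. (\<lambda>g. act g p) ` carrier G)"
  define U where "U = {g \<in> carrier G. \<forall>p\<in>M. act g p = p}"
  have M: "finite M" "M \<subseteq> A" "P \<subseteq> M"
    using assms orbit_finite act_in act_one
    by (auto simp: M_def subset_iff intro!: bexI[of _ "\<one>"] simp: image_iff) (metis one_closed)
  have GM: "act g p \<in> M" if g: "g \<in> carrier G" and p: "p \<in> M" for g p
  proof -
    obtain a h where ah: "a \<in> P" "h \<in> carrier G" "p = act h a" using p by (auto simp: M_def)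
    then have "act g p = act (g \<otimes> h) a"
      using g assms(2) by (simp add: act_act subset_iff)
    then show ?thesis using g ah(1,2) unfolding M_def by blast
  qed
  have "openin T {g \<in> topspace T. \<forall>p\<in>M. act g p = p}"
    using M(1,2)
  proof (induction M rule: finite_induct)
    case (insert p M)
    have "{g \<in> topspace T. \<forall>p\<in>insert p M. act g p = p} =
        {g \<in> topspace T. act g p = p} \<inter> {g \<in> topspace T. \<forall>p\<in>M. act g p = p}" by auto
    moreover have "openin T {g \<in> topspace T. act g p = p}"
      using insert.prems
      by (intro locally_constant_open_fibre continuous_map_discrete_imp_locally_constant[OF orbit_map_continuous]) auto
    ultimately show ?case using insert by auto
  qed simp
  then have "openin T U" by (simp add: U_def topspace_T)
  have inv: "act (inv g) p = p" if "g \<in> U" "p \<in> M" for g p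
  proof -
    have "act (inv g \<otimes> g) p = act (inv g) (act g p)" using that M(2) by (intro act_act) (auto simp: U_def)
    then show ?thesis using that M(2) by (auto simp: U_def act_one)
  qed
  have "subgroup U G"
  proof (rule subgroupI)
    show "U \<noteq> {}" using act_one M(2) by (auto simp: U_def)
    show "inv g \<in> U" if "g \<in> U" for g using that inv by (auto simp: U_def)
    show "g \<otimes> h \<in> U" if "g \<in> U" "h \<in> U" for g h
      using that M(2) by (auto simp: U_def act_act subset_iff)
  qed (auto simp: U_def)
  moreover have "x \<otimes> h \<otimes> inv x \<in> U" if x: "x \<in> carrier G" and h: "h \<in> U" for x h
  proof -
    have "act (x \<otimes> h \<otimes> inv x) p = p" if p: "p \<in> M" for p
    proof -
      have hc: "h \<in> carrier G" and "act h (act (inv x) p) = act (inv x) p"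
        using h GM[OF inv_closed[OF x] p] by (auto simp: U_def)
      moreover have "p \<in> A" using p M(2) by auto
      ultimately show ?thesis
        using x by (simp add: act_act act_in) (simp add: act_act[symmetric] act_one)
    qed
    then show ?thesis using x h by (auto simp: U_def)
  qed
  ultimately have "U \<lhd> G" by (simp add: normal_inv_iff)
  then show thesis
    using that[OF _ \<open>openin T U\<close>] M assms(2) by (auto simp: U_def invariants_def subset_iff)
qed

text \<open>
  The functions on \<open>G\<close> that come from \<open>A \<otimes> A\<close> through the torsor map.  Such a
  function with values \<open>1\<close> at \<open>1\<close> and \<open>0\<close> at \<open>g\<close> exhibits \<open>1 = \<Sum>\<^sub>j x\<^sub>j (y\<^sub>j - g(y\<^sub>j))\<close>, which means that \<open>g\<close> has
  no fixed point on \<open>Spec A\<close>.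
\<close>

definition coefficient_function :: "('g \<Rightarrow> 'a) \<Rightarrow> bool" where
  "coefficient_function \<phi> \<longleftrightarrow>
     (\<exists>ps. set ps \<subseteq> A \<times> A \<and> (\<forall>h\<in>carrier G. \<phi> h = (\<Sum>(a, b)\<leftarrow>ps. a * act h b)))"

lemma coefficient_function_basic:
  "a \<in> A \<Longrightarrow> b \<in> A \<Longrightarrow> coefficient_function (\<lambda>h. a * act h b)"
  unfolding coefficient_function_def by (intro exI[of _ "[(a, b)]"]) auto

lemma coefficient_function_cong:
  "coefficient_function \<phi> \<Longrightarrow> (\<And>h. h \<in> carrier G \<Longrightarrow> \<psi> h = \<phi> h) \<Longrightarrow> coefficient_function \<psi>"
  unfolding coefficient_function_def by simp

lemma coefficient_function_const: "a \<in> A \<Longrightarrow> coefficient_function (\<lambda>_. a)"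
  using coefficient_function_basic[OF _ A_closed(2), of a]
  by (rule coefficient_function_cong) (auto simp: act_1)

lemma coefficient_function_add:
  assumes "coefficient_function \<phi>" "coefficient_function \<psi>"
  shows "coefficient_function (\<lambda>h. \<phi> h + \<psi> h)"
proof -
  obtain ps qs where "set ps \<subseteq> A \<times> A" "\<forall>h\<in>carrier G. \<phi> h = (\<Sum>(a, b)\<leftarrow>ps. a * act h b)"
      "set qs \<subseteq> A \<times> A" "\<forall>h\<in>carrier G. \<psi> h = (\<Sum>(a, b)\<leftarrow>qs. a * act h b)"
    using assms unfolding coefficient_function_def by blast
  then show ?thesis
    unfolding coefficient_function_def by (intro exI[of _ "ps @ qs"]) auto
qed

lemma coefficient_function_induct [consumes 1, case_names basic add cong]:
  assumes "coefficient_function \<phi>"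
    and "\<And>a b. a \<in> A \<Longrightarrow> b \<in> A \<Longrightarrow> P (\<lambda>h. a * act h b)"
    and "\<And>\<phi> \<psi>. P \<phi> \<Longrightarrow> P \<psi> \<Longrightarrow> P (\<lambda>h. \<phi> h + \<psi> h)"
    and "\<And>\<phi> \<psi>. P \<phi> \<Longrightarrow> (\<And>h. h \<in> carrier G \<Longrightarrow> \<psi> h = \<phi> h) \<Longrightarrow> P \<psi>"
  shows "P \<phi>"
proof -
  obtain ps where ps: "set ps \<subseteq> A \<times> A" and \<phi>: "\<forall>h\<in>carrier G. \<phi> h = (\<Sum>(a, b)\<leftarrow>ps. a * act h b)"
    using assms(1) unfolding coefficient_function_def by blast
  from ps have "P (\<lambda>h. \<Sum>(a, b)\<leftarrow>ps. a * act h b)"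
  proof (induction ps)
    case Nil
    show ?case using assms(4)[OF assms(2)[OF A_closed(1,1)], of "\<lambda>_. 0"] by simp
  next
    case (Cons p ps)
    then obtain a b where p: "p = (a, b)" "a \<in> A" "b \<in> A" by auto
    show ?case using assms(3)[OF assms(2)[OF p(2,3)] Cons.IH] Cons.prems p by simp
  qed
  then show ?thesis by (rule assms(4)) (use \<phi> in auto)
qed

lemma coefficient_function_mult:
  assumes "coefficient_function \<phi>" "coefficient_function \<psi>"
  shows "coefficient_function (\<lambda>h. \<phi> h * \<psi> h)"
  using assms(1)
proof (induction rule: coefficient_function_induct)
  case (basic a b)
  show ?case using assms(2)
  proof (induction rule: coefficient_function_induct)
    case (basic c d)
    have "coefficient_function (\<lambda>h. (a * c) * act h (b * d))"
      using basic \<open>a \<in> A\<close> \<open>b \<in> A\<close> by (intro coefficient_function_basic A_closed)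
    then show ?case
      by (rule coefficient_function_cong) (simp add: act_mult basic \<open>b \<in> A\<close> mult_ac)
  next
    case (add \<phi> \<psi>)
    then show ?case by (simp add: distrib_left coefficient_function_add)
  next
    case (cong \<phi> \<psi>)
    from cong(1) show ?case by (rule coefficient_function_cong) (simp add: cong(2))
  qed
next
  case (add \<phi> \<psi>)
  then show ?case by (simp add: distrib_right coefficient_function_add)
next
  case (cong \<phi> \<psi>')
  from cong(1) show ?case by (rule coefficient_function_cong) (simp add: cong(2))
qed

lemma coefficient_function_one_minus:
  assumes "coefficient_function \<phi>"
  shows "coefficient_function (\<lambda>h. 1 - \<phi> h)"
proof -
  have "-1 \<in> A" using unital_subring_uminus[OF A_subring] A_closed(2) by simp
  then have "coefficient_function (\<lambda>h. 1 + (- 1) * \<phi> h)"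
    using assms A_closed(2)
    by (intro coefficient_function_add coefficient_function_mult coefficient_function_const)
  then show ?thesis by simp
qed

lemma coefficient_function_prod:
  assumes "finite I" "\<And>i. i \<in> I \<Longrightarrow> coefficient_function (\<phi> i)"
  shows "coefficient_function (\<lambda>h. \<Prod>i\<in>I. \<phi> i h)"
  using assms
  by (induction I rule: finite_induct) (auto simp: coefficient_function_const A_closed coefficient_function_mult)

lemma coefficient_function_translate:
  assumes "coefficient_function \<phi>" "g \<in> carrier G"
  shows "coefficient_function (\<lambda>h. \<phi> (h \<otimes> g))"
  using assms(1)
proof (induction rule: coefficient_function_induct)
  case (basic a b)
  have "coefficient_function (\<lambda>h. a * act h (act g b))"
    using basic assms(2) by (intro coefficient_function_basic act_in)
  then show ?case
    by (rule coefficient_function_cong) (simp add: act_act assms(2) basic)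
next
  case (cong \<phi> \<psi>)
  from cong(1) show ?case by (rule coefficient_function_cong) (simp add: cong(2) assms(2))
qed (rule coefficient_function_add)

lemma coefficient_function_locally_constant:
  "coefficient_function \<phi> \<Longrightarrow> locally_constant T \<phi>"
proof (induction rule: coefficient_function_induct)
  case (basic a b)
  show ?case
    using locally_constant_combine[OF locally_constant_const[of T a]
        continuous_map_discrete_imp_locally_constant[OF orbit_map_continuous[OF basic(2)]], of "(*)"] .
next
  case (add \<phi> \<psi>)
  then show ?case by (rule locally_constant_combine)
next
  case (cong \<phi> \<psi>)
  show ?case by (rule locally_constant_cong[OF cong(1)]) (simp add: cong(2) topspace_T)
qed

text \<open>
  A product of finitely many separating functions is a \<open>p\<close> that vanishes off \<open>N\<close> and has the value
  \<open>1\<close> at \<open>1\<close>, hence near \<open>1\<close>.  Finitely many right translates of \<open>p\<close> by elements of \<open>N\<close> still vanish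
  off \<open>N\<close>, and at each point of \<open>N\<close> one of them is \<open>1\<close>.
\<close>

lemma coefficient_function_indicator:
  assumes N: "subgroup N G" "openin T N" "closedin T N"
    and sep: "\<And>g. g \<in> carrier G - N \<Longrightarrow> \<exists>\<phi>. coefficient_function \<phi> \<and> \<phi> \<one> = 1 \<and> \<phi> g = 0"
  shows "\<exists>e. coefficient_function e \<and> (\<forall>h\<in>carrier G. e h = (if h \<in> N then 1 else 0))"
proof -
  interpret N: subgroup N G by fact
  obtain \<phi> where \<phi>: "\<And>g. g \<in> carrier G - N \<Longrightarrow> coefficient_function (\<phi> g)"
      "\<And>g. g \<in> carrier G - N \<Longrightarrow> \<phi> g \<one> = 1" "\<And>g. g \<in> carrier G - N \<Longrightarrow> \<phi> g g = 0"
    using sep by metis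
  have closed: "closedin T (carrier G - N)"
    using closedin_diff[OF closedin_topspace N(2)] by (simp add: topspace_T)
  have "openin T {h \<in> topspace T. \<phi> g h = 0}" "g \<in> {h \<in> topspace T. \<phi> g h = 0}"
    if g: "g \<in> carrier G - N" for g
    using locally_constant_open_fibre[OF coefficient_function_locally_constant[OF \<phi>(1)[OF g]]] \<phi>(3)[OF g] g
    by (simp_all add: topspace_T)
  from compact_finite_cover[OF compact closed this]
  obtain C where C: "finite C" "C \<subseteq> carrier G - N"
      "carrier G - N \<subseteq> (\<Union>g\<in>C. {h \<in> topspace T. \<phi> g h = 0})" by blast
  define p where "p h = (\<Prod>g\<in>C. \<phi> g h)" for h
  have p: "coefficient_function p"
    unfolding p_def using C \<phi>(1) by (intro coefficient_function_prod) auto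
  have p1: "p \<one> = 1" unfolding p_def using C(2) \<phi>(2) by (intro prod.neutral) auto
  have p0: "p h = 0" if "h \<in> carrier G - N" for h
    unfolding p_def using that C by (intro prod_zero) auto
  have "openin T {h \<in> topspace T. p (h \<otimes> inv n) = 1}" "n \<in> {h \<in> topspace T. p (h \<otimes> inv n) = 1}"
    if n: "n \<in> N" for n
    using locally_constant_open_fibre[OF coefficient_function_locally_constant[OF
        coefficient_function_translate[OF p, of "inv n"]]] p1 n
    by (simp_all add: topspace_T)
  from compact_finite_cover[OF compact N(3) this]
  obtain C' where C': "finite C'" "C' \<subseteq> N" "N \<subseteq> (\<Union>n\<in>C'. {h \<in> topspace T. p (h \<otimes> inv n) = 1})"
    by blast
  define e where "e h = 1 - (\<Prod>n\<in>C'. 1 - p (h \<otimes> inv n))" for h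
  have "coefficient_function (\<lambda>h. 1 - p (h \<otimes> inv n))" if "n \<in> C'" for n
  proof -
    have "inv n \<in> carrier G" using subsetD[OF C'(2) that] by simp
    from coefficient_function_one_minus[OF coefficient_function_translate[OF p this]] show ?thesis .
  qed
  from coefficient_function_one_minus[OF coefficient_function_prod[OF C'(1) this]]
  have "coefficient_function e" by (simp only: e_def[abs_def])
  moreover have "e h = 1" if h: "h \<in> N" for h
  proof -
    obtain n where "n \<in> C'" "p (h \<otimes> inv n) = 1" using subsetD[OF C'(3) h] by auto
    then have "(\<Prod>n\<in>C'. 1 - p (h \<otimes> inv n)) = 0" using C'(1) by (intro prod_zero) auto
    then show ?thesis by (simp add: e_def)
  qed
  moreover have "e h = 0" if h: "h \<in> carrier G - N" for h
  proof -
    have notin: "h \<otimes> inv n \<in> carrier G - N" if n: "n \<in> N" for n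
    proof -
      have "(h \<otimes> inv n) \<otimes> n = h" using h n by (simp add: m_assoc)
      then have "h \<otimes> inv n \<notin> N" using h n N.m_closed[of "h \<otimes> inv n" n] by auto
      then show ?thesis using h n by auto
    qed
    have "p (h \<otimes> inv n) = 0" if n: "n \<in> C'" for n by (rule p0[OF notin[OF subsetD[OF C'(2) n]]])
    then show ?thesis by (simp add: e_def)
  qed
  ultimately show ?thesis by (intro exI[of _ e]) (simp add: N.subset)
qed

text \<open>
  Data for averaging \<open>U\<close>-invariant elements over \<open>N\<close>: \<open>Q\<close> is the image of \<open>N\<close> in \<open>G/U\<close>, \<open>r\<close> picks
  representatives in \<open>N\<close>, and \<open>d\<close> is the inverse of \<open>|Q|\<close>, which exists because \<open>|Q|\<close> divides the
  invertible index of \<open>U\<close>.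
\<close>

lemma average_over_subgroup:
  assumes U: "U \<lhd> G" "finite (rcosets U)" and N: "subgroup N G"
    and c: "c \<in> A" "of_nat (card (rcosets U)) * c = 1"
  shows "\<exists>r (Q :: 'g set set) d. finite Q \<and> (\<forall>C\<in>Q. r C \<in> N) \<and>
    d \<in> A \<and> of_nat (card Q) * d = 1 \<and> (\<forall>g\<in>carrier G. act g d = d) \<and>
    (\<forall>a\<in>invariants A act U. \<forall>n\<in>N. act n (\<Sum>C\<in>Q. act (r C) a) = (\<Sum>C\<in>Q. act (r C) a))"
proof -
  interpret normal U G by fact
  interpret H: group "G Mod U" by (rule factorgroup_is_group)
  note HA = acts_on_ring_coset_act[OF acts A_subring is_group U(1)]
  note SU = unital_subring_invariants[OF acts A_subring subset]
  define Q where "Q = (\<lambda>n. U #> n) ` N"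
  have "group_hom G (G Mod U) (\<lambda>n. U #> n)"
    using r_coset_hom_Mod by (simp add: group_hom_def group_hom_axioms_def H.is_group)
  from group_hom.subgroup_img_is_subgroup[OF this N] have Q: "subgroup Q (G Mod U)"
    by (simp only: Q_def)
  have carr: "carrier (G Mod U) = rcosets U" by (simp add: FactGroup_def)
  have finQ: "finite Q" using subgroup.subset[OF Q] U(2) unfolding carr by (rule finite_subset)
  have idx: "card (rcosets\<^bsub>G Mod U\<^esub> Q) * card Q = card (rcosets U)"
    using H.lagrange[OF Q] by (simp add: Coset.order_def carr)
  have "of_nat (card Q) * (of_nat (card (rcosets\<^bsub>G Mod U\<^esub> Q)) * c) =
      of_nat (card (rcosets\<^bsub>G Mod U\<^esub> Q) * card Q) * c"
    by (simp add: mult_ac)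
  also have "\<dots> = 1" unfolding idx by (rule c(2))
  finally have inv: "of_nat (card Q) * (of_nat (card (rcosets\<^bsub>G Mod U\<^esub> Q)) * c) = 1" .
  have nat_in: "of_nat k \<in> A" for k by (induction k) (auto intro: A_closed)
  define d where "d = of_nat (card (rcosets\<^bsub>G Mod U\<^esub> Q)) * c"
  have d: "d \<in> A" "of_nat (card Q) * d = 1"
    using inv c(1) nat_in by (auto simp: d_def intro: A_closed)
  have act_nat: "act g (of_nat k) = of_nat k" if "g \<in> carrier G" for g k
    using that by (induction k) (auto simp: act_add act_1 nat_in A_closed acts_on_ring_zero[OF acts A_subring])
  have act_d: "act g d = d" if g: "g \<in> carrier G" for g
  proof -
    have "of_nat (card Q) * act g d = 1"
      using g d act_mult[OF g nat_in d(1), of "card Q"] by (simp add: act_nat act_1)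
    then have "d = d * (of_nat (card Q) * act g d)" by simp
    also have "\<dots> = (of_nat (card Q) * d) * act g d" by (simp only: mult_ac)
    also have "\<dots> = act g d" by (simp only: d(2) mult_1)
    finally show ?thesis by (rule sym)
  qed
  have "\<forall>C\<in>Q. \<exists>n. n \<in> N \<and> C = U #> n" unfolding Q_def by blast
  from bchoice[OF this] obtain r where r: "\<forall>C\<in>Q. r C \<in> N \<and> C = U #> r C" by (elim exE)
  have r_act: "coset_act act C a = act (r C) a" if C: "C \<in> Q" and a: "a \<in> invariants A act U" for C a
  proof -
    have rC: "r C \<in> N" "C = U #> r C" using bspec[OF r C] by (rule conjunct1, rule conjunct2)
    have "coset_act act (U #> r C) a = act (r C) a"
      by (rule coset_act_eq[OF acts is_group U(1) subgroup.mem_carrier[OF N rC(1)] a])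
    then show ?thesis by (simp only: rC(2)[symmetric])
  qed
  have inv: "act n (\<Sum>C\<in>Q. act (r C) a) = (\<Sum>C\<in>Q. act (r C) a)" if a: "a \<in> invariants A act U" and n: "n \<in> N" for a n
  proof -
    have eq: "(\<Sum>C\<in>Q. act (r C) a) = (\<Sum>C\<in>Q. coset_act act C a)" by (intro sum.cong refl r_act[symmetric] a)
    have nQ: "U #> n \<in> Q" and nG: "n \<in> carrier G" using n subgroup.mem_carrier[OF N] by (auto simp: Q_def)
    have "(\<Sum>C\<in>Q. coset_act act C a) \<in> invariants A act U"
      using acts_on_ringD(1)[OF HA _ a] subgroup.mem_carrier[OF Q] by (intro unital_subring_sum[OF SU]) blast
    then have "act n (\<Sum>C\<in>Q. coset_act act C a) = coset_act act (U #> n) (\<Sum>C\<in>Q. coset_act act C a)"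
      using coset_act_eq[OF acts is_group U(1) nG] by simp
    also have "\<dots> = (\<Sum>C\<in>Q. coset_act act C a)"
      by (rule acts_on_ring_orbit_sum[OF HA SU H.is_group Q a nQ])
    finally show ?thesis unfolding eq .
  qed
  show ?thesis
    by (intro exI[of _ r] exI[of _ Q] exI[of _ d] conjI ballI finQ d act_d inv) (use r in blast)
qed

theorem galois_cover_of_separating:
  assumes N: "closed_normal_fin G T N"
    and index: "\<And>U. U \<lhd> G \<Longrightarrow> openin T U \<Longrightarrow> \<exists>n. card (rcosets U) = l ^ n"
    and c: "c \<in> A" "of_nat l * c = 1"
    and sep: "\<And>g. g \<in> carrier G - N \<Longrightarrow> \<exists>\<phi>. coefficient_function \<phi> \<and> \<phi> \<one> = 1 \<and> \<phi> g = 0"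
  shows "galois_cover (invariants A act (carrier G)) (invariants A act N) (G Mod N) (coset_act act)"
proof -
  have Nn: "N \<lhd> G" and Nc: "closedin T N" and Nf: "finite (rcosets N)"
    using N by (auto simp: closed_normal_fin_def closed_normal_def)
  interpret N: normal N G by fact
  let ?S = "invariants A act N"
  have No: "openin T N" using top_group N by (rule closed_normal_fin_open)
  obtain e where e: "coefficient_function e" "\<forall>h\<in>carrier G. e h = (if h \<in> N then 1 else 0)"
    using coefficient_function_indicator[OF N.subgroup_axioms No Nc sep] by blast
  then obtain ps where ps: "set ps \<subseteq> A \<times> A"
      "\<And>h. h \<in> carrier G \<Longrightarrow> (\<Sum>(a, b)\<leftarrow>ps. a * act h b) = (if h \<in> N then 1 else 0)"
    unfolding coefficient_function_def by auto
  define n x y where "n = length ps" and "x = (\<lambda>j. fst (ps ! j))" and "y = (\<lambda>j. snd (ps ! j))"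
  have xy: "x j \<in> A" "y j \<in> A" if "j < n" for j
  proof -
    have "ps ! j \<in> A \<times> A" using that by (intro subsetD[OF ps(1)] nth_mem) (simp add: n_def)
    then show "x j \<in> A" "y j \<in> A" by (simp_all add: x_def y_def mem_Times_iff)
  qed
  have delta: "(\<Sum>j<n. x j * act h (y j)) = (if h \<in> N then 1 else 0)" if "h \<in> carrier G" for h
    using ps(2)[OF that]
    by (simp add: sum_list_sum_nth n_def x_def y_def case_prod_unfold atLeast0LessThan)
  obtain U where U: "U \<lhd> G" "openin T U" "x ` {..<n} \<union> y ` {..<n} \<subseteq> invariants A act U"
  proof (rule open_normal_stabilizer)
    show "finite (x ` {..<n} \<union> y ` {..<n})" by simp
    show "x ` {..<n} \<union> y ` {..<n} \<subseteq> A" using xy by auto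
  qed
  obtain k where k: "card (rcosets U) = l ^ k" using index U by blast
  have cU: "c ^ k \<in> A" "of_nat (card (rcosets U)) * c ^ k = 1"
  proof -
    show "c ^ k \<in> A" for k by (induction k) (auto intro: A_closed c(1))
    have "of_nat (l ^ k) * c ^ k = (of_nat l * c) ^ k" by (simp add: power_mult_distrib)
    then show "of_nat (card (rcosets U)) * c ^ k = 1" by (simp only: k c(2) power_one)
  qed
  have "l \<noteq> 0" using c by (metis mult_zero_left of_nat_0 zero_neq_one)
  then have finU: "finite (rcosets U)" using k by (intro card_ge_0_finite) simp
  obtain r and Q :: "'g set set" and d where "finite Q" and Q: "\<forall>C\<in>Q. r C \<in> N"
      "d \<in> A" "of_nat (card Q) * d = 1" "\<forall>g\<in>carrier G. act g d = d"
      "\<forall>a\<in>invariants A act U. \<forall>n\<in>N. act n (\<Sum>C\<in>Q. act (r C) a) = (\<Sum>C\<in>Q. act (r C) a)"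
    using average_over_subgroup[OF U(1) finU N.subgroup_axioms cU] by (elim exE conjE)
  note Q = Q[rule_format]
  have rG: "r C \<in> carrier G" if "C \<in> Q" for C using Q(1)[OF that] by simp
  \<comment> \<open>averaging both coordinates averages the indicator \<open>h \<mapsto> [h \<in> N]\<close> over \<open>N\<close> from both sides, which does not change it\<close>
  define avg where "avg a = d * (\<Sum>C\<in>Q. act (r C) a)" for a
  have avg: "avg a \<in> ?S" if a: "a \<in> invariants A act U" for a
  proof -
    have aA: "a \<in> A" using a by (simp add: invariants_def)
    have sA: "(\<Sum>C\<in>Q. act (r C) a) \<in> A"
      using aA rG by (intro unital_subring_sum[OF A_subring] act_in)
    then have "act m (avg a) = avg a" if "m \<in> N" for m
      using that a Q(2,4,5) by (simp add: avg_def act_mult)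
    then show ?thesis using sA Q(2) by (auto simp: invariants_def avg_def intro: A_closed)
  qed
  have xU: "x j \<in> invariants A act U" and yU: "y j \<in> invariants A act U" if "j < n" for j
    using U(3) that by auto
  have avg_delta: "(\<Sum>j<n. avg (x j) * act h (avg (y j))) = (if h \<in> N then 1 else 0)" if h: "h \<in> carrier G" for h
  proof -
    have act_avg: "act h (avg (y j)) = d * (\<Sum>D\<in>Q. act (h \<otimes> r D) (y j))" if j: "j < n" for j
    proof -
      have "act h (\<Sum>D\<in>Q. act (r D) (y j)) = (\<Sum>D\<in>Q. act (h \<otimes> r D) (y j))"
        using h rG xy[OF j] by (subst acts_on_ring_sum[OF acts A_subring]) (auto simp: act_in act_act)
      then show ?thesis
        unfolding avg_def using h rG xy[OF j] Q(2,4)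
        by (subst act_mult) (auto intro!: unital_subring_sum[OF A_subring] act_in)
    qed
    have inner: "(\<Sum>j<n. act g (x j) * act g' (y j)) = (if inv g \<otimes> g' \<in> N then 1 else 0)"
      if g: "g \<in> carrier G" "g' \<in> carrier G" for g g'
    proof -
      have "(\<Sum>j<n. act g (x j) * act g' (y j)) = (\<Sum>j<n. act g (x j * act (inv g \<otimes> g') (y j)))"
      proof (rule sum.cong[OF refl])
        fix j assume j: "j \<in> {..<n}"
        have "act g (act (inv g \<otimes> g') (y j)) = act g' (y j)"
          using g xy j by (simp add: act_act[symmetric] m_assoc[symmetric])
        then show "act g (x j) * act g' (y j) = act g (x j * act (inv g \<otimes> g') (y j))"
          using g xy j by (simp add: act_mult act_in)
      qed
      also have "\<dots> = act g (\<Sum>j<n. x j * act (inv g \<otimes> g') (y j))"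
        using g xy by (subst acts_on_ring_sum[OF acts A_subring]) (auto intro!: A_closed act_in)
      also have "\<dots> = (if inv g \<otimes> g' \<in> N then 1 else 0)"
        using g delta[of "inv g \<otimes> g'"] act_1 acts_on_ring_zero[OF acts A_subring] by auto
      finally show ?thesis .
    qed
    have "(\<Sum>j<n. avg (x j) * act h (avg (y j))) =
        (\<Sum>j<n. \<Sum>C\<in>Q. \<Sum>D\<in>Q. d * d * (act (r C) (x j) * act (h \<otimes> r D) (y j)))"
    proof (rule sum.cong[OF refl])
      fix j assume "j \<in> {..<n}"
      then have "avg (x j) * act h (avg (y j)) =
          d * d * ((\<Sum>C\<in>Q. act (r C) (x j)) * (\<Sum>D\<in>Q. act (h \<otimes> r D) (y j)))"
        by (simp add: act_avg) (simp add: avg_def mult_ac)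
      also have "\<dots> = (\<Sum>C\<in>Q. \<Sum>D\<in>Q. d * d * (act (r C) (x j) * act (h \<otimes> r D) (y j)))"
        by (subst sum_product) (simp only: sum_distrib_left)
      finally show "avg (x j) * act h (avg (y j)) =
          (\<Sum>C\<in>Q. \<Sum>D\<in>Q. d * d * (act (r C) (x j) * act (h \<otimes> r D) (y j)))" .
    qed
    also have "\<dots> = (\<Sum>C\<in>Q. \<Sum>D\<in>Q. d * d * (\<Sum>j<n. act (r C) (x j) * act (h \<otimes> r D) (y j)))"
      by (subst sum.swap, intro sum.cong refl, subst sum.swap) (simp add: sum_distrib_left)
    also have "\<dots> = (\<Sum>C\<in>Q. \<Sum>D\<in>Q. d * d * (if h \<in> N then 1 else 0))"
    proof (intro sum.cong refl)
      fix C D assume CD: "C \<in> Q" "D \<in> Q"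
      have "inv (r C) \<otimes> (h \<otimes> r D) \<in> N \<longleftrightarrow> h \<in> N"
      proof
        assume "inv (r C) \<otimes> (h \<otimes> r D) \<in> N"
        then have "r C \<otimes> (inv (r C) \<otimes> (h \<otimes> r D)) \<otimes> inv (r D) \<in> N"
          using CD Q(1) by blast
        moreover have "r C \<otimes> (inv (r C) \<otimes> (h \<otimes> r D)) \<otimes> inv (r D) = h"
          using CD rG h by (simp add: m_assoc) (simp add: m_assoc[symmetric])
        ultimately show "h \<in> N" by simp
      qed (use CD Q(1) in blast)
      then show "d * d * (\<Sum>j<n. act (r C) (x j) * act (h \<otimes> r D) (y j)) = d * d * (if h \<in> N then 1 else 0)"
        using inner[of "r C" "h \<otimes> r D"] CD rG h by simp
    qed
    also have "\<dots> = (of_nat (card Q) * d) * (of_nat (card Q) * d) * (if h \<in> N then 1 else 0)"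
      by (simp add: mult_ac)
    finally show ?thesis using Q(3) by simp
  qed
  have carr: "carrier (G Mod N) = rcosets N" by (simp add: FactGroup_def)
  have "galois_coordinates (G Mod N) ?S (coset_act act) n (\<lambda>j. avg (x j)) (\<lambda>j. avg (y j))"
  proof (rule galois_coordinates.intro)
    show "group (G Mod N)" by (rule N.factorgroup_is_group)
    show "finite (carrier (G Mod N))" using Nf carr by simp
    show "unital_subring ?S" by (rule unital_subring_invariants[OF acts A_subring N.subset])
    show "acts_on_ring (G Mod N) ?S (coset_act act)"
      by (rule acts_on_ring_coset_act[OF acts A_subring is_group Nn])
    show "avg (x j) \<in> ?S" "avg (y j) \<in> ?S" if "j < n" for j using avg xU yU that by auto
    fix \<gamma> assume "\<gamma> \<in> carrier (G Mod N)"
    then obtain h where h: "h \<in> carrier G" "\<gamma> = N #> h" by (auto simp: carr RCOSETS_def)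
    have "(\<Sum>j<n. avg (x j) * coset_act act \<gamma> (avg (y j))) = (\<Sum>j<n. avg (x j) * act h (avg (y j)))"
      using coset_act_eq[OF acts is_group Nn h(1)] avg yU h(2) by (intro sum.cong refl) auto
    moreover have "\<gamma> = \<one>\<^bsub>G Mod N\<^esub> \<longleftrightarrow> h \<in> N"
      using h N.rcos_const[OF is_group] coset_join1[OF _ h(1) N.subgroup_axioms]
      by (auto simp: FactGroup_def)
    ultimately show "(\<Sum>j<n. avg (x j) * coset_act act \<gamma> (avg (y j))) = (if \<gamma> = \<one>\<^bsub>G Mod N\<^esub> then 1 else 0)"
      using avg_delta[OF h(1)] by simp
  qed
  from galois_coordinates.galois_cover[OF this] show ?thesis
    unfolding invariants_coset_act[OF acts is_group Nn] .
qed

end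

section \<open>A permutation cocycle with values in the l-adic integers\<close>

text \<open>
  Over the finite cyclic group generated by \<open>\<sigma>\<close>, a permutation module over \<open>\<int>\<^sub>l\<close> has vanishing first
  cohomology.  Concretely, if \<open>f\<close> sums to zero over each \<open>\<sigma>\<close>-stable set, \<open>y(\<sigma> b) = f(\<sigma> b) + y(b)\<close> can be solved.  Elements
  of \<open>\<int>\<^sub>l\<close> are represented by integer sequences with compatible residues, so that no reduction is
  needed in the proof.
  
  The induction removes a point \<open>b0\<close> from \<open>B\<close>.  If \<open>b0\<close> is not fixed, \<open>\<sigma>\<close> is short-circuited to skip
  \<open>b0\<close>, and the value \<open>f(b0)\<close> is added to \<open>f(\<sigma> b0)\<close>, which preserves the sums over stable sets.
\<close>

lemma l_adic_cocycle_splitting: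
  fixes f :: "'b \<Rightarrow> nat \<Rightarrow> int"
  assumes "finite B" "bij_betw \<sigma> B B"
    and "\<And>b s. b \<in> B \<Longrightarrow> int l ^ s dvd f b (Suc s) - f b s"
    and "\<And>C s. C \<subseteq> B \<Longrightarrow> \<sigma> ` C = C \<Longrightarrow> int l ^ s dvd (\<Sum>b\<in>C. f b s)"
  shows "\<exists>y. (\<forall>b\<in>B. \<forall>s. int l ^ s dvd y b (Suc s) - y b s) \<and>
             (\<forall>b\<in>B. \<forall>s. int l ^ s dvd y (\<sigma> b) s - (f (\<sigma> b) s + y b s))"
  using assms
proof (induction B arbitrary: \<sigma> f rule: finite_induct)
  case (insert b0 B)
  let ?B = "insert b0 B"
  note bij = insert.prems(1)
  have inj: "\<sigma> a = \<sigma> b \<longleftrightarrow> a = b" if "a \<in> ?B" "b \<in> ?B" for a b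
    using bij that by (auto simp: bij_betw_def inj_on_def)
  have im: "\<sigma> b \<in> ?B" if "b \<in> ?B" for b using bij that by (auto simp: bij_betw_def)
  show ?case
  proof (cases "\<sigma> b0 = b0")
    case True
    have "\<sigma> b \<in> B" if "b \<in> B" for b using im[of b] inj[of b b0] that True insert.hyps by auto
    then have sub: "\<sigma> ` B \<subseteq> B" by blast
    have "inj_on \<sigma> B" by (rule inj_onI) (use inj in blast)
    then have \<sigma>B: "bij_betw \<sigma> B B"
      using endo_inj_surj[OF insert.hyps(1) sub] by (simp add: bij_betw_def)
    obtain y where y: "\<forall>b\<in>B. \<forall>s. int l ^ s dvd y b (Suc s) - y b s"
        "\<forall>b\<in>B. \<forall>s. int l ^ s dvd y (\<sigma> b) s - (f (\<sigma> b) s + y b s)"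
      using insert.IH[OF \<sigma>B insert.prems(2,3)] by blast
    have "int l ^ s dvd f b0 s" for s
      using insert.prems(3)[of "{b0}" s] True by simp
    moreover have "\<sigma> b \<noteq> b0" if "b \<in> B" for b using inj[of b b0] that True insert.hyps by auto
    ultimately show ?thesis
      using y insert.hyps True by (intro exI[of _ "y(b0 := \<lambda>_. 0)"]) auto
  next
    case False
    then have \<sigma>b0: "\<sigma> b0 \<in> B" using im[of b0] by auto
    define \<tau> where "\<tau> b = (if \<sigma> b = b0 then \<sigma> b0 else \<sigma> b)" for b
    define h where "h b s = (if b = \<sigma> b0 then f b0 s + f b s else f b s)" for b s
    have "b0 \<in> \<sigma> ` ?B" using bij by (simp add: bij_betw_def)
    then obtain p where "p \<in> ?B" "b0 = \<sigma> p" by (rule imageE)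
    then have p: "p \<in> B" "\<sigma> p = b0" using False by auto
    have \<tau>B: "\<tau> b \<in> B" if "b \<in> B" for b
      using im[of b] that \<sigma>b0 by (auto simp: \<tau>_def)
    have "inj_on \<tau> B"
    proof (rule inj_onI)
      fix a b assume ab: "a \<in> B" "b \<in> B" "\<tau> a = \<tau> b"
      then have "a \<noteq> b0" "b \<noteq> b0" using insert.hyps(2) by auto
      then have "\<sigma> a \<noteq> \<sigma> b0" "\<sigma> b \<noteq> \<sigma> b0" using ab inj[of a b0] inj[of b b0] by auto
      then have "\<sigma> a = \<sigma> b" using ab(3) by (auto simp: \<tau>_def split: if_splits)
      then show "a = b" using ab inj[of a b] by simp
    qed
    moreover have "\<tau> ` B \<subseteq> B" using \<tau>B by auto
    ultimately have bij\<tau>: "bij_betw \<tau> B B"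
      using insert.hyps(1) by (simp add: bij_betw_def endo_inj_surj)
    have sum_h: "int l ^ s dvd (\<Sum>b\<in>C. h b s)" if C: "C \<subseteq> B" "\<tau> ` C = C" for C s
    proof (cases "\<sigma> b0 \<in> C")
      case True
      then have "\<sigma> b0 \<in> \<tau> ` C" using C(2) by simp
      then obtain q where q: "q \<in> C" "\<tau> q = \<sigma> b0" by auto
      have "q = p"
        using q C(1) inj[of q b0] inj[of q p] p insert.hyps(2) by (auto simp: \<tau>_def split: if_splits)
      then have pO: "p \<in> C" using q by simp
      have b0: "b0 \<notin> C" using C insert.hyps by auto
      have "\<sigma> ` insert b0 C = insert b0 C"
      proof
        show "\<sigma> ` insert b0 C \<subseteq> insert b0 C"
        proof (rule image_subsetI)
          fix b assume "b \<in> insert b0 C"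
          moreover have "\<tau> b \<in> C" if "b \<in> C" using that C(2) by blast
          ultimately show "\<sigma> b \<in> insert b0 C" using True by (auto simp: \<tau>_def split: if_splits)
        qed
        show "insert b0 C \<subseteq> \<sigma> ` insert b0 C"
        proof
          fix b assume "b \<in> insert b0 C"
          then consider "b = b0" | "b \<in> \<tau> ` C" using C(2) by auto
          then show "b \<in> \<sigma> ` insert b0 C"
          proof cases
            case 1 then show ?thesis using p pO by auto
          next
            case 2 then show ?thesis by (auto simp: \<tau>_def)
          qed
        qed
      qed
      then have "int l ^ s dvd (\<Sum>b\<in>insert b0 C. f b s)"
        using C by (intro insert.prems(3)) auto
      also have finO: "finite C" using C insert.hyps finite_subset by blast
      have "(\<Sum>b\<in>insert b0 C. f b s) = f b0 s + (f (\<sigma> b0) s + (\<Sum>b\<in>C - {\<sigma> b0}. f b s))"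
        using finO b0 True by (simp add: sum.remove)
      also have "\<dots> = h (\<sigma> b0) s + (\<Sum>b\<in>C - {\<sigma> b0}. h b s)"
        by (auto simp: h_def intro!: sum.cong)
      also have "\<dots> = (\<Sum>b\<in>C. h b s)" using finO True by (simp add: sum.remove)
      finally show ?thesis .
    next
      case False
      have "\<sigma> b = \<tau> b" if "b \<in> C" for b
      proof -
        have "\<tau> b \<in> C" using that C(2) by blast
        then show ?thesis using False by (auto simp: \<tau>_def split: if_splits)
      qed
      then have "\<sigma> ` C = C" using C(2) by (metis image_cong)
      then have "int l ^ s dvd (\<Sum>b\<in>C. f b s)" using C by (intro insert.prems(3)) auto
      also have "(\<Sum>b\<in>C. f b s) = (\<Sum>b\<in>C. h b s)"
        using False by (intro sum.cong) (auto simp: h_def)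
      finally show ?thesis .
    qed
    have h_compat: "int l ^ s dvd h b (Suc s) - h b s" if "b \<in> B" for b s
    proof (cases "b = \<sigma> b0")
      case True
      have "int l ^ s dvd (f b0 (Suc s) - f b0 s) + (f b (Suc s) - f b s)"
        using that by (intro dvd_add insert.prems(2)) auto
      then show ?thesis using True by (simp add: h_def algebra_simps)
    qed (use insert.prems(2)[of b s] that in \<open>simp add: h_def\<close>)
    have "\<exists>y. (\<forall>b\<in>B. \<forall>s. int l ^ s dvd y b (Suc s) - y b s) \<and>
        (\<forall>b\<in>B. \<forall>s. int l ^ s dvd y (\<tau> b) s - (h (\<tau> b) s + y b s))"
      by (rule insert.IH[OF bij\<tau>]) (erule h_compat, erule (1) sum_h)
    then obtain y where y: "\<forall>b\<in>B. \<forall>s. int l ^ s dvd y b (Suc s) - y b s"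
        "\<forall>b\<in>B. \<forall>s. int l ^ s dvd y (\<tau> b) s - (h (\<tau> b) s + y b s)" by (elim exE conjE)
    note y = y[rule_format]
    define z where "z = y(b0 := \<lambda>s. f b0 s + y p s)"
    have z: "z b = y b" if "b \<in> B" for b using that insert.hyps by (auto simp: z_def)
    have "int l ^ s dvd z b (Suc s) - z b s" if "b \<in> ?B" for b s
    proof (cases "b = b0")
      case True
      have "int l ^ s dvd (f b0 (Suc s) - f b0 s) + (y p (Suc s) - y p s)"
        by (intro dvd_add insert.prems(2) y(1) p(1)) simp
      then show ?thesis using True by (simp add: z_def algebra_simps)
    qed (use y(1) z that in simp)
    moreover have "int l ^ s dvd z (\<sigma> b) s - (f (\<sigma> b) s + z b s)" if bB: "b \<in> ?B" for b s
    proof -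
      consider "b = p" | "b = b0" | "b \<in> B" "b \<noteq> p" using bB by auto
      then show ?thesis
      proof cases
        case 1
        have "z p s = y p s" "z b0 s = f b0 s + y p s" using p z by (auto simp: z_def)
        then show ?thesis using 1 p by simp
      next
        case 2
        have "int l ^ s dvd y (\<tau> p) s - (h (\<tau> p) s + y p s)" by (rule y(2)[OF p(1)])
        moreover have "\<tau> p = \<sigma> b0" using p by (simp add: \<tau>_def)
        ultimately show ?thesis
          using 2 \<sigma>b0 z by (simp add: h_def z_def algebra_simps)
      next
        case 3
        then have "\<sigma> b \<noteq> b0" using p inj[of b p] by auto
        moreover have "\<sigma> b \<noteq> \<sigma> b0" using 3 inj[of b b0] insert.hyps by auto
        ultimately have "\<sigma> b \<in> B" "\<tau> b = \<sigma> b" "h (\<sigma> b) s = f (\<sigma> b) s"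
          using 3 im[of b] by (auto simp: \<tau>_def h_def)
        then show ?thesis using y(2)[OF 3(1), of s] z 3(1) by simp
      qed
    qed
    ultimately show ?thesis by blast
  qed
qed simp

section \<open>Coordinates of based affine modules\<close>

locale based_affine_space =
  fixes l :: nat and D :: "('f, 'x) based_affine"
  assumes l_pos: "l > 0" and based_affine: "is_based_affine l D"
begin

abbreviation F :: "(nat \<Rightarrow> int, 'f) module" where "F \<equiv> ba_lattice D"
abbreviation B :: "'f set" where "B \<equiv> ba_basis D"
abbreviation X :: "'x set" where "X \<equiv> topspace (ba_space D)"
abbreviation crd :: "'f \<Rightarrow> 'f \<Rightarrow> nat \<Rightarrow> int" where "crd \<equiv> coords l F B"

lemma module_F: "module (Zl l) F"
  and basis: "is_module_basis l F B"
  and act_zero: "x \<in> X \<Longrightarrow> ba_act D \<zero>\<^bsub>F\<^esub> x = x"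
  and act_add: "f \<in> carrier F \<Longrightarrow> f' \<in> carrier F \<Longrightarrow> x \<in> X \<Longrightarrow>
      ba_act D (f \<oplus>\<^bsub>F\<^esub> f') x = ba_act D f (ba_act D f' x)"
  and homeo: "x \<in> X \<Longrightarrow> homeomorphic_map (lattice_top l F B) (ba_space D) (\<lambda>f. ba_act D f x)"
  using based_affine unfolding is_based_affine_def Let_def by blast+

sublocale module "Zl l" F by (rule module_F)

lemma finite_B: "finite B" and B_subset: "B \<subseteq> carrier F"
  using basis by (auto simp: is_module_basis_def)

lemma coords_unique:
  assumes "c \<in> B \<rightarrow>\<^sub>E carrier (Zl l)" "f = (\<Oplus>\<^bsub>F\<^esub>b\<in>B. c b \<odot>\<^bsub>F\<^esub> b)"
  shows "crd f = c"
proof -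
  have "f \<in> carrier F"
    using assms B_subset by (auto intro!: M.finsum_closed smult_closed)
  then have "\<exists>!c. c \<in> B \<rightarrow>\<^sub>E carrier (Zl l) \<and> f = (\<Oplus>\<^bsub>F\<^esub>b\<in>B. c b \<odot>\<^bsub>F\<^esub> b)"
    using basis by (auto simp: is_module_basis_def)
  from the1_equality[OF this] assms show ?thesis unfolding coords_def by blast
qed

lemma coords_in: "f \<in> carrier F \<Longrightarrow> crd f \<in> B \<rightarrow>\<^sub>E carrier (Zl l)"
  and coords_expansion: "f \<in> carrier F \<Longrightarrow> f = (\<Oplus>\<^bsub>F\<^esub>b\<in>B. crd f b \<odot>\<^bsub>F\<^esub> b)"
proof -
  assume "f \<in> carrier F"
  then have "\<exists>!c. c \<in> B \<rightarrow>\<^sub>E carrier (Zl l) \<and> f = (\<Oplus>\<^bsub>F\<^esub>b\<in>B. c b \<odot>\<^bsub>F\<^esub> b)"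
    using basis by (auto simp: is_module_basis_def)
  from theI'[OF this]
  show "crd f \<in> B \<rightarrow>\<^sub>E carrier (Zl l)" "f = (\<Oplus>\<^bsub>F\<^esub>b\<in>B. crd f b \<odot>\<^bsub>F\<^esub> b)"
    unfolding coords_def by blast+
qed

lemma coords_Zl: "f \<in> carrier F \<Longrightarrow> b \<in> B \<Longrightarrow> crd f b \<in> carrier (Zl l)"
  using coords_in by (auto simp: PiE_iff)

lemma coords_inject:
  assumes "f \<in> carrier F" "f' \<in> carrier F" "\<And>b. b \<in> B \<Longrightarrow> crd f b = crd f' b"
  shows "f = f'"
proof -
  have "crd f = crd f'"
    using coords_in assms by (intro extensionalityI[of _ B]) (auto simp: PiE_iff)
  then have "(\<Oplus>\<^bsub>F\<^esub>b\<in>B. crd f b \<odot>\<^bsub>F\<^esub> b) = (\<Oplus>\<^bsub>F\<^esub>b\<in>B. crd f' b \<odot>\<^bsub>F\<^esub> b)" by (simp only:)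
  then show ?thesis
    by (simp only: coords_expansion[OF assms(1), symmetric] coords_expansion[OF assms(2), symmetric])
qed

lemma coords_surj:
  assumes "c \<in> B \<rightarrow>\<^sub>E carrier (Zl l)"
  obtains f where "f \<in> carrier F" "crd f = c"
proof
  let ?f = "\<Oplus>\<^bsub>F\<^esub>b\<in>B. c b \<odot>\<^bsub>F\<^esub> b"
  show "?f \<in> carrier F" using assms B_subset by (auto intro!: M.finsum_closed smult_closed)
  show "crd ?f = c" using assms by (rule coords_unique) simp
qed

lemma coords_zero: "b \<in> B \<Longrightarrow> crd \<zero>\<^bsub>F\<^esub> b = \<zero>\<^bsub>Zl l\<^esub>"
proof -
  assume b: "b \<in> B"
  have "(\<Oplus>\<^bsub>F\<^esub>b\<in>B. (\<lambda>b\<in>B. \<zero>\<^bsub>Zl l\<^esub>) b \<odot>\<^bsub>F\<^esub> b) = (\<Oplus>\<^bsub>F\<^esub>b\<in>B. \<zero>\<^bsub>F\<^esub>)"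
    using B_subset by (intro M.finsum_cong') (auto simp: smult_l_null subset_iff)
  then have "crd \<zero>\<^bsub>F\<^esub> = (\<lambda>b\<in>B. \<zero>\<^bsub>Zl l\<^esub>)"
    by (intro coords_unique) auto
  then show ?thesis using b by simp
qed

lemma coords_add:
  assumes "f \<in> carrier F" "f' \<in> carrier F" "b \<in> B"
  shows "crd (f \<oplus>\<^bsub>F\<^esub> f') b = crd f b \<oplus>\<^bsub>Zl l\<^esub> crd f' b"
proof -
  let ?c = "\<lambda>b\<in>B. crd f b \<oplus>\<^bsub>Zl l\<^esub> crd f' b"
  have "(\<Oplus>\<^bsub>F\<^esub>b\<in>B. ?c b \<odot>\<^bsub>F\<^esub> b) = (\<Oplus>\<^bsub>F\<^esub>b\<in>B. crd f b \<odot>\<^bsub>F\<^esub> b \<oplus>\<^bsub>F\<^esub> crd f' b \<odot>\<^bsub>F\<^esub> b)"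
    using assms B_subset coords_Zl
    by (intro M.finsum_cong') (auto simp: smult_l_distr subset_iff)
  also have "\<dots> = (\<Oplus>\<^bsub>F\<^esub>b\<in>B. crd f b \<odot>\<^bsub>F\<^esub> b) \<oplus>\<^bsub>F\<^esub> (\<Oplus>\<^bsub>F\<^esub>b\<in>B. crd f' b \<odot>\<^bsub>F\<^esub> b)"
    using assms B_subset coords_Zl by (intro M.finsum_addf) auto
  also have "\<dots> = f \<oplus>\<^bsub>F\<^esub> f'"
    by (simp only: coords_expansion[OF assms(1), symmetric] coords_expansion[OF assms(2), symmetric])
  finally have "crd (f \<oplus>\<^bsub>F\<^esub> f') = ?c"
    using assms coords_Zl by (intro coords_unique) auto
  then show ?thesis using assms by simp
qed

end

locale affine_automorphism = based_affine_space +
  fixes a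
  assumes automorphism: "a \<in> carrier (BA_aut l D)"
begin

lemma lin_closed: "f \<in> carrier F \<Longrightarrow> fst a f \<in> carrier F"
  and lin_inj: "inj_on (fst a) (carrier F)"
  and lin_add: "f \<in> carrier F \<Longrightarrow> f' \<in> carrier F \<Longrightarrow> fst a (f \<oplus>\<^bsub>F\<^esub> f') = fst a f \<oplus>\<^bsub>F\<^esub> fst a f'"
  and lin_smult: "c \<in> carrier (Zl l) \<Longrightarrow> f \<in> carrier F \<Longrightarrow> fst a (c \<odot>\<^bsub>F\<^esub> f) = c \<odot>\<^bsub>F\<^esub> fst a f"
  and lin_basis: "fst a ` B = B"
  and map_homeo: "homeomorphic_map (ba_space D) (ba_space D) (snd a)"
  and map_act: "f \<in> carrier F \<Longrightarrow> x \<in> X \<Longrightarrow> snd a (ba_act D f x) = ba_act D (fst a f) (snd a x)"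
  using automorphism unfolding BA_aut_def Let_def
  by (auto simp: bij_betw_def)

lemma bij_basis: "bij_betw (fst a) B B"
  using lin_basis inj_on_subset[OF lin_inj B_subset] by (simp add: bij_betw_def)

lemma map_closed: "x \<in> X \<Longrightarrow> snd a x \<in> X"
  and map_inj: "inj_on (snd a) X"
  using map_homeo homeomorphic_imp_surjective_map homeomorphic_imp_injective_map by blast+

lemma lin_finsum:
  assumes "finite I" "\<And>i. i \<in> I \<Longrightarrow> f i \<in> carrier F"
  shows "fst a (\<Oplus>\<^bsub>F\<^esub>i\<in>I. f i) = (\<Oplus>\<^bsub>F\<^esub>i\<in>I. fst a (f i))"
  using assms
proof (induction I rule: finite_induct)
  case empty
  have "fst a (\<zero>\<^bsub>F\<^esub> \<oplus>\<^bsub>F\<^esub> \<zero>\<^bsub>F\<^esub>) = fst a \<zero>\<^bsub>F\<^esub> \<oplus>\<^bsub>F\<^esub> fst a \<zero>\<^bsub>F\<^esub>" by (rule lin_add) auto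
  then have "fst a \<zero>\<^bsub>F\<^esub> = \<zero>\<^bsub>F\<^esub>"
    using lin_closed[OF M.zero_closed] by (simp add: M.add.r_cancel_one')
  then show ?case by simp
next
  case (insert i I)
  then have "(\<Oplus>\<^bsub>F\<^esub>i\<in>insert i I. f i) = f i \<oplus>\<^bsub>F\<^esub> (\<Oplus>\<^bsub>F\<^esub>i\<in>I. f i)"
    by (intro M.finsum_insert) auto
  moreover have "(\<Oplus>\<^bsub>F\<^esub>i\<in>insert i I. fst a (f i)) = fst a (f i) \<oplus>\<^bsub>F\<^esub> (\<Oplus>\<^bsub>F\<^esub>i\<in>I. fst a (f i))"
    using insert lin_closed by (intro M.finsum_insert) auto
  moreover have "(\<Oplus>\<^bsub>F\<^esub>i\<in>I. f i) \<in> carrier F" using insert by (intro M.finsum_closed) auto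
  ultimately show ?case using insert by (simp add: lin_add)
qed

lemma coords_lin:
  assumes f: "f \<in> carrier F" and b: "b \<in> B"
  shows "crd (fst a f) (fst a b) = crd f b"
proof -
  let ?\<tau> = "inv_into B (fst a)"
  have \<tau>: "?\<tau> b \<in> B" "fst a (?\<tau> b) = b" if "b \<in> B" for b
    using that lin_basis by (metis inv_into_into, metis f_inv_into_f)
  have \<tau>': "?\<tau> (fst a b) = b" if "b \<in> B" for b
    using that bij_basis by (simp add: bij_betw_inv_into_left)
  let ?c = "\<lambda>b\<in>B. crd f (?\<tau> b)"
  have "fst a f = fst a (\<Oplus>\<^bsub>F\<^esub>b\<in>B. crd f b \<odot>\<^bsub>F\<^esub> b)"
    using coords_expansion[OF f] by simp
  also have "\<dots> = (\<Oplus>\<^bsub>F\<^esub>b\<in>B. fst a (crd f b \<odot>\<^bsub>F\<^esub> b))"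
    using finite_B B_subset coords_Zl[OF f] by (intro lin_finsum) auto
  also have "\<dots> = (\<Oplus>\<^bsub>F\<^esub>b\<in>B. ?c (fst a b) \<odot>\<^bsub>F\<^esub> fst a b)"
    using B_subset coords_Zl[OF f] lin_basis lin_closed
    by (intro M.finsum_cong') (auto simp: lin_smult \<tau>' subset_iff)
  also have "\<dots> = (\<Oplus>\<^bsub>F\<^esub>b\<in>fst a ` B. ?c b \<odot>\<^bsub>F\<^esub> b)"
    using B_subset coords_Zl[OF f] lin_basis \<tau> bij_basis
    by (intro M.finsum_reindex[symmetric]) (auto simp: bij_betw_def)
  finally have "fst a f = (\<Oplus>\<^bsub>F\<^esub>b\<in>B. ?c b \<odot>\<^bsub>F\<^esub> b)" by (simp only: lin_basis)
  then have "crd (fst a f) = ?c"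
    using coords_Zl[OF f] \<tau> by (intro coords_unique) auto
  moreover have "fst a b \<in> B" using lin_basis b by auto
  ultimately show ?thesis using \<tau>'[OF b] by simp
qed

end

context based_affine_space
begin

lemma topspace_lattice_top: "topspace (lattice_top l F B) = carrier F"
proof -
  have "topspace (Zl_top l) = carrier (Zl l)" by (auto simp: Zl_top_def)
  then have "crd f \<in> topspace (product_topology (\<lambda>_. Zl_top l) B)" if "f \<in> carrier F" for f
    using coords_in[OF that] by simp
  then show ?thesis by (auto simp: lattice_top_def topspace_pullback_topology)
qed

lemma unique_translation:
  assumes "x \<in> X" "x0 \<in> X"
  shows "\<exists>!f. f \<in> carrier F \<and> x = ba_act D f x0"
  using homeomorphic_imp_injective_map[OF homeo[OF assms(2)]]
    homeomorphic_imp_surjective_map[OF homeo[OF assms(2)]] assms(1)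
  unfolding topspace_lattice_top by (auto simp: inj_on_def image_iff set_eq_iff)

text \<open>
  The \<open>f \<in> F\<close> in the decomposition \<open>a = f \<cdot> \<sigma>\<close> relative to the base point \<open>x0\<close>.
\<close>

definition translation :: "'x \<Rightarrow> ('f \<Rightarrow> 'f) \<times> ('x \<Rightarrow> 'x) \<Rightarrow> 'f" where
  "translation x0 a = (THE f. f \<in> carrier F \<and> snd a x0 = ba_act D f x0)"

lemma shift_coord_eq: "shift_coord l D x0 a b = crd (translation x0 a) b"
  by (simp add: shift_coord_def translation_def)

lemma translation_eqI:
  "f \<in> carrier F \<Longrightarrow> x0 \<in> X \<Longrightarrow> snd a x0 \<in> X \<Longrightarrow> snd a x0 = ba_act D f x0 \<Longrightarrow> translation x0 a = f"
  unfolding translation_def by (rule the1_equality[OF unique_translation]) auto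

end

context affine_automorphism
begin

lemma translation:
  assumes "x0 \<in> X"
  shows "translation x0 a \<in> carrier F" "snd a x0 = ba_act D (translation x0 a) x0"
  using theI'[OF unique_translation[OF map_closed[OF assms] assms]]
  unfolding translation_def by blast+

lemma shift_coord_Zl: "x0 \<in> X \<Longrightarrow> b \<in> B \<Longrightarrow> shift_coord l D x0 a b \<in> carrier (Zl l)"
  by (simp add: shift_coord_eq coords_Zl translation)

lemma map_translate:
  assumes "f \<in> carrier F" "x0 \<in> X"
  shows "snd a (ba_act D f x0) = ba_act D (fst a f \<oplus>\<^bsub>F\<^esub> translation x0 a) x0"
  using assms translation[OF assms(2)] by (simp add: map_act act_add lin_closed)

text \<open>
  In terms of \<open>a = f \<cdot> \<sigma>\<close>, the point \<open>y \<cdot> x0\<close> is fixed if and only if \<open>\<sigma> y + f = y\<close>; in coordinates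
  this is the equation solved in \<open>l_adic_cocycle_splitting\<close>.
\<close>

theorem fixed_point:
  assumes x0: "x0 \<in> X"
    and sums: "\<And>C s. C \<subseteq> B \<Longrightarrow> fst a ` C = C \<Longrightarrow> int l ^ s dvd (\<Sum>b\<in>C. shift_coord l D x0 a b s)"
  shows "\<exists>x\<in>X. snd a x = x"
proof -
  let ?c = "shift_coord l D x0 a"
  have compat: "int l ^ s dvd ?c b (Suc s) - ?c b s" if "b \<in> B" for b s
  proof -
    have "?c b (Suc s) mod int l ^ s = ?c b s mod int l ^ s"
      using shift_coord_Zl[OF x0 that] by (simp add: Zl_ops_simps)
    then show ?thesis by (simp add: mod_eq_dvd_iff)
  qed
  have "\<exists>y. (\<forall>b\<in>B. \<forall>s. int l ^ s dvd y b (Suc s) - y b s) \<and>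
      (\<forall>b\<in>B. \<forall>s. int l ^ s dvd y (fst a b) s - (?c (fst a b) s + y b s))"
    by (rule l_adic_cocycle_splitting[OF finite_B bij_basis]) (erule compat, erule (1) sums)
  then obtain y where y: "\<forall>b\<in>B. \<forall>s. int l ^ s dvd y b (Suc s) - y b s"
      "\<forall>b\<in>B. \<forall>s. int l ^ s dvd y (fst a b) s - (?c (fst a b) s + y b s)" by (elim exE conjE)
  define d where "d = (\<lambda>b\<in>B. \<lambda>s. y b s mod int l ^ s)"
  have "(\<lambda>s. y b s mod int l ^ s) \<in> carrier (Zl l)" if "b \<in> B" for b
  proof -
    have "y b (Suc s) mod int l ^ Suc s mod int l ^ s = y b s mod int l ^ s" for s
    proof -
      have "y b (Suc s) mod int l ^ s = y b s mod int l ^ s"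
        unfolding mod_eq_dvd_iff using y(1) that by blast
      then show ?thesis by (subst mod_mod_cancel) simp_all
    qed
    then show ?thesis using l_pos by (simp add: Zl_ops_simps del: power_Suc)
  qed
  then have "d \<in> B \<rightarrow>\<^sub>E carrier (Zl l)" by (auto simp: d_def)
  then obtain f where f: "f \<in> carrier F" "crd f = d" by (rule coords_surj)
  note tr = translation[OF x0]
  have "fst a f \<oplus>\<^bsub>F\<^esub> translation x0 a = f"
  proof (rule coords_inject)
    fix b' assume "b' \<in> B"
    then have "b' \<in> fst a ` B" by (simp only: lin_basis)
    then obtain b where b: "b' = fst a b" "b \<in> B" by (rule imageE)
    have b': "fst a b \<in> B" using lin_basis b by auto
    have "crd (fst a f \<oplus>\<^bsub>F\<^esub> translation x0 a) b' = d b \<oplus>\<^bsub>Zl l\<^esub> ?c b'"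
      using f tr b b' by (simp add: coords_add lin_closed coords_lin shift_coord_eq)
    also have "\<dots> = d b'"
    proof
      fix s
      have "int l ^ s dvd y b' s - (?c b' s + y b s)" unfolding b(1) using y(2) b(2) by blast
      then have "y b' s mod int l ^ s = (?c b' s + y b s) mod int l ^ s" by (simp only: mod_eq_dvd_iff)
      then have "(y b s + ?c b' s) mod int l ^ s = y b' s mod int l ^ s" by (simp only: add.commute)
      then show "(d b \<oplus>\<^bsub>Zl l\<^esub> ?c b') s = d b' s"
        using b b' by (simp add: d_def Zl_ops_simps mod_simps)
    qed
    finally show "crd (fst a f \<oplus>\<^bsub>F\<^esub> translation x0 a) b' = crd f b'" using f by simp
  qed (use f tr lin_closed in auto)
  then have "snd a (ba_act D f x0) = ba_act D f x0"
    using map_translate[OF f(1) x0] by simp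
  moreover have "ba_act D f x0 \<in> X"
    using homeomorphic_imp_surjective_map[OF homeo[OF x0]] f(1) unfolding topspace_lattice_top by auto
  ultimately show ?thesis by blast
qed

end

text \<open>
  The product in \<open>\<AA> \<cong> \<Sigma>\<^sub>B \<ltimes> F\<close>: since \<open>a a' x0 = a (f' \<cdot> x0) = (\<sigma> f' + f) \<cdot> x0\<close>, the translation
  part is a cocycle.
\<close>

lemma shift_coord_mult:
  assumes "based_affine_space l D" and a: "a \<in> carrier (BA_aut l D)" and a': "a' \<in> carrier (BA_aut l D)"
    and x0: "x0 \<in> topspace (ba_space D)" and b: "b \<in> ba_basis D"
  shows "fst (a \<otimes>\<^bsub>BA_aut l D\<^esub> a') b = fst a (fst a' b)"
    and "shift_coord l D x0 (a \<otimes>\<^bsub>BA_aut l D\<^esub> a') (fst a (fst a' b)) =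
         shift_coord l D x0 a (fst a (fst a' b)) \<oplus>\<^bsub>Zl l\<^esub> shift_coord l D x0 a' (fst a' b)"
proof -
  interpret based_affine_space l D by fact
  interpret a: affine_automorphism l D a by unfold_locales (fact a)
  interpret a': affine_automorphism l D a' by unfold_locales (fact a')
  have mult: "fst (a \<otimes>\<^bsub>BA_aut l D\<^esub> a') f = fst a (fst a' f)" if "f \<in> carrier F" for f
    using that by (simp add: BA_aut_def Let_def case_prod_unfold compose_def)
  show "fst (a \<otimes>\<^bsub>BA_aut l D\<^esub> a') b = fst a (fst a' b)" using mult b B_subset by auto
  have snd_mult: "snd (a \<otimes>\<^bsub>BA_aut l D\<^esub> a') x0 = snd a (snd a' x0)"
    using x0 by (simp add: BA_aut_def Let_def case_prod_unfold compose_def)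
  have "snd a (snd a' x0) = ba_act D (fst a (translation x0 a') \<oplus>\<^bsub>F\<^esub> translation x0 a) x0"
    by (subst a'.translation(2)[OF x0]) (rule a.map_translate[OF a'.translation(1)[OF x0] x0])
  then have tr: "translation x0 (a \<otimes>\<^bsub>BA_aut l D\<^esub> a') = fst a (translation x0 a') \<oplus>\<^bsub>F\<^esub> translation x0 a"
    using a.map_closed[OF a'.map_closed[OF x0]] a.lin_closed[OF a'.translation(1)[OF x0]] a.translation(1)[OF x0]
    by (intro translation_eqI x0) (simp_all only: snd_mult M.add.m_closed)
  have b': "fst a' b \<in> B" "fst a (fst a' b) \<in> B"
    using a.lin_basis a'.lin_basis b by auto
  show "shift_coord l D x0 (a \<otimes>\<^bsub>BA_aut l D\<^esub> a') (fst a (fst a' b)) =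
      shift_coord l D x0 a (fst a (fst a' b)) \<oplus>\<^bsub>Zl l\<^esub> shift_coord l D x0 a' (fst a' b)"
    unfolding shift_coord_eq tr
    using a'.translation(1)[OF x0] a.translation(1)[OF x0] b'
    by (simp add: coords_add a.lin_closed a.coords_lin coords_Zl R.add.m_comm)
qed

section \<open>Continuity of l-BARs\<close>

locale pointed_l_BAR =
  fixes l :: nat and G :: "('g, 'm) monoid_scheme" and T :: "'g topology"
    and D :: "('f, 'x) based_affine" and \<eta> :: "'g \<Rightarrow> ('f \<Rightarrow> 'f) \<times> ('x \<Rightarrow> 'x)" and x0 :: 'x
  assumes pos: "l > 0" and group: "group G" and topspace_T: "topspace T = carrier G"
    and BAR: "l_BAR l G T D \<eta>" and base_point: "x0 \<in> topspace (ba_space D)"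
begin

sublocale based_affine_space l D
  using pos BAR by unfold_locales (auto simp: l_BAR_def)

lemma eta_automorphism: "g \<in> carrier G \<Longrightarrow> affine_automorphism l D (\<eta> g)"
  using BAR by unfold_locales (auto simp: l_BAR_def hom_def)

lemma eta_mult: "g \<in> carrier G \<Longrightarrow> h \<in> carrier G \<Longrightarrow> \<eta> (g \<otimes>\<^bsub>G\<^esub> h) = \<eta> g \<otimes>\<^bsub>BA_aut l D\<^esub> \<eta> h"
  using BAR by (auto simp: l_BAR_def hom_def)

lemma perm_bij: "g \<in> carrier G \<Longrightarrow> bij_betw (fst (\<eta> g)) B B"
  by (rule affine_automorphism.bij_basis[OF eta_automorphism])

lemma shift_Zl: "g \<in> carrier G \<Longrightarrow> b \<in> B \<Longrightarrow> shift_coord l D x0 (\<eta> g) b \<in> carrier (Zl l)"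
  by (rule affine_automorphism.shift_coord_Zl[OF eta_automorphism base_point])

lemma eta_in: "g \<in> carrier G \<Longrightarrow> \<eta> g \<in> carrier (BA_aut l D)"
  by (rule affine_automorphism.automorphism[OF eta_automorphism])

lemma perm_mult:
  assumes "g \<in> carrier G" "h \<in> carrier G" "b \<in> B"
  shows "fst (\<eta> (g \<otimes>\<^bsub>G\<^esub> h)) b = fst (\<eta> g) (fst (\<eta> h) b)"
  unfolding eta_mult[OF assms(1,2)]
  by (rule shift_coord_mult(1)[OF based_affine_space_axioms eta_in[OF assms(1)] eta_in[OF assms(2)] base_point assms(3)])

lemma shift_mult:
  assumes "g \<in> carrier G" "h \<in> carrier G" "b \<in> B"
  shows "shift_coord l D x0 (\<eta> (g \<otimes>\<^bsub>G\<^esub> h)) (fst (\<eta> g) (fst (\<eta> h) b)) =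
    shift_coord l D x0 (\<eta> g) (fst (\<eta> g) (fst (\<eta> h) b)) \<oplus>\<^bsub>Zl l\<^esub> shift_coord l D x0 (\<eta> h) (fst (\<eta> h) b)"
  unfolding eta_mult[OF assms(1,2)]
  by (rule shift_coord_mult(2)[OF based_affine_space_axioms eta_in[OF assms(1)] eta_in[OF assms(2)] base_point assms(3)])

lemma perm_one: "b \<in> B \<Longrightarrow> fst (\<eta> \<one>\<^bsub>G\<^esub>) b = b"
  and shift_one: "b \<in> B \<Longrightarrow> shift_coord l D x0 (\<eta> \<one>\<^bsub>G\<^esub>) b = \<zero>\<^bsub>Zl l\<^esub>"
proof -
  have one: "\<one>\<^bsub>G\<^esub> \<in> carrier G" by (rule monoid.one_closed[OF group.is_monoid[OF group]])
  have one_one: "\<one>\<^bsub>G\<^esub> \<otimes>\<^bsub>G\<^esub> \<one>\<^bsub>G\<^esub> = \<one>\<^bsub>G\<^esub>"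
    by (rule monoid.l_one[OF group.is_monoid[OF group] one])
  interpret e: affine_automorphism l D "\<eta> \<one>\<^bsub>G\<^esub>" by (rule eta_automorphism[OF one])
  show "fst (\<eta> \<one>\<^bsub>G\<^esub>) b = b" if b: "b \<in> B"
  proof -
    have "fst (\<eta> \<one>\<^bsub>G\<^esub>) b \<in> B" using b e.lin_basis by blast
    moreover have "fst (\<eta> \<one>\<^bsub>G\<^esub>) (fst (\<eta> \<one>\<^bsub>G\<^esub>) b) = fst (\<eta> \<one>\<^bsub>G\<^esub>) b"
      using perm_mult[OF one one b] by (simp only: one_one)
    ultimately show ?thesis
      using inj_onD[OF bij_betw_imp_inj_on[OF e.bij_basis] _ _ b] by blast
  qed
  have "snd (\<eta> \<one>\<^bsub>G\<^esub> \<otimes>\<^bsub>BA_aut l D\<^esub> \<eta> \<one>\<^bsub>G\<^esub>) x0 = snd (\<eta> \<one>\<^bsub>G\<^esub>) (snd (\<eta> \<one>\<^bsub>G\<^esub>) x0)"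
    using base_point by (simp add: BA_aut_def Let_def case_prod_unfold compose_def)
  then have "snd (\<eta> \<one>\<^bsub>G\<^esub>) (snd (\<eta> \<one>\<^bsub>G\<^esub>) x0) = snd (\<eta> \<one>\<^bsub>G\<^esub>) x0"
    by (simp only: eta_mult[OF one one, symmetric] one_one)
  then have "snd (\<eta> \<one>\<^bsub>G\<^esub>) x0 = x0"
    by (rule inj_onD[OF e.map_inj _ e.map_closed[OF base_point] base_point])
  then have "translation x0 (\<eta> \<one>\<^bsub>G\<^esub>) = \<zero>\<^bsub>F\<^esub>"
    using base_point by (intro translation_eqI) (simp_all add: act_zero)
  then show "shift_coord l D x0 (\<eta> \<one>\<^bsub>G\<^esub>) b = \<zero>\<^bsub>Zl l\<^esub>" if "b \<in> B"
    using that by (simp add: shift_coord_eq coords_zero)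
qed

lemma continuous_data:
  "continuous_map T (prod_topology (discrete_topology UNIV) (product_topology (\<lambda>_. ba_space D) X))
     (\<lambda>g. (restrict (fst (\<eta> g)) B, snd (\<eta> g)))"
proof -
  let ?P = "prod_topology (discrete_topology UNIV) (product_topology (\<lambda>_. ba_space D) X)"
  let ?d = "\<lambda>(\<phi>, \<chi>). (restrict \<phi> B, \<chi>)"
  have "continuous_map T (BA_aut_top l D) \<eta>" using BAR by (simp add: l_BAR_def)
  moreover have "continuous_map (BA_aut_top l D) ?P (id \<circ> ?d)"
    unfolding BA_aut_top_def by (rule continuous_map_pullback) (rule continuous_map_id)
  ultimately have "continuous_map T ?P ((id \<circ> ?d) \<circ> \<eta>)" by (rule continuous_map_compose)
  then show ?thesis by (simp add: comp_def case_prod_unfold)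
qed

lemma perm_locally_constant: "b \<in> B \<Longrightarrow> locally_constant T (\<lambda>g. fst (\<eta> g) b)"
proof -
  assume b: "b \<in> B"
  have "continuous_map T (discrete_topology UNIV) (\<lambda>g. restrict (fst (\<eta> g)) B)"
    using continuous_data by (auto simp: continuous_map_pairwise comp_def)
  then have "locally_constant T (\<lambda>g. restrict (fst (\<eta> g)) B)"
    by (rule continuous_map_discrete_imp_locally_constant)
  from locally_constant_combine[OF this this, of "\<lambda>\<phi> _. \<phi> b"] b show ?thesis by simp
qed

text \<open>
  The translation part depends continuously on \<open>\<eta>(g) x0\<close> through the homeomorphism \<open>F \<cong> X\<close>, and a
  residue modulo \<open>l\<^sup>s\<close> is locally constant on \<open>\<int>\<^sub>l\<close>.
\<close>

lemma shift_locally_constant: "b \<in> B \<Longrightarrow> locally_constant T (\<lambda>g. shift_coord l D x0 (\<eta> g) b s)"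
proof -
  assume b: "b \<in> B"
  have "continuous_map T (product_topology (\<lambda>_. ba_space D) X) (\<lambda>g. snd (\<eta> g))"
    using continuous_data by (auto simp: continuous_map_pairwise comp_def)
  from continuous_map_compose[OF this continuous_map_product_projection[OF base_point]]
  have cont: "continuous_map T (ba_space D) (\<lambda>g. snd (\<eta> g) x0)" by (simp add: comp_def)
  obtain k where k: "homeomorphic_maps (lattice_top l F B) (ba_space D) (\<lambda>f. ba_act D f x0) k"
    using homeo[OF base_point] by (auto simp: homeomorphic_map_maps)
  have "continuous_map T (lattice_top l F B) (\<lambda>g. k (snd (\<eta> g) x0))"
    using continuous_map_compose[OF cont, of "lattice_top l F B" k] k
    by (simp add: homeomorphic_maps_def comp_def)
  moreover have "continuous_map (lattice_top l F B) (product_topology (\<lambda>_. Zl_top l) B) (id \<circ> crd)"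
    unfolding lattice_top_def by (rule continuous_map_pullback) (rule continuous_map_id)
  ultimately have "continuous_map T (product_topology (\<lambda>_. Zl_top l) B) ((id \<circ> crd) \<circ> (\<lambda>g. k (snd (\<eta> g) x0)))"
    by (rule continuous_map_compose)
  from continuous_map_compose[OF this continuous_map_product_projection[OF b]]
  have "continuous_map T (Zl_top l) (\<lambda>g. crd (k (snd (\<eta> g) x0)) b)" by (simp add: comp_def)
  then have "continuous_map T (product_topology (\<lambda>_. discrete_topology UNIV) UNIV) (\<lambda>g. crd (k (snd (\<eta> g) x0)) b)"
    unfolding Zl_top_def continuous_map_in_subtopology by blast
  from continuous_map_compose[OF this continuous_map_product_projection[of s]]
  have "continuous_map T (discrete_topology UNIV) (\<lambda>g. crd (k (snd (\<eta> g) x0)) b s)" by (simp add: comp_def)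
  then have "locally_constant T (\<lambda>g. crd (k (snd (\<eta> g) x0)) b s)"
    by (rule continuous_map_discrete_imp_locally_constant)
  moreover have "crd (k (snd (\<eta> g) x0)) b s = shift_coord l D x0 (\<eta> g) b s" if g: "g \<in> carrier G" for g
  proof -
    interpret affine_automorphism l D "\<eta> g" by (rule eta_automorphism[OF g])
    have "k (snd (\<eta> g) x0) = translation x0 (\<eta> g)"
      using k translation[OF base_point] topspace_lattice_top by (simp add: homeomorphic_maps_def)
    then show ?thesis by (simp add: shift_coord_eq)
  qed
  ultimately show ?thesis
    by (elim locally_constant_cong) (simp add: topspace_T)
qed

end

section \<open>Characters of monomials\<close>

lemma Zl_residue:
  assumes "c \<in> carrier (Zl l)" "s \<le> t"
  shows "c t mod int l ^ s = c s"
  using assms(2)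
proof (induction t rule: dec_induct)
  case base
  show ?case using assms(1) by (simp add: Zl_ops_simps)
next
  case (step t)
  have "c (Suc t) mod int l ^ s = c (Suc t) mod int l ^ t mod int l ^ s"
    by (rule mod_mod_cancel[symmetric]) (simp add: le_imp_power_dvd step.hyps(1))
  then show ?case using assms(1) step.IH by (simp add: Zl_ops_simps)
qed

lemma locally_constant_prod:
  assumes "\<And>i. i \<in> I \<Longrightarrow> locally_constant T (f i)"
  shows "locally_constant T (\<lambda>x. \<Prod>i\<in>I. f i x)"
  using assms
proof (induction I rule: infinite_finite_induct)
  case (insert i I)
  then have "locally_constant T (\<lambda>x. f i x * (\<Prod>i\<in>I. f i x))"
    by (intro locally_constant_combine[where h = "(*)"]) auto
  then show ?case using insert.hyps by simp
qed (simp_all add: locally_constant_const)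

locale roots_of_unity =
  fixes l :: nat and \<zeta> :: "nat \<Rightarrow> 'k::field"
  assumes l_pos: "l > 0" and roots: "compatible_roots l \<zeta>"
begin

lemma root_order: "\<zeta> s ^ (l ^ s) = 1" "0 < j \<Longrightarrow> j < l ^ s \<Longrightarrow> \<zeta> s ^ j \<noteq> 1" "\<zeta> (Suc s) ^ l = \<zeta> s"
  using roots by (auto simp: compatible_roots_def)

lemma root_nonzero: "\<zeta> s \<noteq> 0"
  using root_order(1)[of s] l_pos by (auto simp: power_0_left)

lemma root_tower: "\<zeta> (s + k) ^ (l ^ k) = \<zeta> s"
proof (induction k)
  case (Suc k)
  have "\<zeta> (s + Suc k) ^ (l ^ Suc k) = (\<zeta> (Suc (s + k)) ^ l) ^ (l ^ k)"
    by (simp add: power_mult)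
  then show ?case using Suc by (simp add: root_order(3))
qed simp

lemma root_powi_multiple: "\<zeta> s powi (int l ^ s * k) = 1"
proof -
  have "\<zeta> s powi (int (l ^ s) * k) = (\<zeta> s powi int (l ^ s)) powi k" by (rule power_int_mult)
  also have "\<zeta> s powi int (l ^ s) = 1" using root_order(1)[of s] by (simp only: power_int_of_nat)
  finally show ?thesis by simp
qed

lemma root_powi_mod: "\<zeta> s powi (a mod int l ^ s) = \<zeta> s powi a"
proof -
  have "\<zeta> s powi a = \<zeta> s powi (int l ^ s * (a div int l ^ s) + a mod int l ^ s)" by simp
  also have "\<dots> = \<zeta> s powi (int l ^ s * (a div int l ^ s)) * \<zeta> s powi (a mod int l ^ s)"
    by (rule power_int_add) (simp add: root_nonzero)
  finally show ?thesis by (simp add: root_powi_multiple)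
qed

lemma root_powi_eq_1: "\<zeta> s powi a = 1 \<longleftrightarrow> int l ^ s dvd a"
proof
  assume "\<zeta> s powi a = 1"
  define r where "r = nat (a mod int l ^ s)"
  have r: "int r = a mod int l ^ s" "r < l ^ s"
    using l_pos by (simp_all add: r_def nat_less_iff)
  have "\<zeta> s ^ r = \<zeta> s powi (a mod int l ^ s)" by (simp only: r(1)[symmetric] power_int_of_nat)
  then have "\<zeta> s ^ r = 1" using \<open>\<zeta> s powi a = 1\<close> by (simp add: root_powi_mod)
  then have "r = 0" using root_order(2)[of r s] r(2) by auto
  then show "int l ^ s dvd a" using r(1) by (simp add: dvd_eq_mod_eq_0)
next
  assume "int l ^ s dvd a"
  then show "\<zeta> s powi a = 1" by (auto simp: dvd_def root_powi_multiple)
qed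

text \<open>
  \<open>root_pow\<close> uses the least possible denominator of \<open>q\<close>; by compatibility of the roots of unity
  and of the residues of \<open>c\<close> any larger denominator gives the same value.
\<close>

lemma root_pow_eq:
  assumes c: "c \<in> carrier (Zl l)" and q: "of_nat (l ^ s) * q = of_int n"
  shows "root_pow l \<zeta> c q = \<zeta> s powi (c s * n)"
proof -
  define t where "t = (LEAST s. of_nat (l ^ s) * q \<in> \<int>)"
  have int_s: "of_nat (l ^ s) * q \<in> \<int>" using q by simp
  have t: "of_nat (l ^ t) * q \<in> \<int>" "t \<le> s"
    unfolding t_def using LeastI[of "\<lambda>s. of_nat (l ^ s) * q \<in> \<int>", OF int_s]
      Least_le[of "\<lambda>s. of_nat (l ^ s) * q \<in> \<int>", OF int_s] by simp_all
  from t(1) obtain m where m: "of_nat (l ^ t) * q = of_int m" by (rule Ints_cases)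
  define k where "k = s - t"
  have s: "s = t + k" using t(2) by (simp add: k_def)
  have "of_int n = of_nat (l ^ k) * (of_nat (l ^ t) * q)"
    unfolding q[symmetric] s by (simp add: power_add mult_ac)
  also have "\<dots> = of_int (int l ^ k * m)" unfolding m by simp
  finally have n: "n = int l ^ k * m" by (simp only: of_int_eq_iff)
  have "\<zeta> s powi (c s * n) = \<zeta> s powi (int (l ^ k) * (c s * m))" by (simp add: n mult_ac)
  also have "\<dots> = (\<zeta> s powi int (l ^ k)) powi (c s * m)" by (rule power_int_mult)
  also have "\<zeta> s powi int (l ^ k) = \<zeta> t" using root_tower[of t k] by (simp only: power_int_of_nat s)
  also have "\<zeta> t powi (c s * m) = \<zeta> t powi ((c s mod int l ^ t) * m)"
    by (subst (1 2) root_powi_mod[symmetric]) (simp only: mod_mult_left_eq)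
  also have "\<dots> = \<zeta> t powi (c t * m)" by (simp only: Zl_residue[OF c t(2)])
  finally show ?thesis
    unfolding root_pow_def Let_def t_def[symmetric] m by simp
qed

lemma root_pow_add_exponent:
  assumes "c \<in> carrier (Zl l)" "of_nat (l ^ s) * q \<in> \<int>" "of_nat (l ^ s') * q' \<in> \<int>"
  shows "root_pow l \<zeta> c (q + q') = root_pow l \<zeta> c q * root_pow l \<zeta> c q'"
proof -
  let ?t = "s + s'"
  obtain n where n1: "of_nat (l ^ ?t) * q = of_int n"
    using frac_mono[OF assms(2) le_add1] by (rule Ints_cases)
  obtain n' where n2: "of_nat (l ^ ?t) * q' = of_int n'"
    using frac_mono[OF assms(3) le_add2] by (rule Ints_cases)
  note n = n1 n2
  then have "of_nat (l ^ ?t) * (q + q') = of_int (n + n')" by (simp add: distrib_left)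
  from root_pow_eq[OF assms(1) this] root_pow_eq[OF assms(1) n(1)] root_pow_eq[OF assms(1) n(2)]
  show ?thesis by (simp add: distrib_left power_int_add root_nonzero)
qed

lemma root_pow_add_coeff:
  assumes "c \<in> carrier (Zl l)" "c' \<in> carrier (Zl l)" "of_nat (l ^ s) * q \<in> \<int>"
  shows "root_pow l \<zeta> (c \<oplus>\<^bsub>Zl l\<^esub> c') q = root_pow l \<zeta> c q * root_pow l \<zeta> c' q"
proof -
  interpret cring "Zl l" by (rule cring_Zl[OF l_pos])
  obtain n where n: "of_nat (l ^ s) * q = of_int n" using assms(3) by (rule Ints_cases)
  have "root_pow l \<zeta> (c \<oplus>\<^bsub>Zl l\<^esub> c') q = \<zeta> s powi (((c s + c' s) mod int l ^ s) * n)"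
    by (subst root_pow_eq[OF a_closed[OF assms(1,2)] n]) (simp add: Zl_ops_simps)
  also have "\<dots> = \<zeta> s powi ((c s + c' s) * n)"
    by (subst (1 2) root_powi_mod[symmetric]) (simp only: mod_mult_left_eq)
  also have "\<dots> = root_pow l \<zeta> c q * root_pow l \<zeta> c' q"
    by (simp only: root_pow_eq[OF assms(1) n] root_pow_eq[OF assms(2) n] distrib_right)
       (simp add: power_int_add root_nonzero)
  finally show ?thesis .
qed

lemma root_pow_0 [simp]: "root_pow l \<zeta> c 0 = 1" "root_pow l \<zeta> (\<lambda>s. 0) q = 1"
  by (simp_all add: root_pow_def Let_def)

text \<open>
  The scalar by which \<open>c \<in> \<Prod>\<^sub>v \<int>\<^sub>l\<close> multiplies the monomial \<open>m\<close>.
\<close>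

definition mono_char :: "('v \<Rightarrow> nat \<Rightarrow> int) \<Rightarrow> ('v \<Rightarrow>\<^sub>0 rat) \<Rightarrow> 'k" where
  "mono_char c m = (\<Prod>v\<in>Poly_Mapping.keys m. root_pow l \<zeta> (c v) (Poly_Mapping.lookup m v))"

lemma mono_char_superset:
  assumes "finite W" "Poly_Mapping.keys m \<subseteq> W"
  shows "mono_char c m = (\<Prod>v\<in>W. root_pow l \<zeta> (c v) (Poly_Mapping.lookup m v))"
  unfolding mono_char_def
  by (rule prod.mono_neutral_left[OF assms]) (simp add: in_keys_iff)

lemma laurent_monosD:
  assumes "m \<in> laurent_monos l V"
  shows "Poly_Mapping.keys m \<subseteq> V" "\<exists>s. of_nat (l ^ s) * Poly_Mapping.lookup m v \<in> \<int>"
proof -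
  show "Poly_Mapping.keys m \<subseteq> V" using assms by (auto simp: laurent_monos_def)
  show "\<exists>s. of_nat (l ^ s) * Poly_Mapping.lookup m v \<in> \<int>"
  proof (cases "v \<in> Poly_Mapping.keys m")
    case True
    then show ?thesis using assms by (simp add: laurent_monos_def)
  qed (simp add: in_keys_iff)
qed

lemma mono_char_add:
  assumes "m \<in> laurent_monos l V" "m' \<in> laurent_monos l V" "\<And>v. v \<in> V \<Longrightarrow> c v \<in> carrier (Zl l)"
  shows "mono_char c (m + m') = mono_char c m * mono_char c m'"
proof -
  let ?W = "Poly_Mapping.keys m \<union> Poly_Mapping.keys m'"
  have "mono_char c (m + m') = (\<Prod>v\<in>?W. root_pow l \<zeta> (c v) (Poly_Mapping.lookup (m + m') v))"
    by (rule mono_char_superset) (simp_all add: keys_add)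
  also have "\<dots> = (\<Prod>v\<in>?W. root_pow l \<zeta> (c v) (Poly_Mapping.lookup m v) *
      root_pow l \<zeta> (c v) (Poly_Mapping.lookup m' v))"
  proof (rule prod.cong[OF refl])
    fix v assume "v \<in> ?W"
    then have v: "c v \<in> carrier (Zl l)" using laurent_monosD(1) assms by blast
    obtain s s' where "of_nat (l ^ s) * Poly_Mapping.lookup m v \<in> \<int>"
        "of_nat (l ^ s') * Poly_Mapping.lookup m' v \<in> \<int>"
      using laurent_monosD(2)[OF assms(1), of v] laurent_monosD(2)[OF assms(2), of v] by blast
    from root_pow_add_exponent[OF v this]
    show "root_pow l \<zeta> (c v) (Poly_Mapping.lookup (m + m') v) =
        root_pow l \<zeta> (c v) (Poly_Mapping.lookup m v) * root_pow l \<zeta> (c v) (Poly_Mapping.lookup m' v)"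
      by (simp only: lookup_add)
  qed
  also have "\<dots> = mono_char c m * mono_char c m'"
    using mono_char_superset[of ?W m c] mono_char_superset[of ?W m' c] by (simp add: prod.distrib)
  finally show ?thesis .
qed

lemma laurent_act_single_char:
  "laurent_act l \<zeta> \<sigma> c (Poly_Mapping.single m a) =
     Poly_Mapping.single (rename_mono \<sigma> m) (a * mono_char (\<lambda>v. c (\<sigma> v)) m)"
  by (simp add: mono_char_def)

section \<open>Monomial actions on Laurent rings\<close>

lemma laurent_act_mult:
  assumes p: "p \<in> laurent_ring l V" and q: "q \<in> laurent_ring l V"
    and c: "\<And>v. v \<in> V \<Longrightarrow> c (\<sigma> v) \<in> carrier (Zl l)"
  shows "laurent_act l \<zeta> \<sigma> c (p * q) = laurent_act l \<zeta> \<sigma> c p * laurent_act l \<zeta> \<sigma> c q"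
proof -
  let ?L = "laurent_act l \<zeta> \<sigma> c"
  let ?S = "\<lambda>p. \<Sum>m\<in>Poly_Mapping.keys p. Poly_Mapping.single m (Poly_Mapping.lookup p m)"
  have "?L (?S p * ?S q) = (\<Sum>m\<in>Poly_Mapping.keys p. \<Sum>m'\<in>Poly_Mapping.keys q.
      ?L (Poly_Mapping.single (m + m') (Poly_Mapping.lookup p m * Poly_Mapping.lookup q m')))"
    by (simp only: sum_product laurent_act_sum mult_single)
  also have "\<dots> = (\<Sum>m\<in>Poly_Mapping.keys p. \<Sum>m'\<in>Poly_Mapping.keys q.
      ?L (Poly_Mapping.single m (Poly_Mapping.lookup p m)) * ?L (Poly_Mapping.single m' (Poly_Mapping.lookup q m')))"
  proof (intro sum.cong refl)
    fix m m' assume "m \<in> Poly_Mapping.keys p" "m' \<in> Poly_Mapping.keys q"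
    then have "m \<in> laurent_monos l V" "m' \<in> laurent_monos l V"
      using p q unfolding laurent_ring_altdef by blast+
    from mono_char_add[OF this, of "\<lambda>v. c (\<sigma> v)"] c
    have char: "mono_char (\<lambda>v. c (\<sigma> v)) (m + m') = mono_char (\<lambda>v. c (\<sigma> v)) m * mono_char (\<lambda>v. c (\<sigma> v)) m'"
      by blast
    show "?L (Poly_Mapping.single (m + m') (Poly_Mapping.lookup p m * Poly_Mapping.lookup q m')) =
        ?L (Poly_Mapping.single m (Poly_Mapping.lookup p m)) * ?L (Poly_Mapping.single m' (Poly_Mapping.lookup q m'))"
      by (simp only: laurent_act_single_char char mult_single rename_mono_add) (simp add: mult_ac)
  qed
  also have "\<dots> = ?L (?S p) * ?L (?S q)" by (simp only: sum_product laurent_act_sum)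
  finally show ?thesis by (simp only: poly_mapping_sum_single)
qed

lemma lookup_rename_mono_inj_on:
  assumes "inj_on \<sigma> V" "Poly_Mapping.keys m \<subseteq> V" "v \<in> V"
  shows "Poly_Mapping.lookup (rename_mono \<sigma> m) (\<sigma> v) = Poly_Mapping.lookup m v"
proof -
  have "Poly_Mapping.lookup (rename_mono \<sigma> m) (\<sigma> v) =
      (\<Sum>u\<in>Poly_Mapping.keys m. if u = v then Poly_Mapping.lookup m u else 0)"
    unfolding rename_mono_def lookup_sum
  proof (rule sum.cong[OF refl])
    fix u assume "u \<in> Poly_Mapping.keys m"
    then have "\<sigma> u = \<sigma> v \<longleftrightarrow> u = v" using assms inj_on_eq_iff[OF assms(1)] by blast
    then show "Poly_Mapping.lookup (Poly_Mapping.single (\<sigma> u) (Poly_Mapping.lookup m u)) (\<sigma> v) =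
        (if u = v then Poly_Mapping.lookup m u else 0)" by (simp add: lookup_single when_def)
  qed
  then show ?thesis by (simp add: in_keys_iff)
qed

lemma keys_rename_mono_inj_on:
  assumes "inj_on \<sigma> V" "Poly_Mapping.keys m \<subseteq> V"
  shows "Poly_Mapping.keys (rename_mono \<sigma> m) = \<sigma> ` Poly_Mapping.keys m"
proof
  show "Poly_Mapping.keys (rename_mono \<sigma> m) \<subseteq> \<sigma> ` Poly_Mapping.keys m"
    unfolding rename_mono_def by (rule order_trans[OF keys_sum]) (auto split: if_splits)
  show "\<sigma> ` Poly_Mapping.keys m \<subseteq> Poly_Mapping.keys (rename_mono \<sigma> m)"
  proof (rule image_subsetI)
    fix v assume v: "v \<in> Poly_Mapping.keys m"
    then have "Poly_Mapping.lookup (rename_mono \<sigma> m) (\<sigma> v) = Poly_Mapping.lookup m v"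
      using assms(2) by (intro lookup_rename_mono_inj_on[OF assms]) blast
    then show "\<sigma> v \<in> Poly_Mapping.keys (rename_mono \<sigma> m)" using v by (simp add: in_keys_iff)
  qed
qed

lemma rename_mono_cong:
  "(\<And>v. v \<in> Poly_Mapping.keys m \<Longrightarrow> \<sigma> v = \<tau> v) \<Longrightarrow> rename_mono \<sigma> m = rename_mono \<tau> m"
  unfolding rename_mono_def by (intro sum.cong) auto

lemma rename_mono_in_laurent_monos:
  assumes "bij_betw \<sigma> V V" and m: "m \<in> laurent_monos l V"
  shows "rename_mono \<sigma> m \<in> laurent_monos l V"
proof -
  have inj: "inj_on \<sigma> V" and im: "\<sigma> ` V = V" using assms(1) by (auto simp: bij_betw_def)
  note K = laurent_monosD(1)[OF m]
  have "\<sigma> v \<in> V \<and> (\<exists>s. of_nat (l ^ s) * Poly_Mapping.lookup (rename_mono \<sigma> m) (\<sigma> v) \<in> \<int>)"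
    if v: "v \<in> Poly_Mapping.keys m" for v
  proof -
    have "v \<in> V" using v K by blast
    then have "\<sigma> v \<in> V" using im by blast
    then show ?thesis
      using lookup_rename_mono_inj_on[OF inj K \<open>v \<in> V\<close>] laurent_monosD(2)[OF m, of v] by simp
  qed
  then show ?thesis
    unfolding laurent_monos_def mem_Collect_eq keys_rename_mono_inj_on[OF inj K] by blast
qed

lemma unital_subring_laurent_ring: "unital_subring (laurent_ring l V :: (('v \<Rightarrow>\<^sub>0 rat) \<Rightarrow>\<^sub>0 'k) set)"
proof -
  have "a - b \<in> laurent_ring l V" "a + b \<in> laurent_ring l V"
    if "a \<in> laurent_ring l V" "b \<in> laurent_ring l V" for a b :: "('v \<Rightarrow>\<^sub>0 rat) \<Rightarrow>\<^sub>0 'k"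
    using that keys_add[of a b] keys_add[of a "- b"] unfolding laurent_ring_altdef by auto
  moreover have "(1 :: ('v \<Rightarrow>\<^sub>0 rat) \<Rightarrow>\<^sub>0 'k) \<in> laurent_ring l V"
    unfolding single_one[symmetric] by (rule single_in_laurent_ring[OF laurent_monos_0])
  ultimately show ?thesis
    unfolding unital_subring_def using laurent_ring_mult laurent_ring_sum[of "{}"] by auto
qed

lemma laurent_act_in_laurent_ring:
  assumes "bij_betw \<sigma> V V" "p \<in> laurent_ring l V"
  shows "laurent_act l \<zeta> \<sigma> c p \<in> laurent_ring l V"
  unfolding laurent_act_def
  using assms(2)
  by (intro laurent_ring_sum single_in_laurent_ring rename_mono_in_laurent_monos[OF assms(1)])
     (auto simp: laurent_ring_altdef)

text \<open>
  The multiplication in the semidirect product, under the cocycle condition on the translation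
  parts.  It is enough to compare both sides on monomials.
\<close>

lemma laurent_act_comp:
  assumes \<tau>: "bij_betw \<tau> V V" and p: "p \<in> laurent_ring l V"
    and perm: "\<And>v. v \<in> V \<Longrightarrow> \<rho> v = \<sigma> (\<tau> v)"
    and c: "\<And>v. v \<in> V \<Longrightarrow> c (\<sigma> v) \<in> carrier (Zl l)" and d: "\<And>v. v \<in> V \<Longrightarrow> d v \<in> carrier (Zl l)"
    and e: "\<And>v. v \<in> V \<Longrightarrow> e (\<rho> v) = c (\<sigma> (\<tau> v)) \<oplus>\<^bsub>Zl l\<^esub> d (\<tau> v)"
  shows "laurent_act l \<zeta> \<rho> e p = laurent_act l \<zeta> \<sigma> c (laurent_act l \<zeta> \<tau> d p)"
proof -
  have inj: "inj_on \<tau> V" and im: "\<tau> ` V = V" using \<tau> by (auto simp: bij_betw_def)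
  have single: "laurent_act l \<zeta> \<rho> e (Poly_Mapping.single m a) =
      laurent_act l \<zeta> \<sigma> c (laurent_act l \<zeta> \<tau> d (Poly_Mapping.single m a))"
    if m: "m \<in> laurent_monos l V" for m a
  proof -
    note K = laurent_monosD(1)[OF m]
    have KV: "v \<in> V" "\<tau> v \<in> V" if "v \<in> Poly_Mapping.keys m" for v using that K im by blast+
    have "rename_mono \<rho> m = rename_mono (\<sigma> \<circ> \<tau>) m"
      by (rule rename_mono_cong) (simp add: perm KV)
    then have ren: "rename_mono \<rho> m = rename_mono \<sigma> (rename_mono \<tau> m)"
      by (simp only: rename_mono_rename_mono)
    have "mono_char (\<lambda>v. c (\<sigma> v)) (rename_mono \<tau> m) =
        (\<Prod>v\<in>Poly_Mapping.keys m. root_pow l \<zeta> (c (\<sigma> (\<tau> v))) (Poly_Mapping.lookup (rename_mono \<tau> m) (\<tau> v)))"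
      unfolding mono_char_def keys_rename_mono_inj_on[OF inj K]
      by (subst prod.reindex[OF inj_on_subset[OF inj K]]) (simp add: comp_def)
    also have "\<dots> = (\<Prod>v\<in>Poly_Mapping.keys m. root_pow l \<zeta> (c (\<sigma> (\<tau> v))) (Poly_Mapping.lookup m v))"
      by (intro prod.cong refl) (simp only: lookup_rename_mono_inj_on[OF inj K KV(1)])
    finally have "mono_char (\<lambda>v. d (\<tau> v)) m * mono_char (\<lambda>v. c (\<sigma> v)) (rename_mono \<tau> m) =
        (\<Prod>v\<in>Poly_Mapping.keys m. root_pow l \<zeta> (c (\<sigma> (\<tau> v))) (Poly_Mapping.lookup m v) *
           root_pow l \<zeta> (d (\<tau> v)) (Poly_Mapping.lookup m v))"
      by (simp only: prod.distrib mono_char_def[of "\<lambda>v. d (\<tau> v)"] mult.commute)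
    also have "\<dots> = mono_char (\<lambda>v. e (\<rho> v)) m"
      unfolding mono_char_def
    proof (rule prod.cong[OF refl])
      fix v assume v: "v \<in> Poly_Mapping.keys m"
      obtain s where s: "of_nat (l ^ s) * Poly_Mapping.lookup m v \<in> \<int>"
        using laurent_monosD(2)[OF m] by blast
      show "root_pow l \<zeta> (c (\<sigma> (\<tau> v))) (Poly_Mapping.lookup m v) * root_pow l \<zeta> (d (\<tau> v)) (Poly_Mapping.lookup m v) =
          root_pow l \<zeta> (e (\<rho> v)) (Poly_Mapping.lookup m v)"
        unfolding e[OF KV(1)[OF v]]
        by (rule root_pow_add_coeff[OF c[OF KV(2)[OF v]] d[OF KV(2)[OF v]] s, symmetric])
    qed
    finally show ?thesis
      by (simp only: laurent_act_single_char ren mult.assoc)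
  qed
  let ?S = "\<Sum>m\<in>Poly_Mapping.keys p. Poly_Mapping.single m (Poly_Mapping.lookup p m)"
  have "laurent_act l \<zeta> \<rho> e ?S = laurent_act l \<zeta> \<sigma> c (laurent_act l \<zeta> \<tau> d ?S)"
    unfolding laurent_act_sum
    by (rule sum.cong[OF refl], rule single) (use p in \<open>auto simp: laurent_ring_altdef\<close>)
  then show ?thesis by (simp only: poly_mapping_sum_single)
qed

lemma laurent_act_ident:
  assumes p: "p \<in> laurent_ring l V" and "\<And>v. v \<in> V \<Longrightarrow> \<sigma> v = v" "\<And>v. v \<in> V \<Longrightarrow> c v = \<zero>\<^bsub>Zl l\<^esub>"
  shows "laurent_act l \<zeta> \<sigma> c p = p"
proof -
  have "laurent_act l \<zeta> \<sigma> c p = (\<Sum>m\<in>Poly_Mapping.keys p. Poly_Mapping.single m (Poly_Mapping.lookup p m))"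
    unfolding laurent_act_def
  proof (rule sum.cong[OF refl])
    fix m assume "m \<in> Poly_Mapping.keys p"
    then have "m \<in> laurent_monos l V" using p unfolding laurent_ring_altdef by blast
    then have V: "v \<in> V" if "v \<in> Poly_Mapping.keys m" for v using that laurent_monosD(1) by blast
    have "rename_mono \<sigma> m = rename_mono id m" by (rule rename_mono_cong) (simp add: assms(2) V)
    also have "\<dots> = m" by (simp add: rename_mono_def poly_mapping_sum_single)
    finally have "rename_mono \<sigma> m = m" .
    moreover have "root_pow l \<zeta> (c (\<sigma> v)) (Poly_Mapping.lookup m v) = 1" if "v \<in> Poly_Mapping.keys m" for v
      by (simp add: assms(2,3) V[OF that] Zl_ops_simps)
    ultimately show "Poly_Mapping.single (rename_mono \<sigma> m) (Poly_Mapping.lookup p m *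
          (\<Prod>v\<in>Poly_Mapping.keys m. root_pow l \<zeta> (c (\<sigma> v)) (Poly_Mapping.lookup m v))) =
        Poly_Mapping.single m (Poly_Mapping.lookup p m)" by simp
  qed
  then show ?thesis by (simp only: poly_mapping_sum_single)
qed

theorem acts_on_ring_laurent_act:
  fixes V :: "'v set"
  assumes G: "group G"
    and bij: "\<And>g. g \<in> carrier G \<Longrightarrow> bij_betw (\<sigma> g) V V"
    and c: "\<And>g v. g \<in> carrier G \<Longrightarrow> v \<in> V \<Longrightarrow> c g v \<in> carrier (Zl l)"
    and one: "\<And>v. v \<in> V \<Longrightarrow> \<sigma> \<one>\<^bsub>G\<^esub> v = v" "\<And>v. v \<in> V \<Longrightarrow> c \<one>\<^bsub>G\<^esub> v = \<zero>\<^bsub>Zl l\<^esub>"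
    and mult: "\<And>g h v. g \<in> carrier G \<Longrightarrow> h \<in> carrier G \<Longrightarrow> v \<in> V \<Longrightarrow> \<sigma> (g \<otimes>\<^bsub>G\<^esub> h) v = \<sigma> g (\<sigma> h v)"
    "\<And>g h v. g \<in> carrier G \<Longrightarrow> h \<in> carrier G \<Longrightarrow> v \<in> V \<Longrightarrow>
        c (g \<otimes>\<^bsub>G\<^esub> h) (\<sigma> g (\<sigma> h v)) = c g (\<sigma> g (\<sigma> h v)) \<oplus>\<^bsub>Zl l\<^esub> c h (\<sigma> h v)"
  shows "acts_on_ring G (laurent_ring l V) (\<lambda>g. laurent_act l \<zeta> (\<sigma> g) (c g))"
  unfolding acts_on_ring_def
proof (intro conjI ballI)
  have \<sigma>V: "\<sigma> g v \<in> V" if "g \<in> carrier G" "v \<in> V" for g v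
    using bij[OF that(1)] that(2) by (auto simp: bij_betw_def)
  fix g assume g: "g \<in> carrier G"
  have cg: "c g (\<sigma> g v) \<in> carrier (Zl l)" if "v \<in> V" for v using c \<sigma>V g that by blast
  show "laurent_act l \<zeta> (\<sigma> g) (c g) p \<in> laurent_ring l V" if "p \<in> laurent_ring l V" for p
    using laurent_act_in_laurent_ring[OF bij[OF g] that] .
  show "laurent_act l \<zeta> (\<sigma> g) (c g) 1 = 1"
    using laurent_act_single[of l \<zeta> "\<sigma> g" "c g" 0 1] by simp
  show "laurent_act l \<zeta> (\<sigma> g) (c g) (p + q) = laurent_act l \<zeta> (\<sigma> g) (c g) p + laurent_act l \<zeta> (\<sigma> g) (c g) q" for p q
    by (rule laurent_act_add)
  show "laurent_act l \<zeta> (\<sigma> g) (c g) (p * q) = laurent_act l \<zeta> (\<sigma> g) (c g) p * laurent_act l \<zeta> (\<sigma> g) (c g) q"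
    if "p \<in> laurent_ring l V" "q \<in> laurent_ring l V" for p q
    by (rule laurent_act_mult[OF that]) (rule cg)
  fix h and p :: "('v \<Rightarrow>\<^sub>0 rat) \<Rightarrow>\<^sub>0 'k" assume h: "h \<in> carrier G" and p: "p \<in> laurent_ring l V"
  show "laurent_act l \<zeta> (\<sigma> (g \<otimes>\<^bsub>G\<^esub> h)) (c (g \<otimes>\<^bsub>G\<^esub> h)) p =
      laurent_act l \<zeta> (\<sigma> g) (c g) (laurent_act l \<zeta> (\<sigma> h) (c h) p)"
    by (rule laurent_act_comp[OF bij[OF h] p]) (simp_all add: mult g h c cg)
next
  fix p :: "('v \<Rightarrow>\<^sub>0 rat) \<Rightarrow>\<^sub>0 'k" assume "p \<in> laurent_ring l V"
  then show "laurent_act l \<zeta> (\<sigma> \<one>\<^bsub>G\<^esub>) (c \<one>\<^bsub>G\<^esub>) p = p" by (rule laurent_act_ident) (simp_all add: one)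
qed

text \<open>
  The image of \<open>p\<close> depends only on the images of the finitely many variables in \<open>p\<close> and on finitely
  many residues of the translation part.
\<close>

lemma laurent_act_locally_constant:
  assumes p: "p \<in> laurent_ring l V"
    and \<sigma>V: "\<And>g v. g \<in> topspace T \<Longrightarrow> v \<in> V \<Longrightarrow> \<sigma> g v \<in> V"
    and \<sigma>: "\<And>v. v \<in> V \<Longrightarrow> locally_constant T (\<lambda>g. \<sigma> g v)"
    and c: "\<And>v s. v \<in> V \<Longrightarrow> locally_constant T (\<lambda>g. c g v s)"
  shows "locally_constant T (\<lambda>g. laurent_act l \<zeta> (\<sigma> g) (c g) p)"
  unfolding laurent_act_def
proof (rule locally_constant_sum)
  fix m assume "m \<in> Poly_Mapping.keys p"
  then have "m \<in> laurent_monos l V" using p unfolding laurent_ring_altdef by blast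
  then have V: "v \<in> V" if "v \<in> Poly_Mapping.keys m" for v using that laurent_monosD(1) by blast
  have ren: "locally_constant T (\<lambda>g. rename_mono (\<sigma> g) m)"
    unfolding rename_mono_def
  proof (rule locally_constant_sum)
    fix v assume "v \<in> Poly_Mapping.keys m"
    from locally_constant_combine[OF \<sigma>[OF V[OF this]] locally_constant_const]
    show "locally_constant T (\<lambda>g. Poly_Mapping.single (\<sigma> g v) (Poly_Mapping.lookup m v))" .
  qed
  have coeff: "locally_constant T (\<lambda>g. \<Prod>v\<in>Poly_Mapping.keys m. root_pow l \<zeta> (c g (\<sigma> g v)) (Poly_Mapping.lookup m v))"
  proof (rule locally_constant_prod)
    fix v assume "v \<in> Poly_Mapping.keys m"
    then have v: "v \<in> V" by (rule V)
    have "locally_constant T (\<lambda>g. c g (\<sigma> g v) s)" for s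
      unfolding locally_constant_def
    proof
      fix g assume g: "g \<in> topspace T"
      obtain W where W: "openin T W" "g \<in> W" "\<forall>h\<in>W. \<sigma> h v = \<sigma> g v"
        using locally_constantD[OF \<sigma>[OF v] g] by blast
      obtain W' where W': "openin T W'" "g \<in> W'" "\<forall>h\<in>W'. c h (\<sigma> g v) s = c g (\<sigma> g v) s"
        using locally_constantD[OF c[OF \<sigma>V[OF g v], of s] g] by blast
      have "c h (\<sigma> h v) s = c g (\<sigma> g v) s" if "h \<in> W \<inter> W'" for h
      proof -
        have "\<sigma> h v = \<sigma> g v" using W(3) that by blast
        then have "c h (\<sigma> h v) s = c h (\<sigma> g v) s" by (simp only:)
        also have "\<dots> = c g (\<sigma> g v) s" using W'(3) that by blast
        finally show ?thesis .
      qed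
      then show "\<exists>W. openin T W \<and> g \<in> W \<and> (\<forall>h\<in>W. c h (\<sigma> h v) s = c g (\<sigma> g v) s)"
        using W(1,2) W'(1,2) by (intro exI[of _ "W \<inter> W'"] conjI ballI openin_Int) blast+
    qed
    from locally_constant_combine[OF this locally_constant_const[of _ "()"],
        of "\<lambda>a _. \<zeta> (LEAST s. of_nat (l ^ s) * Poly_Mapping.lookup m v \<in> \<int>) powi
          (a * \<lfloor>of_nat (l ^ (LEAST s. of_nat (l ^ s) * Poly_Mapping.lookup m v \<in> \<int>)) * Poly_Mapping.lookup m v\<rfloor>)"]
    show "locally_constant T (\<lambda>g. root_pow l \<zeta> (c g (\<sigma> g v)) (Poly_Mapping.lookup m v))"
      unfolding root_pow_def Let_def .
  qed
  from locally_constant_combine[OF ren coeff, of "\<lambda>r a. Poly_Mapping.single r (Poly_Mapping.lookup p m * a)"]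
  show "locally_constant T (\<lambda>g. Poly_Mapping.single (rename_mono (\<sigma> g) m) (Poly_Mapping.lookup p m *
      (\<Prod>v\<in>Poly_Mapping.keys m. root_pow l \<zeta> (c g (\<sigma> g v)) (Poly_Mapping.lookup m v))))" .
qed

lemma powi_sum: "(\<Prod>b\<in>C. \<zeta> s powi f b) = \<zeta> s powi (\<Sum>b\<in>C. f b)"
  by (induction C rule: infinite_finite_induct) (simp_all add: power_int_add root_nonzero)

text \<open>
  A product of \<open>l\<^sup>s\<close>-th roots of the variables in a \<open>\<sigma>\<close>-stable set is preserved by \<open>\<sigma>\<close>, and
  \<open>c\<close> multiplies it by \<open>\<zeta>\<^sub>s\<close> to the power of the sum of its coordinates over that set.
\<close>

lemma eigenmonomial:
  fixes s :: nat
  assumes C: "finite C" "C \<subseteq> V" "inj_on \<sigma> V" "\<sigma> ` C = C" and c: "\<And>v. v \<in> C \<Longrightarrow> c v \<in> carrier (Zl l)"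
  defines "m \<equiv> \<Sum>v\<in>C. Poly_Mapping.single v (1 / of_nat (l ^ s))"
  shows "m \<in> laurent_monos l V"
    and "laurent_act l \<zeta> \<sigma> c (Poly_Mapping.single m 1) = Poly_Mapping.single m (\<zeta> s powi (\<Sum>v\<in>C. c v s))"
proof -
  let ?q = "1 / of_nat (l ^ s) :: rat"
  have q: "of_nat (l ^ s) * ?q = of_int 1" using l_pos by simp
  have lookup_m: "Poly_Mapping.lookup m v = (if v \<in> C then ?q else 0)" for v
    using C(1) by (simp add: m_def lookup_sum lookup_single when_def)
  have keys_m: "Poly_Mapping.keys m = C"
    using l_pos by (auto simp: in_keys_iff lookup_m split: if_splits)
  show "m \<in> laurent_monos l V"
    unfolding laurent_monos_def mem_Collect_eq keys_m
  proof (intro ballI conjI)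
    fix v assume v: "v \<in> C"
    show "v \<in> V" using C(2) v by blast
    show "\<exists>s. of_nat (l ^ s) * Poly_Mapping.lookup m v \<in> \<int>"
      by (rule exI[of _ s]) (simp only: lookup_m v q if_True Ints_of_int)
  qed
  have inj: "inj_on \<sigma> C" using C(2,3) by (rule inj_on_subset[rotated])
  have "rename_mono \<sigma> m = (\<Sum>v\<in>C. Poly_Mapping.single (\<sigma> v) ?q)"
    by (simp add: m_def rename_mono_sum)
  also have "\<dots> = (\<Sum>v\<in>\<sigma> ` C. Poly_Mapping.single v ?q)"
    by (simp add: sum.reindex[OF inj])
  finally have ren: "rename_mono \<sigma> m = m" by (simp only: C(4) m_def)
  have "mono_char (\<lambda>v. c (\<sigma> v)) m = (\<Prod>v\<in>C. \<zeta> s powi (c (\<sigma> v) s))"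
    unfolding mono_char_def keys_m
  proof (rule prod.cong[OF refl])
    fix v assume v: "v \<in> C"
    have "c (\<sigma> v) \<in> carrier (Zl l)" using c C(4) v by blast
    from root_pow_eq[OF this q]
    show "root_pow l \<zeta> (c (\<sigma> v)) (Poly_Mapping.lookup m v) = \<zeta> s powi (c (\<sigma> v) s)"
      by (simp add: lookup_m v)
  qed
  also have "\<dots> = (\<Prod>v\<in>\<sigma> ` C. \<zeta> s powi (c v s))" by (simp add: prod.reindex[OF inj])
  also have "\<dots> = \<zeta> s powi (\<Sum>v\<in>C. c v s)" by (simp only: C(4) powi_sum)
  finally show "laurent_act l \<zeta> \<sigma> c (Poly_Mapping.single m 1) = Poly_Mapping.single m (\<zeta> s powi (\<Sum>v\<in>C. c v s))"
    by (simp only: laurent_act_single_char ren mult_1)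
qed

end

lemma laurent_monos_uminus: "m \<in> laurent_monos l V \<Longrightarrow> - m \<in> laurent_monos l V"
  by (simp add: laurent_monos_def in_keys_iff)

lemma of_nat_mult_single:
  "of_nat n * Poly_Mapping.single (0 :: 'v \<Rightarrow>\<^sub>0 rat) (a :: 'k::field) = Poly_Mapping.single 0 (of_nat n * a)"
  by (induction n) (simp_all add: distrib_right single_add)

section \<open>Etaleness of EG\<close>

theorem proposition5p5:
  fixes l :: nat
    and \<zeta> :: "nat \<Rightarrow> 'k::alg_closed_field"
    and G :: "('g, 'm) monoid_scheme" and T :: "'g topology"
    and D :: "'g set + ('g \<Rightarrow> 'k mat) set \<Rightarrow> ('f, 'x) based_affine"
    and x0 :: "'g set + ('g \<Rightarrow> 'k mat) set \<Rightarrow> 'x"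
    and \<eta> :: "'g set + ('g \<Rightarrow> 'k mat) set \<Rightarrow> 'g \<Rightarrow> ('f \<Rightarrow> 'f) \<times> ('x \<Rightarrow> 'x)"
  assumes "prime l" and "l \<noteq> CHAR('k)"
    and "compatible_roots l \<zeta>"
    and "pro_l_group l G T" and "totally_torsion_free G T"
    and "EG_choice l \<zeta> G T D x0 \<eta>"
  shows "etale_G_scheme G T (EG_ring l G T D) (prod_act l \<zeta> D x0 \<eta>)"
proof -
  have l_pos: "l > 0" using assms(1) by (rule prime_gt_0_nat)
  interpret roots_of_unity l \<zeta> by unfold_locales (fact l_pos assms(3))+
  have top: "topological_group G T" and compact: "compact_space T"
    using assms(4) by (auto simp: pro_l_group_def profinite_group_def)
  then have G: "group G" and topspace_T: "topspace T = carrier G"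
    by (auto simp: topological_group_def)
  interpret group G by (rule G)
  let ?I = "EG_index G T :: ('g set + ('g \<Rightarrow> 'k mat) set) set"
  let ?V = "SIGMA i:?I. ba_basis (D i)"
  let ?A = "EG_ring l G T D :: ((('g set + ('g \<Rightarrow> 'k mat) set) \<times> 'f \<Rightarrow>\<^sub>0 rat) \<Rightarrow>\<^sub>0 'k) set"
  define \<sigma> where "\<sigma> g = (\<lambda>(i, b). (i, fst (\<eta> i g) b))" for g
  define c where "c g = (\<lambda>(i, b). shift_coord l (D i) (x0 i) (\<eta> i g) b)" for g
  let ?act = "\<lambda>g. laurent_act l \<zeta> (\<sigma> g) (c g)"
  have act: "prod_act l \<zeta> D x0 \<eta> = ?act"
    by (rule ext) (simp add: prod_act_def \<sigma>_def c_def)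
  have A: "?A = laurent_ring l ?V" by (simp add: EG_ring_def prod_ring_def)
  have BAR: "pointed_l_BAR l G T (D i) (\<eta> i) (x0 i)" if "i \<in> ?I" for i
    using assms(6) that by unfold_locales (auto simp: EG_choice_def l_pos G topspace_T)
  have bij: "bij_betw (\<sigma> g) ?V ?V" if g: "g \<in> carrier G" for g
  proof -
    have perm: "bij_betw (fst (\<eta> i g)) (ba_basis (D i)) (ba_basis (D i))" if "i \<in> ?I" for i
      by (rule pointed_l_BAR.perm_bij[OF BAR[OF that] g])
    have "inj_on (\<sigma> g) ?V"
    proof (rule inj_onI)
      fix v w assume vw: "v \<in> ?V" "w \<in> ?V" "\<sigma> g v = \<sigma> g w"
      obtain i b j d where v: "v = (i, b)" and w: "w = (j, d)" by fastforce
      have ij: "i = j" "fst (\<eta> i g) b = fst (\<eta> i g) d" using vw(3) by (auto simp: v w \<sigma>_def)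
      have mem: "i \<in> ?I" "b \<in> ba_basis (D i)" "d \<in> ba_basis (D i)" using vw(1,2) ij(1) by (auto simp: v w)
      show "v = w"
        using inj_onD[OF bij_betw_imp_inj_on[OF perm[OF mem(1)]] ij(2) mem(2,3)] ij(1) by (simp add: v w)
    qed
    moreover have "\<sigma> g ` ?V = ?V"
    proof
      show "\<sigma> g ` ?V \<subseteq> ?V"
        using bij_betw_imp_surj_on[OF perm] by (auto simp: \<sigma>_def)
      show "?V \<subseteq> \<sigma> g ` ?V"
      proof
        fix v assume "v \<in> ?V"
        then obtain i b where v: "v = (i, b)" "i \<in> ?I" "b \<in> ba_basis (D i)" by auto
        have "b \<in> fst (\<eta> i g) ` ba_basis (D i)"
          using bij_betw_imp_surj_on[OF perm[OF v(2)]] v(3) by simp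
        then obtain d where d: "b = fst (\<eta> i g) d" "d \<in> ba_basis (D i)" by (rule imageE)
        show "v \<in> \<sigma> g ` ?V"
          by (rule image_eqI[of _ _ "(i, d)"]) (simp_all add: v d \<sigma>_def)
      qed
    qed
    ultimately show ?thesis by (simp add: bij_betw_def)
  qed
  have \<sigma>V: "\<sigma> g v \<in> ?V" if "g \<in> carrier G" "v \<in> ?V" for g v
    using bij_betw_apply[OF bij[OF that(1)] that(2)] .
  have c_Zl: "c g v \<in> carrier (Zl l)" if g: "g \<in> carrier G" and v: "v \<in> ?V" for g v
  proof -
    obtain i b where v: "v = (i, b)" "i \<in> ?I" "b \<in> ba_basis (D i)" using v by auto
    show ?thesis using pointed_l_BAR.shift_Zl[OF BAR[OF v(2)] g v(3)] by (simp add: c_def v(1))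
  qed
  have acts: "acts_on_ring G ?A ?act"
    unfolding A
  proof (rule acts_on_ring_laurent_act[OF G bij c_Zl])
    fix v assume "v \<in> ?V"
    then obtain i b where v: "v = (i, b)" "i \<in> ?I" "b \<in> ba_basis (D i)" by auto
    interpret pointed_l_BAR l G T "D i" "\<eta> i" "x0 i" by (rule BAR[OF v(2)])
    show "\<sigma> \<one>\<^bsub>G\<^esub> v = v" using perm_one[OF v(3)] by (simp add: v(1) \<sigma>_def)
    show "c \<one>\<^bsub>G\<^esub> v = \<zero>\<^bsub>Zl l\<^esub>" using shift_one[OF v(3)] by (simp add: v(1) c_def)
    fix g h assume gh: "g \<in> carrier G" "h \<in> carrier G"
    show "\<sigma> (g \<otimes>\<^bsub>G\<^esub> h) v = \<sigma> g (\<sigma> h v)"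
      using perm_mult[OF gh v(3)] by (simp add: v(1) \<sigma>_def)
    show "c (g \<otimes>\<^bsub>G\<^esub> h) (\<sigma> g (\<sigma> h v)) = c g (\<sigma> g (\<sigma> h v)) \<oplus>\<^bsub>Zl l\<^esub> c h (\<sigma> h v)"
      using shift_mult[OF gh v(3)] by (simp add: v(1) \<sigma>_def c_def)
  qed
  have loc: "locally_constant T (\<lambda>g. ?act g p)" if p: "p \<in> ?A" for p
  proof (rule laurent_act_locally_constant[OF p[unfolded A]])
    show "\<sigma> g v \<in> ?V" if "g \<in> topspace T" "v \<in> ?V" for g v
      using \<sigma>V that by (simp only: topspace_T)
    fix v assume "v \<in> ?V"
    then obtain i b where v: "v = (i, b)" "i \<in> ?I" "b \<in> ba_basis (D i)" by auto
    interpret pointed_l_BAR l G T "D i" "\<eta> i" "x0 i" by (rule BAR[OF v(2)])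
    from locally_constant_combine[OF perm_locally_constant[OF v(3)] locally_constant_const[of _ "()"], of "\<lambda>b _. (i, b)"]
    show "locally_constant T (\<lambda>g. \<sigma> g v)" by (simp add: v(1) \<sigma>_def)
    show "locally_constant T (\<lambda>g. c g v s)" for s
      using shift_locally_constant[OF v(3), of s] by (simp add: v(1) c_def)
  qed
  have A_subring: "unital_subring ?A" unfolding A by (rule unital_subring_laurent_ring)
  have cont: "continuous_affine_G_scheme G T ?A ?act"
    unfolding continuous_affine_G_scheme_def
  proof (intro conjI A_subring acts)
    let ?P = "prod_topology T (discrete_topology ?A)"
    have "locally_constant ?P (\<lambda>(g, a). ?act g a)"
      unfolding locally_constant_def
    proof
      fix z assume "z \<in> topspace ?P"
      then obtain g a where z: "z = (g, a)" "g \<in> topspace T" "a \<in> ?A" by auto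
      obtain W where W: "openin T W" "g \<in> W" "\<forall>h\<in>W. ?act h a = ?act g a"
        using locally_constantD[OF loc[OF z(3)] z(2)] by blast
      have "openin ?P (W \<times> {a})" using W(1) z(3) by (simp add: openin_prod_Times_iff)
      moreover have "z \<in> W \<times> {a}" using W(2) z(1) by simp
      moreover have "\<forall>y\<in>W \<times> {a}. (case y of (h, b) \<Rightarrow> ?act h b) = (case z of (h, b) \<Rightarrow> ?act h b)"
      proof
        fix y assume "y \<in> W \<times> {a}"
        then obtain h where "y = (h, a)" "h \<in> W" by auto
        then show "(case y of (h, b) \<Rightarrow> ?act h b) = (case z of (h, b) \<Rightarrow> ?act h b)"
          using bspec[OF W(3), of h] by (simp only: z(1) prod.case)
      qed
      ultimately show "\<exists>W. openin ?P W \<and> z \<in> W \<and>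
          (\<forall>y\<in>W. (case y of (h, b) \<Rightarrow> ?act h b) = (case z of (h, b) \<Rightarrow> ?act h b))" by blast
    qed
    moreover have "(\<lambda>(g, a). ?act g a) ` topspace ?P \<subseteq> ?A"
      using acts_on_ringD(1)[OF acts] by (auto simp: topspace_T)
    ultimately show "continuous_map ?P (discrete_topology ?A) (\<lambda>(g, a). ?act g a)"
      by (simp only: continuous_map_discrete_iff_locally_constant)
  qed
  interpret continuous_action G T ?A ?act
    by unfold_locales (fact top compact cont)+
  have "CHAR('k) \<noteq> 1" by simp
  then have "\<not> CHAR('k) dvd l" using assms(1,2) by (auto simp: prime_nat_iff)
  then have l_nz: "of_nat l \<noteq> (0 :: 'k)" by (simp add: of_nat_eq_0_iff_char_dvd)
  show ?thesis
    unfolding etale_G_scheme_def act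
  proof (intro conjI allI impI cont)
    fix N assume N: "closed_normal_fin G T N"
    show "galois_cover (invariants ?A ?act (carrier G)) (invariants ?A ?act N) (G Mod N) (coset_act ?act)"
    proof (rule galois_cover_of_separating[OF N])
      show "\<exists>n. card (rcosets\<^bsub>G\<^esub> U) = l ^ n" if "U \<lhd> G" "openin T U" for U
        using assms(4) that by (simp add: pro_l_group_def)
      show "Poly_Mapping.single 0 (1 / of_nat l) \<in> ?A"
        unfolding A by (rule single_in_laurent_ring[OF laurent_monos_0])
      show "of_nat l * Poly_Mapping.single 0 (1 / of_nat l) = (1 :: (('g set + ('g \<Rightarrow> 'k mat) set) \<times> 'f \<Rightarrow>\<^sub>0 rat) \<Rightarrow>\<^sub>0 'k)"
        using l_nz by (simp add: of_nat_mult_single)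
      fix g assume g: "g \<in> carrier G - N"
      let ?i = "Inl N :: 'g set + ('g \<Rightarrow> 'k mat) set"
      have i: "?i \<in> ?I" unfolding EG_index_def by (rule InlI) (simp only: mem_Collect_eq N)
      interpret i: pointed_l_BAR l G T "D ?i" "\<eta> ?i" "x0 ?i" by (rule BAR[OF i])
      interpret a: affine_automorphism l "D ?i" "\<eta> ?i g" using g by (intro i.eta_automorphism) simp
      obtain N' where N': "N' \<subseteq> N" "principal G (D ?i) (\<eta> ?i) N'"
        using assms(6)[unfolded EG_choice_def, THEN conjunct2, THEN conjunct1, rule_format, OF N]
        by (elim exE conjE)
      have "snd (\<eta> ?i g) x \<noteq> x" if "x \<in> topspace (ba_space (D ?i))" for x
      proof
        assume "snd (\<eta> ?i g) x = x"
        then have "g \<in> {g \<in> carrier G. snd (\<eta> ?i g) x = x}" using g by simp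
        then have "g \<in> N'" using N'(2) that unfolding principal_def by simp
        then show False using N'(1) g by blast
      qed
      then have nofix: "\<not> (\<exists>x\<in>topspace (ba_space (D ?i)). snd (\<eta> ?i g) x = x)" by blast
      have "\<exists>C s. C \<subseteq> ba_basis (D ?i) \<and> fst (\<eta> ?i g) ` C = C \<and>
          \<not> int l ^ s dvd (\<Sum>b\<in>C. shift_coord l (D ?i) (x0 ?i) (\<eta> ?i g) b s)" (is "\<exists>C s. ?nz C s")
      proof (rule ccontr)
        assume none: "\<not> (\<exists>C s. ?nz C s)"
        have "\<exists>x\<in>topspace (ba_space (D ?i)). snd (\<eta> ?i g) x = x"
        proof (rule a.fixed_point[OF i.base_point])
          fix C s assume "C \<subseteq> ba_basis (D ?i)" "fst (\<eta> ?i g) ` C = C"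
          then show "int l ^ s dvd (\<Sum>b\<in>C. shift_coord l (D ?i) (x0 ?i) (\<eta> ?i g) b s)"
            using none by blast
        qed
        then show False using nofix by (rule notE[rotated])
      qed
      then obtain C s where C: "C \<subseteq> ba_basis (D ?i)" "fst (\<eta> ?i g) ` C = C"
          "\<not> int l ^ s dvd (\<Sum>b\<in>C. shift_coord l (D ?i) (x0 ?i) (\<eta> ?i g) b s)" by (elim exE conjE)
      let ?C = "Pair ?i ` C"
      define m where "m = (\<Sum>v\<in>?C. Poly_Mapping.single v (1 / of_nat (l ^ s) :: rat))"
      define \<omega> where "\<omega> = \<zeta> s powi (\<Sum>v\<in>?C. c g v s)"
      have CV: "?C \<subseteq> ?V" using C(1) i by auto
      have "\<sigma> g ` ?C = Pair ?i ` (fst (\<eta> ?i g) ` C)" by (simp add: image_image \<sigma>_def)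
      then have \<sigma>C: "\<sigma> g ` ?C = ?C" by (simp only: C(2))
      have finC: "finite ?C" using finite_subset[OF C(1) i.finite_B] by simp
      have cC: "c g v \<in> carrier (Zl l)" if "v \<in> ?C" for v using c_Zl[of g v] g CV that by blast
      have inj: "inj_on (\<sigma> g) ?V" using bij[of g] g by (simp add: bij_betw_def)
      have m_mono: "m \<in> laurent_monos l ?V"
        unfolding m_def by (rule eigenmonomial(1)[OF finC CV inj \<sigma>C cC])
      have eigen: "?act g (Poly_Mapping.single m 1) = Poly_Mapping.single m \<omega>"
        unfolding m_def \<omega>_def by (rule eigenmonomial(2)[OF finC CV inj \<sigma>C cC])
      have "(\<Sum>v\<in>?C. c g v s) = (\<Sum>b\<in>C. shift_coord l (D ?i) (x0 ?i) (\<eta> ?i g) b s)"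
        by (subst sum.reindex) (simp_all add: inj_on_def c_def)
      then have \<omega>: "\<omega> \<noteq> 1" using C(3) by (simp only: \<omega>_def root_powi_eq_1 not_False_eq_True)
      let ?u = "Poly_Mapping.single m (1 :: 'k)"
      \<comment> \<open>\<open>?a * h(?u) + ?b\<close> is \<open>(u\<inverse> h(u) - \<omega>) / (1 - \<omega>)\<close> for the unit \<open>u = ?u\<close>\<close>
      let ?a = "Poly_Mapping.single (- m) (1 / (1 - \<omega>))" and ?b = "Poly_Mapping.single 0 (- \<omega> / (1 - \<omega>))"
      have "- m \<in> laurent_monos l ?V" using m_mono by (rule laurent_monos_uminus)
      then have "?a \<in> ?A" "?u \<in> ?A" "?b \<in> ?A" using m_mono unfolding A by simp_all
      then have coef: "coefficient_function (\<lambda>h. ?a * ?act h ?u + ?b)"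
        by (intro coefficient_function_add coefficient_function_basic coefficient_function_const)
      have "?a * ?act \<one>\<^bsub>G\<^esub> ?u + ?b = Poly_Mapping.single 0 (1 / (1 - \<omega>) + - \<omega> / (1 - \<omega>))"
        using act_one[OF \<open>?u \<in> ?A\<close>] by (simp only: mult_single single_add) simp
      also have "1 / (1 - \<omega>) + - \<omega> / (1 - \<omega>) = 1" using \<omega> by (simp add: field_simps)
      finally have at_one: "?a * ?act \<one>\<^bsub>G\<^esub> ?u + ?b = 1" by simp
      have "?a * ?act g ?u + ?b = Poly_Mapping.single 0 (\<omega> / (1 - \<omega>) + - \<omega> / (1 - \<omega>))"
        unfolding eigen by (simp only: mult_single single_add) simp
      then have "?a * ?act g ?u + ?b = 0" by simp
      with coef at_one
      show "\<exists>\<phi>. coefficient_function \<phi> \<and> \<phi> \<one>\<^bsub>G\<^esub> = 1 \<and> \<phi> g = 0"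
        by (intro exI[of _ "\<lambda>h. ?a * ?act h ?u + ?b"] conjI)
    qed
  qed
qed

end
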